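(* Up to isomorphism there are exactly $15$ right Bol loops of order $27$, of which exactly five are groups (so exactly ten are nonassociative).
   Context: A loop is a set with a binary multiplication and a two-sided identity $1$ in which all left and right translations are bijections. A loop is right Bol if it satisfies $((xy)z)y=x((yz)y)$ for all $x,y,z$. *)

theory Defs
  imports Main
begin

definition is_loop :: "'a set \<Rightarrow> ('a \<Rightarrow> 'a \<Rightarrow> 'a) \<Rightarrow> bool" where
  "is_loop G m \<longleftrightarrow>
     (\<forall>x\<in>G. \<forall>y\<in>G. m x y \<in> G) \<and>
     (\<exists>e\<in>G. \<forall>x\<in>G. m e x = x \<and> m x e = x) \<and>
     (\<forall>a\<in>G. bij_betw (\<lambda>x. m a x) G G \<and> bij_betw (\<lambda>x. m x a) G G)"

definition is_right_bol_loop :: "'a set \<Rightarrow> ('a \<Rightarrow> 'a \<Rightarrow> 'a) \<Rightarrow> bool" where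
  "is_right_bol_loop G m \<longleftrightarrow> is_loop G m \<and>
     (\<forall>x\<in>G. \<forall>y\<in>G. \<forall>z\<in>G. m (m (m x y) z) y = m x (m (m y z) y))"

definition is_associative_on :: "'a set \<Rightarrow> ('a \<Rightarrow> 'a \<Rightarrow> 'a) \<Rightarrow> bool" where
  "is_associative_on G m \<longleftrightarrow> (\<forall>x\<in>G. \<forall>y\<in>G. \<forall>z\<in>G. m (m x y) z = m x (m y z))"

definition magma_iso :: "'a set \<Rightarrow> ('a \<Rightarrow> 'a \<Rightarrow> 'a) \<Rightarrow> 'b set \<Rightarrow> ('b \<Rightarrow> 'b \<Rightarrow> 'b) \<Rightarrow> bool" where
  "magma_iso G m H n \<longleftrightarrow> (\<exists>f. bij_betw f G H \<and> (\<forall>x\<in>G. \<forall>y\<in>G. f (m x y) = n (f x) (f y)))"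

text \<open>Every loop of order 27 is isomorphic to one whose carrier is {0..<27}.\<close>
definition bol27 :: "(nat \<Rightarrow> nat \<Rightarrow> nat) set" where
  "bol27 = {m. is_right_bol_loop {0..<27} m}"

definition iso27 :: "((nat \<Rightarrow> nat \<Rightarrow> nat) \<times> (nat \<Rightarrow> nat \<Rightarrow> nat)) set" where
  "iso27 = {(m, n). m \<in> bol27 \<and> n \<in> bol27 \<and> magma_iso {0..<27} m {0..<27} n}"

end

theory Submission
  imports Defs "HOL-Library.Numeral_Type"
begin

text \<open>
The right multiplications \<open>R x\<close> of a right Bol loop form a set \<open>S\<close> of permutations closed under
\<open>s + t + s\<close> (groups are written additively), and \<open>S\<close> determines the loop. In order 27 the nonzero elements of
\<open>S\<close> are fixed-point-free of order dividing 27, and square roots in \<open>S\<close> are unique. An element of order 27 makes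
the loop cyclic.

If there are elements of order 9 but none of order 27, take \<open>t\<close> of order 9 and \<open>f\<close> in \<open>S\<close> outside
\<open>\<langle>t\<rangle>\<close>. Then \<open>S\<close> consists of the elements \<open>n t\<close>, \<open>n t + f + n t\<close> and \<open>n t - f + n t\<close>. Since
\<open>f + n t + f = k t - f + k t\<close> for suitable \<open>k\<close>, the sum \<open>(n + k) t\<close> commutes with \<open>f\<close>; this leads to
\<open>3 t\<close> being central, and the loop is determined by the cubes of \<open>f\<close>, \<open>f + t\<close>, \<open>f - t\<close> and one commutator, four
numbers modulo 3. All 81 values occur in ten central extensions of an elementary abelian group of order 9: five
binary cubic forms describing cubing, each with or without an alternating term.

In exponent 3 the maps \<open>P x\<close> sending \<open>y\<close> to \<open>(x y) x\<close> commute, by counting points of a Heisenberg group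
action, hence the commutators of right multiplications are central. What remains is linear algebra over the field
with three elements: the elementary abelian group, the Heisenberg group, and one loop for each similarity class, up to
sign, of 2 by 2 matrices without eigenvalues.
\<close>

text \<open>An equation between permutations cannot simply be tested at the identity: the group
  generated by the right multiplications may be larger than the loop, with nontrivial point
  stabilisers. Two kinds of permutation are controlled by a single point: conjugates of elements of
  \<open>S\<close>, and permutations commuting with all of \<open>S\<close>; either is zero as soon
  as it fixes a point. Most computations bring a word into one of these forms. Since only symmetric
  products \<open>s + t + s\<close> are known to stay in \<open>S\<close>, words are balanced by
  halving, with \<open>14\<close>, \<open>5\<close> and \<open>2\<close> as inverses of
  \<open>2\<close> modulo 27, 9 and 3. In the order 9 case the commutator of \<open>f\<close> and
  \<open>t\<close> need not be central; it is recorded by its effect at one point, and its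
  commutators with \<open>f\<close> and \<open>t\<close>, which are central, carry that value
  elsewhere. In exponent 3 a central permutation need not lie in \<open>S\<close>, and the element
  of \<open>S\<close> agreeing with it at the identity may fail to be central; the matrices without
  eigenvalues describe how such elements commute with a third generator.\<close>

subsection \<open>Multiples and commuting elements in noncommutative additive groups\<close>

text \<open>Groups are written additively throughout, because \<^class>\<open>group_add\<close> is the library's type class for
groups that need not be commutative. The rule turned off here would hide the shape of group words.\<close>

declare add_uminus_conv_diff [simp del] add_uminus_conv_diff [where 'a = int, simp]
  add_uminus_conv_diff [where 'a = 3, simp]

fun nmul :: "nat \<Rightarrow> 'g::group_add \<Rightarrow> 'g" where
  "nmul 0 s = 0" | "nmul (Suc n) s = s + nmul n s"

lemma nmul_comm: "nmul n s + s = s + nmul n s"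
  by (induction n) (simp_all add: add.assoc)

definition zmul :: "int \<Rightarrow> 'g::group_add \<Rightarrow> 'g" where
  "zmul n s = nmul (nat n) s - nmul (nat (- n)) s"

lemma zmul_0 [simp]: "zmul 0 s = 0"
  by (simp add: zmul_def)

lemma zmul_succ: "zmul (n + 1) s = s + zmul n s"
proof (cases "n \<ge> 0")
  case True
  then have "nat (n + 1) = Suc (nat n)" "nat (- n) = 0" "nat (- (n + 1)) = 0" by auto
  then show ?thesis by (simp add: zmul_def)
next
  case False
  define k where "k = nat (- (n + 1))"
  have k: "nat (- n) = Suc k" "nat (- (n + 1)) = k" "nat n = 0" "nat (n + 1) = 0"
    using False by (auto simp: k_def)
  have "zmul n s = - s + - nmul k s"
    using nmul_comm[of k s] by (simp add: zmul_def k minus_add[symmetric] del: add_uminus_conv_diff)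
  moreover have "zmul (n + 1) s = - nmul k s" by (simp only: zmul_def k) simp
  ultimately show ?thesis by (simp add: add.assoc[symmetric] del: add_uminus_conv_diff)
qed

lemma zmul_add: "zmul (m + n) s = zmul m s + zmul n s"
proof (induction m rule: int_induct[where k = 0])
  case base
  then show ?case by simp
next
  case (step1 i)
  have "zmul (i + 1 + n) s = s + zmul (i + n) s"
    using zmul_succ[of "i + n" s] by (simp add: algebra_simps)
  then show ?case using step1 by (simp add: zmul_succ add.assoc)
next
  case (step2 i)
  have "zmul (i + n) s = s + zmul (i - 1 + n) s" "zmul i s = s + zmul (i - 1) s"
    using zmul_succ[of "i - 1 + n" s] zmul_succ[of "i - 1" s] by (simp_all add: algebra_simps)
  then show ?case using step2 by (metis add.assoc add_left_cancel)
qed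

lemma zmul_1 [simp]: "zmul 1 s = s"
  using zmul_succ[of 0 s] by simp

lemma zmul_minus: "zmul (- n) s = - zmul n s"
  using zmul_add[of "- n" n s] by (simp add: eq_neg_iff_add_eq_0)

lemma zmul_diff: "zmul (m - n) s = zmul m s + - zmul n s"
  using zmul_add[of m "- n" s] by (simp add: zmul_minus)

lemma zmul_comm: "zmul m s + zmul n s = zmul n s + zmul m s"
  by (metis add.commute zmul_add)

lemma zmul_zmul: "zmul m (zmul n s) = zmul (m * n) s"
proof (induction m rule: int_induct[where k = 0])
  case base
  then show ?case by simp
next
  case (step1 i)
  then have "zmul (n + i * n) s = zmul n s + zmul i (zmul n s)" by (simp only: zmul_add)
  then show ?case using zmul_succ[of i "zmul n s"] by (simp add: algebra_simps)
next
  case (step2 i)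
  have "zmul i (zmul n s) = zmul n s + zmul (i - 1) (zmul n s)"
    using zmul_succ[of "i - 1" "zmul n s"] by simp
  moreover have "zmul (i * n) s = zmul n s + zmul ((i - 1) * n) s"
    using zmul_add[of n "(i - 1) * n" s] by (simp add: algebra_simps)
  ultimately show ?case using step2 by simp
qed

lemma zmul_zero [simp]: "zmul n 0 = (0::'g::group_add)"
  by (metis add.right_neutral add_left_cancel mult_zero_right zmul_0 zmul_zmul)

lemma comm_neg: "a + b = b + a \<Longrightarrow> - a + b = b + - a" for a :: "'g::group_add"
  by (metis add.assoc add.left_inverse add_0 add.right_inverse add.right_neutral)

lemma comm_plus: "a + c = c + a \<Longrightarrow> b + c = c + b \<Longrightarrow> (a + b) + c = c + (a + b)"
  for a :: "'g::group_add"
  by (metis add.assoc)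

lemma comm_zmul: "a + b = b + a \<Longrightarrow> zmul n a + b = b + zmul n a"
proof (induction n rule: int_induct[where k = 0])
  case base
  then show ?case by simp
next
  case (step1 i)
  then show ?case by (simp add: zmul_succ comm_plus)
next
  case (step2 i)
  have "zmul (i - 1) a = - a + zmul i a"
    using zmul_add[of "-1" i a] by (simp add: zmul_minus)
  then show ?case using step2 by (simp add: comm_plus comm_neg)
qed

lemma zmul_plus: "a + b = b + a \<Longrightarrow> zmul n (a + b) = zmul n a + zmul n b"
proof (induction n rule: int_induct[where k = 0])
  case base
  then show ?case by simp
next
  case (step1 i)
  then have c: "zmul i a + b = b + zmul i a" by (intro comm_zmul)
  have "zmul (i + 1) (a + b) = a + (b + zmul i a) + zmul i b"
    by (simp only: zmul_succ add.assoc step1(2)[OF step1(3)])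
  also have "\<dots> = a + (zmul i a + b) + zmul i b" by (simp only: c)
  finally show ?case by (simp add: zmul_succ add.assoc)
next
  case (step2 i)
  have m: "zmul (i - 1) x = zmul i x + - x" for x :: 'a
    using zmul_diff[of i 1 x] by simp
  have c: "- a + zmul i b = zmul i b + - a"
    using step2(3) by (metis comm_neg comm_zmul)
  have "zmul (i - 1) (a + b) = zmul i a + zmul i b + (- b + - a)"
    using step2 by (simp only: m) (metis minus_add)
  also have "- b + - a = - a + - b"
    using step2(3) by (metis minus_add)
  also have "zmul i a + zmul i b + (- a + - b) = zmul i a + (zmul i b + - a) + - b"
    by (simp only: add.assoc)
  also have "\<dots> = zmul i a + (- a + zmul i b) + - b" by (simp only: c)
  finally show ?case by (simp only: m add.assoc)
qed

lemma zmul_conj: "zmul n (- g + s + g) = - g + zmul n s + g"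
proof (induction n rule: int_induct[where k = 0])
  case base
  then show ?case by simp
next
  case (step1 i)
  then show ?case by (simp add: zmul_succ add.assoc)
next
  case (step2 i)
  have m: "zmul (i - 1) x = - x + zmul i x" for x :: 'a
    using zmul_add[of "-1" i x] by (simp add: zmul_minus)
  show ?case by (simp only: m step2) (simp add: add.assoc minus_add del: add_uminus_conv_diff)
qed

lemma zmul_mod: "zmul m s = 0 \<Longrightarrow> zmul (n mod m) s = zmul n s"
  by (metis add_0 mult.commute mult_div_mod_eq zmul_add zmul_zero zmul_zmul)

subsection \<open>Permutations acting on the right\<close>

text \<open>In \<open>p + q\<close> the permutation \<open>p\<close> is applied first.\<close>

typedef 'a sym = "{f :: 'a \<Rightarrow> 'a. bij f}"
  using bij_id by blast

definition act :: "'a \<Rightarrow> 'a sym \<Rightarrow> 'a" (infixl "\<triangleleft>" 70) where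
  "x \<triangleleft> p = Rep_sym p x"

instantiation sym :: (type) group_add
begin

definition "0 = Abs_sym id"
definition "p + q = Abs_sym (Rep_sym q \<circ> Rep_sym p)"
definition "- p = Abs_sym (inv (Rep_sym p))"
definition "p - q = p + - (q :: 'a sym)"

lemma bij_Rep: "bij (Rep_sym p)"
  using Rep_sym by blast

instance
proof
  fix p q r :: "'a sym"
  show "p + q + r = p + (q + r)"
    by (simp add: plus_sym_def Abs_sym_inverse bij_comp bij_Rep comp_assoc)
  show "0 + p = p" "p + 0 = p"
    by (simp_all add: plus_sym_def zero_sym_def Abs_sym_inverse bij_Rep Rep_sym_inverse)
  show "- p + p = 0"
  proof -
    have "Rep_sym p \<circ> inv (Rep_sym p) = id"
      using bij_Rep[of p] by (metis bij_is_surj surj_iff)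
    then show ?thesis
      by (simp add: plus_sym_def uminus_sym_def zero_sym_def Abs_sym_inverse bij_imp_bij_inv bij_Rep)
  qed
  show "p + - q = p - q" by (simp add: minus_sym_def)
qed

end

lemma act_0 [simp]: "x \<triangleleft> 0 = x"
  by (simp add: act_def zero_sym_def Abs_sym_inverse)

lemma act_plus: "x \<triangleleft> (p + q) = x \<triangleleft> p \<triangleleft> q"
  by (simp add: act_def plus_sym_def Abs_sym_inverse bij_comp bij_Rep)

lemma act_ext: "(\<And>x. x \<triangleleft> p = x \<triangleleft> q) \<Longrightarrow> p = q"
  by (metis Rep_sym_inject act_def ext)

lemma act_neg [simp]: "x \<triangleleft> p \<triangleleft> - p = x" "x \<triangleleft> - p \<triangleleft> p = x"
  by (metis act_0 act_plus add.right_inverse) (metis act_0 act_plus add.left_inverse)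

lemma act_inj: "x \<triangleleft> p = y \<triangleleft> p \<longleftrightarrow> x = y"
  by (metis act_neg(1))

lemma act_eq_iff: "x \<triangleleft> p = x \<triangleleft> q \<longleftrightarrow> x \<triangleleft> (p + - q) = x"
  by (metis act_neg(1) act_neg(2) act_plus)

lemma fix_zmul: "x \<triangleleft> p = x \<Longrightarrow> x \<triangleleft> zmul n p = x"
proof (induction n rule: int_induct[where k = 0])
  case base
  then show ?case by simp
next
  case (step1 i)
  then show ?case by (simp add: zmul_succ act_plus)
next
  case (step2 i)
  have "zmul i p = p + zmul (i - 1) p"
    using zmul_succ[of "i - 1" p] by simp
  then show ?case using step2 by (simp add: act_plus)
qed

lemma fix_conj: "x \<triangleleft> (- g + p + g) = x \<Longrightarrow> (x \<triangleleft> - g) \<triangleleft> p = x \<triangleleft> - g"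
  by (metis act_inj act_neg(2) act_plus)

text \<open>No nonzero multiple of \<open>p\<close> fixes a point, so all orbits of its multiples
  have the same length \<open>m\<close>, the order of \<open>p\<close>, and they partition the
  set.\<close>

lemma semiregular_order:
  fixes p :: "'a::finite sym"
  assumes fp: "\<And>n x. x \<triangleleft> zmul n p = x \<Longrightarrow> zmul n p = 0"
  obtains m where "m > 0" "m dvd CARD('a)" "zmul (int m) p = 0"
    "\<And>n. zmul n p = 0 \<Longrightarrow> int m dvd n"
proof -
  define x0 :: 'a where "x0 = undefined"
  have "\<not> inj (\<lambda>n::nat. x0 \<triangleleft> zmul (int n) p)"
    using finite_imageD[of "\<lambda>n::nat. x0 \<triangleleft> zmul (int n) p" UNIV] by auto
  then obtain a b where ab: "a < b" "x0 \<triangleleft> zmul (int a) p = x0 \<triangleleft> zmul (int b) p"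
    by (metis (no_types, lifting) injI linorder_neqE_nat)
  then have "x0 \<triangleleft> zmul (int b - int a) p = x0"
    by (metis act_eq_iff zmul_diff)
  then have e0: "\<exists>m. m > 0 \<and> zmul (int m) p = 0"
    using fp ab(1) by (intro exI[of _ "b - a"]) (auto simp: of_nat_diff)
  define m where "m = (LEAST m. m > 0 \<and> zmul (int m) p = 0)"
  have m: "m > 0" "zmul (int m) p = 0"
    using LeastI_ex[OF e0] by (auto simp: m_def)
  have min: "k = 0" if "k < m" "zmul (int k) p = 0" for k
    using that not_less_Least[of k "\<lambda>m. m > 0 \<and> zmul (int m) p = 0"] by (auto simp: m_def)
  have dv: "int m dvd n" if "zmul n p = 0" for n
  proof -
    have "zmul (n mod int m) p = 0" using zmul_mod[OF m(2)] that by simp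
    then have "nat (n mod int m) = 0"
      using m(1) by (intro min) (auto simp: nat_less_iff)
    then show ?thesis using m(1) by (simp add: dvd_eq_mod_eq_0)
      (metis Euclidean_Rings.pos_mod_sign nat_0_iff of_nat_0_less_iff order_antisym)
  qed
  define orb where "orb x = (\<lambda>n. x \<triangleleft> zmul n p) ` UNIV" for x
  have orb_eq: "orb x = (\<lambda>n. x \<triangleleft> zmul (int n) p) ` {..<m}" for x
  proof -
    have "x \<triangleleft> zmul n p = x \<triangleleft> zmul (int (nat (n mod int m))) p \<and> nat (n mod int m) < m" for n
      using m zmul_mod[OF m(2), of n] by (simp add: nat_less_iff)
    then show ?thesis unfolding orb_def by blast
  qed
  have "inj_on (\<lambda>n. x \<triangleleft> zmul (int n) p) {..<m}" for x
  proof (rule inj_onI)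
    fix i j assume ij: "i \<in> {..<m}" "j \<in> {..<m}" "x \<triangleleft> zmul (int i) p = x \<triangleleft> zmul (int j) p"
    then have "zmul (int i - int j) p = 0" by (metis act_eq_iff fp zmul_diff)
    then have "int m dvd int i - int j" by (rule dv)
    then have "int i mod int m = int j mod int m" by (simp add: mod_eq_dvd_iff)
    then show "i = j" using ij by auto
  qed
  then have card_orb: "card (orb x) = m" for x
    by (simp add: orb_eq card_image)
  have orb_sub: "orb y \<subseteq> orb x" if yx: "y \<in> orb x" for x y
  proof -
    obtain n where "y = x \<triangleleft> zmul n p" using yx by (auto simp: orb_def)
    then have "y \<triangleleft> zmul k p = x \<triangleleft> zmul (n + k) p" for k by (simp add: zmul_add act_plus)
    then show ?thesis by (auto simp: orb_def)
  qed
  have self: "x \<in> orb x" for x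
    unfolding orb_def by (rule image_eqI[of _ _ 0]) auto
  have orb_sym: "x \<in> orb y" if yx: "y \<in> orb x" for x y
  proof -
    obtain n where "y = x \<triangleleft> zmul n p" using yx by (auto simp: orb_def)
    then have "x = y \<triangleleft> zmul (- n) p" by (simp add: zmul_minus)
    then show ?thesis by (auto simp: orb_def)
  qed
  have "m * card (range orb) = card (\<Union> (range orb))"
  proof (rule card_partition)
    show "card c = m" if "c \<in> range orb" for c using that card_orb by auto
    show "c1 \<inter> c2 = {}" if "c1 \<in> range orb" "c2 \<in> range orb" "c1 \<noteq> c2" for c1 c2
    proof (rule ccontr)
      assume "c1 \<inter> c2 \<noteq> {}"
      then obtain x y z where "c1 = orb x" "c2 = orb y" "z \<in> orb x" "z \<in> orb y" using \<open>c1 \<in> range orb\<close> \<open>c2 \<in> range orb\<close> by auto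
      then have "c1 = orb z" "c2 = orb z" using orb_sub orb_sym by (metis subset_antisym)+
      then show False using \<open>c1 \<noteq> c2\<close> by simp
    qed
  qed auto
  moreover have "\<Union> (range orb) = UNIV" using self by auto
  ultimately have "m dvd CARD('a)" by (metis dvd_triv_left)
  then show thesis using that m dv by blast
qed

subsection \<open>Right Bol loops\<close>

locale rbol =
  fixes mul :: "'a::finite \<Rightarrow> 'a \<Rightarrow> 'a" (infixl "\<cdot>" 70) and e :: 'a
  assumes eL [simp]: "e \<cdot> x = x" and eR [simp]: "x \<cdot> e = x"
    and bol: "((x \<cdot> y) \<cdot> z) \<cdot> y = x \<cdot> ((y \<cdot> z) \<cdot> y)"
    and injL: "x \<cdot> y = x \<cdot> z \<Longrightarrow> y = z" and injR: "y \<cdot> x = z \<cdot> x \<Longrightarrow> y = z"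
begin

definition R :: "'a \<Rightarrow> 'a sym" where "R x = Abs_sym (\<lambda>y. y \<cdot> x)"

lemma act_R [simp]: "y \<triangleleft> R x = y \<cdot> x"
proof -
  have "inj (\<lambda>y. y \<cdot> x)" by (meson injI injR)
  then have "bij (\<lambda>y. y \<cdot> x)" by (simp add: bij_def finite_UNIV_inj_surj)
  then show ?thesis by (simp add: act_def R_def Abs_sym_inverse)
qed

lemma R_bol: "R ((x \<cdot> y) \<cdot> x) = R x + R y + R x"
  by (rule act_ext) (simp add: act_plus bol)

lemma R_e [simp]: "R e = 0"
  by (rule act_ext) simp

lemma R_inj: "v \<triangleleft> R x = v \<triangleleft> R y \<Longrightarrow> x = y"
  using injL by simp

text \<open>For \<open>y\<close> with \<open>x \<cdot> y = e\<close> the Bol law turns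
  \<open>R x + R y + R x\<close> into \<open>R x\<close>; cancelling gives the inverse.\<close>

lemma R_neg: "\<exists>y. R y = - R x"
proof -
  have "inj (\<lambda>y. x \<cdot> y)" by (meson injI injL)
  then have "surj (\<lambda>y. x \<cdot> y)" by (simp add: finite_UNIV_inj_surj)
  then obtain y where "x \<cdot> y = e" by (metis surjD)
  then have "R x + R y + R x = R x" using R_bol[of x y] by simp
  then have "R y + R x = 0" by (metis add.assoc add.right_neutral add_left_cancel)
  then have "R y = - R x" by (simp add: eq_neg_iff_add_eq_0)
  then show ?thesis by blast
qed

definition S :: "'a sym set" where "S = range R"

lemma S_0 [simp]: "0 \<in> S"
  by (metis R_e S_def rangeI)

lemma S_R [simp]: "R x \<in> S"
  by (simp add: S_def)

lemma S_tw: "s \<in> S \<Longrightarrow> t \<in> S \<Longrightarrow> s + t + s \<in> S"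
  by (auto simp: S_def simp flip: R_bol)

lemma S_neg: "s \<in> S \<Longrightarrow> - s \<in> S"
  by (metis R_neg S_def imageE rangeI)

lemma S_pt: "s \<in> S \<Longrightarrow> R (e \<triangleleft> s) = s"
  using S_def by auto

lemma S_eq: "s \<in> S \<Longrightarrow> t \<in> S \<Longrightarrow> v \<triangleleft> s = v \<triangleleft> t \<Longrightarrow> s = t"
  by (metis R_inj S_pt)

lemma S_fix: "s \<in> S \<Longrightarrow> v \<triangleleft> s = v \<Longrightarrow> s = 0"
  using S_eq[of s 0 v] by simp

text \<open>Only symmetric products stay in \<open>S\<close>, so the induction goes down by two,
  taking one \<open>s\<close> off each end.\<close>

lemma S_nmul: "s \<in> S \<Longrightarrow> nmul n s \<in> S"
proof (induction n rule: less_induct)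
  case (less n)
  show ?case
  proof (cases "n < 2")
    case True
    then have "n = 0 \<or> n = 1" by auto
    then show ?thesis using less.prems by auto
  next
    case False
    then obtain m where m: "n = Suc (Suc m)" by (metis add_2_eq_Suc le_Suc_ex not_less)
    then have "nmul n s = s + nmul m s + s" by (simp add: nmul_comm add.assoc)
    then show ?thesis using less m by (simp add: S_tw)
  qed
qed

lemma S_zmul: "s \<in> S \<Longrightarrow> zmul n s \<in> S"
  by (cases "n \<ge> 0") (auto simp: zmul_def S_nmul S_neg)

lemma S_fix_conj: "s \<in> S \<Longrightarrow> v \<triangleleft> (- g + s + g) = v \<Longrightarrow> s = 0"
  by (metis fix_conj S_fix)

lemma R_zmul_act: "s \<in> S \<Longrightarrow> R (e \<triangleleft> zmul n s) = zmul n s"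
  by (simp add: S_pt S_zmul)

end

locale rbol27 = rbol mul e for mul :: "'a::finite \<Rightarrow> 'a \<Rightarrow> 'a" (infixl "\<cdot>" 70) and e +
  assumes card27: "CARD('a) = 27"
begin

lemma zmul27: "s \<in> S \<Longrightarrow> zmul 27 s = 0"
proof -
  assume s: "s \<in> S"
  obtain m where m: "m dvd CARD('a)" "zmul (int m) s = 0"
    using semiregular_order[of s] S_fix S_zmul[OF s] by metis
  then obtain k where "27 = int m * k" using card27
    by (metis dvd_def of_nat_dvd_iff of_nat_numeral)
  then show ?thesis using m(2) by (metis mult.commute zmul_zero zmul_zmul)
qed

lemma sqrt_unique: "s \<in> S \<Longrightarrow> t \<in> S \<Longrightarrow> s + s = t + t \<Longrightarrow> s = t"
proof -
  assume st: "s \<in> S" "t \<in> S" "s + s = t + t"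
  \<comment> \<open>\<open>14\<close> inverts \<open>2\<close> modulo 27, so \<open>x\<close> is
    recovered from \<open>x + x\<close>.\<close>
  have *: "zmul 14 (x + x) = x" if "x \<in> S" for x
  proof -
    have "x + x = zmul 2 x" using zmul_add[of 1 1 x] by simp
    then have "zmul 14 (x + x) = zmul (27 + 1) x" by (simp add: zmul_zmul)
    also have "\<dots> = x" using zmul27[OF that] by (simp only: zmul_add) simp
    finally show ?thesis .
  qed
  then show ?thesis using st by metis
qed

end

subsection \<open>Loops with an element of order 9 or 27\<close>

lemma eq_of_dvd_diff: "n \<in> {0..<k} \<Longrightarrow> m \<in> {0..<k} \<Longrightarrow> k dvd n - m \<Longrightarrow> n = m" for n m k :: int
  by (metis atLeastLessThan_iff mod_eq_dvd_iff mod_pos_pos_trivial)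

lemma nine_dvd: "9 dvd 3 * x \<longleftrightarrow> x mod 3 = 0" "9 dvd 6 * x \<longleftrightarrow> x mod 3 = 0"
  "\<not> 9 dvd 1 + 3 * x" "\<not> 9 dvd - 1 + 3 * x" for x :: int
  by presburger+

text \<open>Solving \<open>h\<close> for \<open>f + - q + f\<close> from either side gives
  \<open>- p + - f + q\<close> and \<open>q + - f + - p\<close>; adding \<open>p\<close> at both
  ends of this equality yields the commutation.\<close>

lemma twist_comm:
  fixes f :: "'g::group_add"
  assumes pq: "p + q = q + p" and h: "f + p + f = q + - f + q"
  shows "(p + q) + f = f + (p + q)"
proof -
  have i: "f + p + (f + - q + f) = q"
  proof -
    have "f + p + (f + - q + f) = (f + p + f) + - q + f" by (simp only: add.assoc)
    also have "\<dots> = q" by (simp only: h) (simp add: add.assoc)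
    finally show ?thesis .
  qed
  have ii: "(f + - q + f) + p + f = q"
  proof -
    have "- q + (f + p + f) = - q + (q + - f + q)" by (simp only: h)
    also have "\<dots> = - f + q" by (simp add: add.assoc)
    finally show ?thesis by (simp add: add.assoc)
  qed
  have "- p + - f + q = q + - f + - p"
  proof -
    have "f + - q + f = - p + - f + q"
      using i by (metis add.assoc add_0 add.left_inverse minus_add)
    moreover have "f + - q + f = q + - f + - p"
    proof -
      have "f + - q + f = ((f + - q + f) + p + f) + - f + - p" by (simp add: add.assoc)
      then show ?thesis by (simp only: ii)
    qed
    ultimately show ?thesis by simp
  qed
  then have "p + (- p + - f + q) + p = p + (q + - f + - p) + p" by simp
  then have "- f + (q + p) = (p + q) + - f" by (simp add: add.assoc)
  then have "- f + (p + q) = (p + q) + - f" by (simp only: pq)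
  then show ?thesis using comm_neg[of "- f" "p + q"] by simp
qed

lemma twist_cube:
  fixes f :: "'g::group_add"
  assumes pq: "p + q = q + p" and h: "f + p + f = q + - f + q"
  shows "f + p + f + p + f + p = p + q + (p + q)"
proof -
  have c: "- f + (p + q) = (p + q) + - f"
    by (rule comm_neg) (metis twist_comm[OF pq h])
  have "f + p + f + p + f + p = (q + - f + q) + p + f + p" by (simp only: h)
  also have "\<dots> = q + (- f + (p + q)) + f + p" by (simp only: pq add.assoc)
  also have "\<dots> = q + (p + q) + p"
    by (simp only: c) (simp add: add.assoc)
  also have "\<dots> = (q + p) + (q + p)" by (simp only: add.assoc)
  also have "\<dots> = (p + q) + (p + q)" by (simp only: pq)
  finally show ?thesis .
qed

text \<open>Multiplicatively, \<open>f^-2 u f^2 . f^-1 u f . u = f^-3 (f u)^3\<close>: the cubes of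
  \<open>f\<close> and \<open>f + u\<close> determine the product of three successive conjugates of
  \<open>u\<close>.\<close>

lemma conj_cube:
  fixes f :: "'g::group_add"
  shows "(- f + (- f + u + f) + f) + (- f + u + f) + u = - (f + f + f) + (f + u + f + u + f + u)"
  by (simp add: add.assoc minus_add)

text \<open>\<open>conj_cube\<close> at \<open>t\<close> and at \<open>- t\<close> gives the double
  conjugate of \<open>t\<close> with the two summands in either order; so \<open>t\<close> commutes
  with its conjugate by \<open>f\<close>.\<close>

lemma cube_conj:
  fixes f :: "'g::group_add"
  assumes "f + f + f = 0" "f + t + f + t + f + t = 0" "f + - t + f + - t + f + - t = 0"
  shows "- f + (- f + t + f) + f = - ((- f + t + f) + t)" "- f + (- f + t + f) + f = - (t + (- f + t + f))"
proof -
  define s where "s = - f + t + f"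
  define s2 where "s2 = - f + s + f"
  have "s2 + s + t = 0"
    using conj_cube[of f t] by (simp only: s_def s2_def assms) simp
  then have a: "s2 = - (s + t)" by (simp add: add.assoc eq_neg_iff_add_eq_0)
  have ns: "- f + - t + f = - s" "- f + - s + f = - s2" by (simp_all add: s_def s2_def minus_add add.assoc)
  have "- s2 + - s + - t = 0"
    using conj_cube[of f "- t"] by (simp only: ns assms) simp
  then have "t + s + s2 = 0" by (metis add.assoc minus_add minus_minus neg_equal_0_iff_equal)
  then have b: "s2 = - (t + s)" by (metis add_eq_0_iff2 minus_minus add_eq_0_iff)
  show "- f + (- f + t + f) + f = - ((- f + t + f) + t)" "- f + (- f + t + f) + f = - (t + (- f + t + f))"
    using a b by (simp_all only: s_def s2_def)
qed

section \<open>Halving in \<open>S\<close>, fixed points of sandwich maps, and the cyclic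
  loop\<close>

context rbol27
begin

lemma half: "s \<in> S \<Longrightarrow> \<exists>p \<in> S. s = p + p"
proof -
  assume s: "s \<in> S"
  have "zmul 14 s + zmul 14 s = zmul (27 + 1) s" by (simp flip: zmul_add)
  also have "\<dots> = s" using zmul27[OF s] by (simp only: zmul_add) simp
  finally show ?thesis using S_zmul[OF s] by metis
qed

text \<open>Here and in the next two lemmas one element is halved into \<open>p + p\<close>; the
  hypothesis then equates the doubles of two elements of \<open>S\<close>, and unique square roots
  apply.\<close>

lemma P_fix:
  assumes "s \<in> S" "r \<in> S" "s + r + s = r" shows "s = 0"
proof -
  obtain p where p: "p \<in> S" "r = p + p" using half assms by blast
  have "(p + s + p) + (p + s + p) = p + (s + r + s) + p" by (simp add: p add.assoc)
  also have "\<dots> = p + r + p" by (simp only: assms(3))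
  also have "\<dots> = (p + p) + (p + p)" by (simp add: p add.assoc)
  finally have "p + s + p = p + p"
    by (rule sqrt_unique[OF S_tw[OF p(1) assms(1)] assms(2)[unfolded p(2)]])
  then have "p + s = p" by (rule add_right_imp_eq)
  then show ?thesis by (metis add.right_neutral add_left_cancel)
qed

lemma P_swap:
  assumes "s \<in> S" "r \<in> S" "r = s + - r + s" shows "r = s"
proof -
  obtain p where p: "p \<in> S" "r = p + p" using half assms by blast
  let ?w = "- p + s + - p"
  have w: "?w \<in> S" using S_tw[OF S_neg[OF p(1)] assms(1)] by simp
  have "?w + ?w = - p + (s + - r + s) + - p"
    by (simp add: p add.assoc minus_add del: add_uminus_conv_diff)
  also have "\<dots> = - p + r + - p" by (simp only: assms(3)[symmetric])
  also have "\<dots> = 0 + 0" by (simp add: p(2) add.assoc)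
  finally have "?w = 0" by (rule sqrt_unique[OF w S_0])
  moreover have "s = p + ?w + p" by (simp add: add.assoc)
  ultimately have "s = p + p" by simp
  then show ?thesis using p(2) by simp
qed

lemma P_sq:
  assumes "s \<in> S" "g \<in> S" "g + g = s + g + s" shows "g = s + s"
proof -
  obtain p where p: "p \<in> S" "g = p + p" using half assms by blast
  have "(p + s + p) + (p + s + p) = p + (s + g + s) + p" by (simp add: p add.assoc)
  also have "\<dots> = p + (g + g) + p" by (simp only: assms(3))
  also have "\<dots> = (p + p + p) + (p + p + p)" by (simp add: p add.assoc)
  finally have "p + s + p = p + p + p"
    by (rule sqrt_unique[OF S_tw[OF p(1) assms(1)] S_tw[OF p(1) p(1)]])
  then show ?thesis by (simp add: p add.assoc)
qed

lemma card_S: "card S = 27"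
proof -
  have "inj R" by (metis R_inj injI)
  then show ?thesis by (simp add: S_def card_image card27)
qed

text \<open>The multiples of \<open>a\<close> lie in \<open>S\<close> and already move
  \<open>e\<close> to 27 different points, so they are all the right multiplications.\<close>

lemma cyclic:
  assumes a: "a \<in> S" "zmul 9 a \<noteq> 0"
  shows "\<exists>h. bij_betw h {0..<27::nat} UNIV \<and> (\<forall>x y. h ((x + y) mod 27) = h x \<cdot> h y)"
proof -
  have dv: "27 dvd n" if n: "zmul n a = 0" for n
  proof -
    have no: "3 dvd k" if k: "zmul (9 * k) a = 0" for k
    proof -
      have m: "zmul (9 * (k mod 3)) a = 0"
        using zmul_mod[OF zmul27[OF a(1)], of "9 * k"] k by (simp add: mult_mod_right)
      have "k mod 3 \<noteq> 1" using m a(2) by auto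
      moreover have "k mod 3 \<noteq> 2"
      proof
        assume "k mod 3 = 2"
        then have "zmul 2 (zmul 18 a) = 0" using m by simp
        then have "zmul (36 mod 27) a = 0" by (simp only: zmul_zmul zmul_mod[OF zmul27[OF a(1)]]) simp
        then show False using a(2) by simp
      qed
      ultimately show ?thesis by presburger
    qed
    have mul: "zmul (k * n) a = 0" for k using n by (metis zmul_zero zmul_zmul)
    obtain m where m: "n = 3 * m" using no mul[of 9] by (auto simp: dvd_def)
    obtain l where l: "m = 3 * l" using no[of m] mul[of 3] m by (auto simp: dvd_def)
    then show ?thesis using no[of l] n m by (auto simp: dvd_def)
  qed
  define h where "h n = e \<triangleleft> zmul (int n) a" for n :: nat
  have hom: "h ((x + y) mod 27) = h x \<cdot> h y" for x y
  proof -
    have "h x \<cdot> h y = e \<triangleleft> zmul (int x) a \<triangleleft> R (h y)" by (simp add: h_def)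
    also have "\<dots> = e \<triangleleft> zmul (int (x + y)) a"
      by (simp add: h_def R_zmul_act a zmul_add act_plus)
    also have "\<dots> = h ((x + y) mod 27)"
      using zmul_mod[OF zmul27[OF a(1)], of "int (x + y)"] by (simp add: h_def zmod_int)
    finally show ?thesis by simp
  qed
  have inj: "inj_on h {0..<27}"
  proof (rule inj_onI)
    fix x y assume xy: "x \<in> {0..<27}" "y \<in> {0..<27}" "h x = h y"
    then have "e \<triangleleft> zmul (int x - int y) a = e"
      by (simp add: h_def act_eq_iff zmul_diff)
    then have "27 dvd int x - int y" using dv S_fix S_zmul a(1) by metis
    moreover have "\<bar>int x - int y\<bar> < 27" using xy by auto
    ultimately have "int x - int y = 0" using dvd_imp_le_int[of "int x - int y" 27] by linarith
    then show "x = y" by simp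
  qed
  then have "h ` {0..<27} = UNIV"
    by (intro card_subset_eq) (auto simp: card_image card27)
  then show ?thesis using inj hom by (auto simp: bij_betw_def)
qed

end

section \<open>Decomposition of \<open>S\<close> relative to an element of order 9\<close>

locale pre_frame = rbol27 mul e for mul :: "'a::finite \<Rightarrow> 'a \<Rightarrow> 'a" (infixl "\<cdot>" 70) and e +
  fixes t f :: "'a sym"
  assumes tS: "t \<in> S" and fS: "f \<in> S" and nine: "s \<in> S \<Longrightarrow> zmul 9 s = 0"
    and t3: "zmul 3 t \<noteq> 0" and fA: "f \<noteq> zmul n t"
begin

lemma t9: "n mod 9 = m mod 9 \<Longrightarrow> zmul n t = zmul m t"
  by (metis nine tS zmul_mod)

lemma t3_mult: "\<not> 9 dvd n \<Longrightarrow> \<exists>k. zmul k (zmul n t) = zmul 3 t"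
proof -
  assume "\<not> 9 dvd n"
  then have "(1 * n) mod 9 = 3 mod 9 \<or> (2 * n) mod 9 = 3 mod 9 \<or> (3 * n) mod 9 = 3 mod 9 \<or> (6 * n) mod 9 = 3 mod 9"
  proof -
    have "n mod 9 = 1 \<or> n mod 9 = 2 \<or> n mod 9 = 3 \<or> n mod 9 = 4 \<or> n mod 9 = 5 \<or> n mod 9 = 6
      \<or> n mod 9 = 7 \<or> n mod 9 = 8"
      using \<open>\<not> 9 dvd n\<close> by presburger
    moreover have "(k * n) mod 9 = (k * (n mod 9)) mod 9" for k by (simp add: mod_mult_right_eq)
    ultimately show ?thesis by (elim disjE) simp_all
  qed
  then obtain k where "(k * n) mod 9 = 3 mod 9" by blast
  then have "zmul (k * n) t = zmul 3 t" by (rule t9)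
  then show ?thesis by (metis zmul_zmul)
qed

lemma t_dvd: "zmul n t = 0 \<longleftrightarrow> 9 dvd n"
proof
  show "zmul n t = 0 \<Longrightarrow> 9 dvd n" using t3_mult t3 by (metis zmul_zero)
  show "9 dvd n \<Longrightarrow> zmul n t = 0" using t9[of n 0] by simp
qed

lemma t_fix: "v \<triangleleft> zmul n t = v \<longleftrightarrow> 9 dvd n"
  by (metis S_fix S_zmul act_0 t_dvd tS)

lemma t_shift: "zmul (n + 9 * k) t = zmul n t"
  by (rule t9) simp

text \<open>\<open>5\<close> inverts \<open>2\<close> modulo 9.\<close>

lemma t_half: "zmul n t = zmul (5 * n) t + zmul (5 * n) t"
  using t_shift[of n n] by (simp add: zmul_add[symmetric])

lemma t_inj: "zmul n t = zmul m t \<longleftrightarrow> n mod 9 = m mod 9"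
proof -
  have "zmul n t = zmul m t \<longleftrightarrow> zmul (n - m) t = 0"
    by (simp add: zmul_diff add_eq_0_iff2)
  then show ?thesis by (simp add: t_dvd mod_eq_dvd_iff)
qed

lemma f_sandwich: "zmul n t + f + zmul m t \<noteq> zmul k t"
proof
  assume h: "zmul n t + f + zmul m t = zmul k t"
  have "f = - zmul n t + (zmul n t + f + zmul m t) + - zmul m t" by (simp add: add.assoc)
  also have "\<dots> = zmul (- n + k + - m) t" by (simp only: h zmul_add zmul_minus)
  finally show False using fA by blast
qed

lemma nf_sandwich: "zmul n t + - f + zmul m t \<noteq> zmul k t"
proof
  assume "zmul n t + - f + zmul m t = zmul k t"
  then have "- (zmul n t + - f + zmul m t) = - zmul k t" by simp
  then have "zmul (- m) t + f + zmul (- n) t = zmul (- k) t"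
    by (simp add: minus_add zmul_minus add.assoc del: add_uminus_conv_diff)
  then show False using f_sandwich by blast
qed

text \<open>Balances a word: the total \<open>n + m\<close> is divided equally,
  \<open>5 * (n + m)\<close> on each side, at the price of a conjugation. For \<open>g\<close> in
  \<open>S\<close> the balanced word is in \<open>S\<close>, whence \<open>fix_f\<close> and
  \<open>fix_nf\<close>.\<close>

lemma sandwich_conj:
  "zmul n t + g + zmul m t = - zmul (m - 5 * (n + m)) t + (zmul (5 * (n + m)) t + g + zmul (5 * (n + m)) t) + zmul (m - 5 * (n + m)) t"
proof -
  have "- zmul (m - 5 * (n + m)) t + zmul (5 * (n + m)) t = zmul n t"
  proof -
    have "- (m - 5 * (n + m)) + 5 * (n + m) = n + 9 * (n + m)" by simp
    then show ?thesis by (simp only: zmul_minus[symmetric] zmul_add[symmetric] t_shift)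
  qed
  moreover have "zmul (5 * (n + m)) t + zmul (m - 5 * (n + m)) t = zmul m t"
    by (simp add: zmul_add[symmetric])
  ultimately show ?thesis by (metis add.assoc)
qed

lemma fix_f: "v \<triangleleft> (zmul n t + f + zmul m t) \<noteq> v"
proof
  assume "v \<triangleleft> (zmul n t + f + zmul m t) = v"
  then have "zmul (5 * (n + m)) t + f + zmul (5 * (n + m)) t = 0"
    using S_fix_conj S_tw[OF S_zmul[OF tS] fS] by (metis sandwich_conj)
  then show False using f_sandwich[of _ _ 0] by simp
qed

lemma fix_nf: "v \<triangleleft> (zmul n t + - f + zmul m t) \<noteq> v"
proof
  assume "v \<triangleleft> (zmul n t + - f + zmul m t) = v"
  then have "zmul (5 * (n + m)) t + - f + zmul (5 * (n + m)) t = 0"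
    using S_fix_conj S_tw[OF S_zmul[OF tS] S_neg[OF fS]] by (metis sandwich_conj)
  then show False using nf_sandwich[of _ _ 0] by simp
qed

lemma shift_eq:
  assumes "zmul n t + g + zmul n t = zmul m t + g' + zmul m t"
  shows "g = zmul (m - n) t + g' + zmul (m - n) t"
proof -
  have "g = - zmul n t + (zmul n t + g + zmul n t) + - zmul n t" by (simp add: add.assoc)
  also have "\<dots> = (- zmul n t + zmul m t) + g' + (zmul m t + - zmul n t)"
    by (simp only: assms) (simp only: add.assoc)
  also have "- zmul n t + zmul m t = zmul (m - n) t"
    using zmul_add[of "- n" m t] by (simp add: zmul_minus)
  also have "zmul m t + - zmul n t = zmul (m - n) t" by (simp only: zmul_diff)
  finally show ?thesis .
qed

text \<open>Three families of nine elements exhaust the 27 of \<open>S\<close>: \<open>P_fix\<close>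
  makes each family of sandwiches injective modulo 9, and \<open>P_swap\<close> keeps those of
  \<open>f\<close> and \<open>- f\<close> apart.\<close>

lemma S_cases:
  assumes "s \<in> S"
  obtains n where "s = zmul n t" | n where "s = zmul n t + f + zmul n t"
    | n where "s = zmul n t + - f + zmul n t"
proof -
  define A where "A = (\<lambda>n. zmul n t) ` {0..<9}"
  define X where "X g = (\<lambda>n. zmul n t + g + zmul n t) ` {0..<9}" for g
  have "card A = 9" unfolding A_def
    by (subst card_image) (auto intro!: inj_onI simp: t_inj)
  moreover have "card (X g) = 9" if g: "g \<in> S" "g \<noteq> 0" for g
    unfolding X_def
  proof (subst card_image)
    show "inj_on (\<lambda>n. zmul n t + g + zmul n t) {0..<9}"
    proof (rule inj_onI)
      fix n m :: int
      assume nmul: "n \<in> {0..<9}" "m \<in> {0..<9}" "zmul n t + g + zmul n t = zmul m t + g + zmul m t"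
      have "zmul (m - n) t = 0"
        using P_fix[OF S_zmul[OF tS] g(1)] shift_eq[OF nmul(3)] by metis
      then show "n = m" using nmul by (intro eq_of_dvd_diff[symmetric]) (auto simp: t_dvd)
    qed
  qed simp
  moreover have f0: "f \<noteq> 0" "- f \<noteq> 0" using fA[of 0] by auto
  moreover have "A \<inter> X f = {}" by (auto simp: A_def X_def f_sandwich[symmetric])
  moreover have "A \<inter> X (- f) = {}" by (auto simp: A_def X_def nf_sandwich[symmetric])
  moreover have "X f \<inter> X (- f) = {}"
  proof (rule ccontr)
    assume "X f \<inter> X (- f) \<noteq> {}"
    then obtain n m where "zmul n t + f + zmul n t = zmul m t + - f + zmul m t"
      by (auto simp: X_def)
    then have "f = zmul (m - n) t"
      using shift_eq P_swap[OF S_zmul[OF tS] fS] by metis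
    then show False using fA by blast
  qed
  moreover have "finite A" "finite (X g)" for g by (simp_all add: A_def X_def)
  ultimately have "card (A \<union> X f \<union> X (- f)) = 27"
    using fS S_neg[OF fS] by (simp add: card_Un_disjoint Int_Un_distrib2 del: neg_equal_0_iff_equal)
  moreover have "A \<union> X f \<union> X (- f) \<subseteq> S"
    using S_zmul[OF tS] S_tw[OF S_zmul[OF tS]] fS S_neg[OF fS] by (auto simp: A_def X_def simp del: add_uminus_conv_diff)
  moreover have "finite S" by (rule card_ge_0_finite) (simp add: card_S)
  ultimately have "A \<union> X f \<union> X (- f) = S"
    by (intro card_subset_eq) (auto simp: card_S)
  then have "s \<in> A \<union> X f \<union> X (- f)" using assms by simp
  then show thesis using that by (auto simp: A_def X_def simp del: add_uminus_conv_diff)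
qed

text \<open>The value lies in one of the three parts of \<open>S\<close>; in the first two cases uniqueness of square roots
would make a conjugate of \<open>f\<close> a multiple of \<open>t\<close>.\<close>

lemma f_square: "\<exists>k. f + zmul n t + f = zmul k t + - f + zmul k t"
proof -
  define g where "g = zmul (5 * n) t + f + zmul (5 * n) t"
  have gS: "g \<in> S" unfolding g_def using S_tw[OF S_zmul[OF tS] fS] .
  have hh: "zmul (5 * n) t + zmul (5 * n) t = zmul n t"
    by (rule t_half[symmetric])
  have gg: "g + g = zmul (5 * n) t + (f + zmul n t + f) + zmul (5 * n) t"
    by (simp add: g_def add.assoc flip: hh)
  have "f + zmul n t + f \<in> S" using S_tw[OF fS S_zmul[OF tS]] .
  then show ?thesis
  proof (cases rule: S_cases)
    case (1 m)
    have "g + g = zmul (5 * n + m + 5 * n) t" by (simp only: gg 1 zmul_add)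
    also have "\<dots> = zmul (5 * (5 * n + m + 5 * n)) t + zmul (5 * (5 * n + m + 5 * n)) t"
      by (rule t_half)
    finally have "g = zmul (5 * (5 * n + m + 5 * n)) t"
      by (rule sqrt_unique[OF gS S_zmul[OF tS]])
    then show ?thesis using f_sandwich by (metis g_def)
  next
    case (2 m)
    have "g + g = zmul (5 * n) t + zmul m t + f + (zmul m t + zmul (5 * n) t)"
      by (simp only: gg 2) (simp only: add.assoc)
    also have "\<dots> = zmul m t + zmul (5 * n) t + f + (zmul (5 * n) t + zmul m t)"
      by (simp only: zmul_comm[of "5 * n" t m])
    also have "\<dots> = zmul m t + g + zmul m t"
      by (simp only: g_def add.assoc)
    finally have "g = zmul m t + zmul m t" using P_sq[OF S_zmul[OF tS] gS] by blast
    then show ?thesis using f_sandwich by (metis g_def zmul_add)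
  next
    case (3 m)
    then show ?thesis by blast
  qed
qed

text \<open>With \<open>k\<close> from \<open>f_square\<close>, \<open>twist_cube\<close> makes the
  cube \<open>2 * (n + k)\<close> times \<open>t\<close>, while \<open>n + k\<close> times
  \<open>t\<close> commutes with \<open>f\<close>. The balanced conjugate \<open>g\<close> lies in
  \<open>S\<close> and has the same cube, so \<open>zmul 9 g = 0\<close> forces 3 to divide
  \<open>n + k\<close>; \<open>c\<close> is the quotient.\<close>

lemma f_cube: "\<exists>c. f + zmul n t + f + zmul n t + f + zmul n t = zmul (3 * (2 * c)) t \<and> zmul (3 * c) t + f = f + zmul (3 * c) t"
proof -
  obtain k where k: "f + zmul n t + f = zmul k t + - f + zmul k t" using f_square by blast
  have c: "(zmul n t + zmul k t) + f = f + (zmul n t + zmul k t)"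
    by (rule twist_comm[OF zmul_comm k])
  have q: "f + zmul n t + f + zmul n t + f + zmul n t = zmul (2 * (n + k)) t"
    by (subst twist_cube[OF zmul_comm k]) (simp add: zmul_add[symmetric] algebra_simps)
  define h where "h = zmul (5 * n) t"
  have hh: "h + h = zmul n t"
    unfolding h_def by (rule t_half[symmetric])
  define g where "g = h + f + h"
  have "g \<in> S" unfolding g_def h_def using S_tw[OF S_zmul[OF tS] fS] .
  then have "zmul 9 g = 0" by (rule nine)
  moreover have "zmul 3 g = zmul (2 * (n + k)) t"
  proof -
    have "zmul 3 g = g + g + g" using zmul_add[of 2 1 g] zmul_add[of 1 1 g] by simp
    also have "\<dots> = h + f + (h + h) + f + (h + h) + f + (h + h) + - h"
      by (simp add: g_def add.assoc)
    also have "\<dots> = h + (f + zmul n t + f + zmul n t + f + zmul n t) + - h"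
      by (simp only: hh add.assoc)
    also have "\<dots> = zmul (5 * n + 2 * (n + k) + - (5 * n)) t"
      unfolding q h_def by (simp only: zmul_add zmul_minus)
    finally show ?thesis by simp
  qed
  ultimately have "zmul (6 * (n + k)) t = 0" using zmul_zmul[of 3 3 g] zmul_zmul[of 3 "2 * (n + k)" t] by simp
  then have "9 dvd 6 * (n + k)" by (simp add: t_dvd)
  then have "(n + k) mod 3 = 0" by (simp only: nine_dvd)
  then have "3 dvd n + k" by (simp only: dvd_eq_mod_eq_0)
  then obtain c where n: "n + k = 3 * c" by (auto simp: dvd_def)
  have "zmul (3 * c) t + f = f + zmul (3 * c) t" using c by (simp only: zmul_add[symmetric] n)
  moreover have "2 * (n + k) = 3 * (2 * c)" using n by simp
  ultimately show ?thesis using q by metis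
qed

lemma S_comm:
  assumes t: "z + t = t + z" and f: "z + f = f + z" and s: "s \<in> S"
  shows "z + s = s + z"
proof -
  have tn: "zmul n t + z = z + zmul n t" for n using comm_zmul[OF t[symmetric]] .
  show ?thesis
    using s
  proof (cases rule: S_cases)
    case (1 n)
    then show ?thesis using tn by simp
  next
    case (2 n)
    have "(zmul n t + f + zmul n t) + z = z + (zmul n t + f + zmul n t)"
      by (intro comm_plus tn f[symmetric])
    then show ?thesis using 2 by simp
  next
    case (3 n)
    have "(zmul n t + - f + zmul n t) + z = z + (zmul n t + - f + zmul n t)"
      by (intro comm_plus tn comm_neg f[symmetric])
    then show ?thesis using 3 by simp
  qed
qed

lemma central_fix:
  assumes t: "z + t = t + z" and f: "z + f = f + z" and v: "e \<triangleleft> z = e"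
  shows "z = 0"
proof (rule act_ext)
  fix x
  have "x \<triangleleft> z = e \<triangleleft> (R x + z)" by (simp add: act_plus)
  also have "\<dots> = e \<triangleleft> (z + R x)" using S_comm[OF t f, of "R x"] by simp
  also have "\<dots> = x" by (simp add: act_plus v)
  finally show "x \<triangleleft> z = x \<triangleleft> 0" by simp
qed

text \<open>If all cubes \<open>3 (f + n t)\<close> vanish, then \<open>t\<close> and its conjugate \<open>s = - f + t + f\<close> commute.
Counting the 81 pairs against 27 points, some nontrivial \<open>3 (a t + b s)\<close> fixes the identity. Each of these is
conjugate to a multiple of \<open>3 t\<close>, which has no fixed points, or else is a multiple of \<open>3 (t - s)\<close>, which is
central and hence zero.\<close>

lemma t3_comm: "zmul 3 t + f = f + zmul 3 t"
proof (cases "\<forall>n. f + zmul n t + f + zmul n t + f + zmul n t = 0")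
  case False
  then obtain n where n: "f + zmul n t + f + zmul n t + f + zmul n t \<noteq> 0" by blast
  obtain c where c: "f + zmul n t + f + zmul n t + f + zmul n t = zmul (3 * (2 * c)) t"
    "zmul (3 * c) t + f = f + zmul (3 * c) t" using f_cube by blast
  \<comment> \<open>A nonzero cube already provides a nonzero multiple of \<open>zmul 3 t\<close>
    commuting with \<open>f\<close>, and a multiple of that is \<open>zmul 3 t\<close>
    itself.\<close>
  have "\<not> 9 dvd 3 * c" using n c(1) by (auto simp: t_dvd dvd_def)
  then show ?thesis using t3_mult comm_zmul[OF c(2)] by metis
next
  case True
  have c0: "f + f + f = 0" using True[THEN spec, of 0] by simp
  define s where "s = - f + t + f"
  define s2 where "s2 = - f + s + f"
  have "f + - t + f + - t + f + - t = 0" using True[THEN spec, of "-1"] by (simp add: zmul_minus)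
  then have a: "s2 = - (s + t)" and b: "s2 = - (t + s)"
    using cube_conj[OF c0, of t] True[THEN spec, of 1] by (simp_all add: s_def s2_def)
  have st: "t + s = s + t" using a b by (metis minus_minus)
  have sc: "zmul n s = - f + zmul n t + f" for n by (simp add: s_def zmul_conj)
  have s2c: "zmul n s2 = - (f + f) + zmul n t + (f + f)" for n
    by (simp only: s2_def s_def zmul_conj) (simp add: minus_add add.assoc)
  have s9: "zmul n s = zmul m s" if "n mod 9 = m mod 9" for n m using t9[OF that] by (simp add: sc)
  have stc: "zmul i t + zmul j s = zmul j s + zmul i t" for i j by (metis comm_zmul st)
  have "\<not> inj_on (\<lambda>(i, j). e \<triangleleft> (zmul i t + zmul j s)) ({0..<9} \<times> {0..<9})"
  proof
    assume "inj_on (\<lambda>(i, j). e \<triangleleft> (zmul i t + zmul j s)) ({0..<9} \<times> {0..<9})"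
    then have "card ({0..<9::int} \<times> {0..<9::int}) \<le> CARD('a)"
      by (rule card_inj_on_le) auto
    then show False by (simp add: card27)
  qed
  then obtain i j i' j' where ij: "i \<in> {0..<9}" "j \<in> {0..<9}" "i' \<in> {0..<9}" "j' \<in> {0..<9}"
    "(i, j) \<noteq> (i', j')" "e \<triangleleft> (zmul i t + zmul j s) = e \<triangleleft> (zmul i' t + zmul j' s)"
    unfolding inj_on_def by auto
  have "zmul i t + zmul j s + - (zmul i' t + zmul j' s) = zmul i t + (zmul (j - j') s + zmul (- i') t)"
    by (simp only: minus_add zmul_diff zmul_minus add.assoc)
  also have "\<dots> = zmul i t + (zmul (- i') t + zmul (j - j') s)" by (simp only: stc[of "- i'" "j - j'"])
  also have "\<dots> = zmul (i - i') t + zmul (j - j') s" by (simp only: zmul_diff zmul_minus add.assoc)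
  finally have fx: "e \<triangleleft> (zmul (i - i') t + zmul (j - j') s) = e" using ij(6) act_eq_iff by metis
  have nz: "\<not> (9 dvd i - i' \<and> 9 dvd j - j')" using ij(1-5) eq_of_dvd_diff by blast
  have mult: "e \<triangleleft> (zmul (k * (i - i')) t + zmul (k * (j - j')) s) = e" for k
    using fix_zmul[OF fx, of k] by (simp add: zmul_plus[OF stc] zmul_zmul)
  obtain a b where ab: "\<not> (3 dvd a \<and> 3 dvd b)" "e \<triangleleft> (zmul (3 * a) t + zmul (3 * b) s) = e"
  proof (cases "3 dvd i - i' \<and> 3 dvd j - j'")
    case True
    then obtain a b where "i - i' = 3 * a" "j - j' = 3 * b" by (auto simp: dvd_def)
    moreover from this have "\<not> (3 dvd a \<and> 3 dvd b)" using nz by auto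
    ultimately show thesis using that[of a b] fx by metis
  next
    case False
    then show thesis using that mult[of 3] by blast
  qed
  have m3: "zmul (3 * b) s = zmul (3 * c) s" if "b mod 3 = c mod 3" for c
    using that mult_mod_right[of 3 b 3] mult_mod_right[of 3 c 3] by (intro s9) simp
  have r: "x mod 3 = 0 \<or> x mod 3 = 1 \<or> x mod 3 = 2" for x :: int by presburger
  have "(- a) mod 3 = (if a mod 3 = 0 then 0 else 3 - a mod 3)" by (rule zmod_zminus1_eq_if)
  then have "b mod 3 = 0 \<or> (a mod 3 = 0 \<and> b mod 3 \<noteq> 0) \<or> b mod 3 = a mod 3 \<or> b mod 3 = (- a) mod 3"
    using r[of a] r[of b] by auto
  \<comment> \<open>The four directions modulo 3: multiples of \<open>t\<close>, of its conjugate
    \<open>s\<close>, of \<open>t + s\<close>, which is minus the second conjugate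
    \<open>s2\<close>, and of the difference of \<open>t\<close> and \<open>s\<close>.\<close>
  then consider "b mod 3 = 0" | "a mod 3 = 0" "b mod 3 \<noteq> 0" | "b mod 3 = a mod 3" "a mod 3 \<noteq> 0"
    | "b mod 3 = (- a) mod 3" "a mod 3 \<noteq> 0" by fastforce
  then show ?thesis
  proof cases
    case 1
    then have "e \<triangleleft> zmul (3 * a) t = e" using ab(2) m3[of 0] by simp
    then have "a mod 3 = 0" by (simp only: t_fix nine_dvd)
    then show ?thesis using 1 ab(1) by (simp add: dvd_eq_mod_eq_0)
  next
    case 2
    then have "zmul (3 * a) t = 0" by (simp only: t_dvd nine_dvd)
    then have "e \<triangleleft> (- f + zmul (3 * b) t + f) = e" using ab(2) by (simp add: sc)
    then have "zmul (3 * b) t = 0" by (rule S_fix_conj[OF S_zmul[OF tS]])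
    then show ?thesis using 2 by (auto simp: t_dvd)
  next
    case 3
    have "zmul (3 * a) t + zmul (3 * b) s = zmul (3 * a) (t + s)" by (simp add: m3[OF 3(1)] zmul_plus[OF st])
    also have "\<dots> = zmul (- (3 * a)) s2"
      by (simp add: b zmul_minus del: minus_add_distrib) (metis minus_minus mult.right_neutral zmul_minus zmul_zmul zmul_1 mult_minus_right)
    finally have "e \<triangleleft> (- (f + f) + zmul (- (3 * a)) t + (f + f)) = e" using ab(2) by (simp add: s2c)
    then have "zmul (- (3 * a)) t = 0" by (rule S_fix_conj[OF S_zmul[OF tS]])
    then show ?thesis using 3 by (auto simp: t_dvd)
  next
    case 4
    define z where "z = zmul (3 * a) t + zmul (3 * b) s"
    have zb: "zmul (3 * b) s = zmul (- (3 * a)) s" using m3[OF 4(1)] by simp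
    have zt: "z + t = t + z"
      unfolding z_def by (intro comm_plus) (metis comm_zmul, metis comm_zmul st)
    have "- f + z + f = (- f + zmul (3 * a) t + f) + (- f + zmul (- (3 * a)) s + f)"
      by (simp add: z_def zb add.assoc)
    also have "\<dots> = zmul (3 * a) s + zmul (- (3 * a)) s2" by (simp only: sc s2_def zmul_conj)
    also have "\<dots> = zmul (3 * a) s + zmul (3 * a) (t + s)"
      by (simp add: b zmul_minus del: minus_add_distrib) (metis minus_minus mult.right_neutral zmul_minus zmul_zmul zmul_1 mult_minus_right)
    also have "\<dots> = zmul (3 * a) s + zmul (3 * a) s + zmul (3 * a) t" by (simp add: zmul_plus[OF st] stc add.assoc)
    also have "\<dots> = zmul (6 * a) s + zmul (3 * a) t" by (simp flip: zmul_add)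
    \<comment> \<open>\<open>6 * a\<close> and \<open>- (3 * a)\<close> differ by a multiple of 9;
      this makes \<open>z\<close> invariant under conjugation by \<open>f\<close>.\<close>
    also have "zmul (6 * a) s = zmul (- (3 * a)) s" by (rule s9) (simp add: mod_eq_dvd_iff)
    finally have "- f + z + f = z" by (simp add: z_def zb stc)
    then have "f + (- f + z + f) = f + z" by simp
    then have zf: "z + f = f + z" by (simp add: add.assoc)
    have "z = 0" by (rule central_fix[OF zt zf]) (simp add: z_def ab(2))
    then have "zmul (3 * a) t = zmul (3 * a) s" by (simp add: z_def zb zmul_minus add_eq_0_iff2)
    then have "f + zmul (3 * a) t = f + (- f + zmul (3 * a) t + f)" by (simp add: sc)
    then have "zmul (3 * a) t + f = f + zmul (3 * a) t" by (simp add: add.assoc)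
    moreover have "\<not> 9 dvd 3 * a" using 4 by (simp only: nine_dvd not_False_eq_True)
    ultimately show ?thesis using t3_mult comm_zmul by metis
  qed
qed

lemma Z_comm: "zmul (3 * k) t + f = f + zmul (3 * k) t"
  using comm_zmul[OF t3_comm, of k] by (simp add: zmul_zmul mult.commute)

end

section \<open>Central relations and coordinates of a frame\<close>

lemma comm_assoc: "a + b = b + a \<Longrightarrow> a + (b + c) = b + (a + c)" for a :: "'g::group_add"
  by (metis add.assoc)

text \<open>The parameters of a frame matter only modulo 3.\<close>

locale cube_frame = pre_frame +
  fixes e0 e1 e2 :: int
  assumes E0: "f + f + f = zmul (3 * e0) t"
    and E1: "f + t + f + t + f + t = zmul (3 * e1) t"
    and E2: "f + - t + f + - t + f + - t = zmul (3 * e2) t"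
begin

definition Z :: "int \<Rightarrow> 'a sym" where "Z k = zmul (3 * k) t"

lemma Z_add: "Z a + Z b = Z (a + b)" "Z a + (Z b + x) = Z (a + b) + x"
  by (simp_all add: Z_def zmul_add[symmetric] add.assoc[symmetric] distrib_left)

lemma Z_neg: "- Z a = Z (- a)"
  by (simp add: Z_def zmul_minus)

lemma Z_0: "Z 0 = 0"
  by (simp add: Z_def)

lemma Zt: "Z k + t = t + Z k" and Zf: "Z k + f = f + Z k"
  unfolding Z_def using comm_zmul[of t t "3 * k"] Z_comm by auto

definition sg where "sg = - f + t + f"
text \<open>The group commutator: \<open>f + t = t + f + gm\<close>.\<close>

definition gm where "gm = - f + - t + f + t"

lemma Zs: "Z k + sg = sg + Z k"
  unfolding sg_def by (metis comm_plus comm_neg Zt Zf)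

lemma gm_sg: "gm = - sg + t"
  by (simp add: gm_def sg_def minus_add add.assoc)

lemma Zg: "Z k + gm = gm + Z k"
  unfolding gm_sg by (metis comm_plus comm_neg Zt Zs)

lemmas Zc = Zt Zf Zs Zg comm_neg[OF Zt[symmetric], symmetric] comm_neg[OF Zf[symmetric], symmetric]
  comm_neg[OF Zs[symmetric], symmetric]
lemmas Zm = Zc Zc[THEN comm_assoc] Z_add add.assoc

text \<open>Exponents of central elements: \<open>c1\<close> and \<open>c2\<close> come from
  multiplying three successive conjugates of \<open>t\<close> in the two orders, \<open>A\<close>
  belongs to the commutator of \<open>sg\<close> with \<open>t\<close> and of \<open>t\<close> with
  \<open>gm\<close>, \<open>B\<close> to that of \<open>f\<close> with \<open>gm\<close>.\<close>

definition "c1 = e1 - e0"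
definition "c2 = e0 - e2"
definition "A = c1 - c2"
definition "B = - (1 + 2 * A - c1)"

definition sg2 where "sg2 = - f + sg + f"

lemma sg2_1: "sg2 + sg + t = Z c1"
proof -
  have "sg2 + sg + t = - (f + f + f) + (f + t + f + t + f + t)"
    using conj_cube[of f t] by (simp add: sg_def sg2_def)
  then show ?thesis by (simp only: E0 E1) (simp add: c1_def Z_def zmul_minus[symmetric] zmul_add[symmetric] algebra_simps)
qed

lemma sg2_2: "t + sg + sg2 = Z c2"
proof -
  have ns: "- f + - t + f = - sg" "- f + - sg + f = - sg2"
    by (simp_all add: sg_def sg2_def minus_add add.assoc)
  have "- sg2 + - sg + - t = - (f + f + f) + (f + - t + f + - t + f + - t)"
    using conj_cube[of f "- t"] by (simp add: ns)
  also have "\<dots> = Z (- c2)"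
    by (simp only: E0 E2) (simp add: c2_def Z_def zmul_minus[symmetric] zmul_add[symmetric] algebra_simps)
  finally have "- (- sg2 + - sg + - t) = Z c2" by (simp add: Z_neg)
  then show ?thesis by (simp add: minus_add add.assoc)
qed

lemma sg2_eq: "- sg2 = sg + t + Z (- c1)"
proof -
  have "sg2 = (sg2 + sg + t) + - (sg + t)" by (simp add: minus_add add.assoc)
  then have "- sg2 = - (Z c1 + - (sg + t))" by (simp only: sg2_1)
  also have "\<dots> = sg + t + Z (- c1)" by (simp add: minus_add Z_neg)
  finally show ?thesis .
qed

lemma sg_t: "sg + t = t + sg + Z A"
proof -
  have "sg2 = - (t + sg) + (t + sg + sg2)" by (simp add: minus_add add.assoc)
  then have "- sg2 = - (- (t + sg) + Z c2)" by (simp only: sg2_2)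
  also have "\<dots> = Z (- c2) + (t + sg)" by (simp add: minus_add Z_neg)
  finally have "sg + t + Z (- c1) = Z (- c2) + (t + sg)" by (simp only: sg2_eq)
  then have "sg + t + Z (- c1) + Z c1 = Z (- c2) + (t + sg) + Z c1" by simp
  then show ?thesis by (simp add: Zm A_def Z_0)
qed

lemma t_gm: "t + gm = gm + t + Z A"
proof -
  have "t + - sg = - sg + (sg + t) + - sg" by (simp add: add.assoc)
  also have "\<dots> = - sg + (t + sg + Z A) + - sg" by (simp only: sg_t)
  also have "\<dots> = - sg + t + Z A" by (simp add: Zm)
  finally have "t + - sg + t = - sg + t + Z A + t" by simp
  then show ?thesis by (simp add: gm_sg Zm)
qed

lemma sg3: "sg + sg + sg = Z 1"
proof -
  have "sg + sg + sg = - f + (t + t + t) + f" by (simp add: sg_def add.assoc)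
  also have "t + t + t = Z 1" using zmul_add[of 2 1 t] zmul_add[of 1 1 t] by (simp add: Z_def)
  also have "- f + Z 1 + f = Z 1" by (simp add: Zm)
  finally show ?thesis .
qed

lemma f_gm: "f + gm = gm + f + Z B"
proof -
  have "- f + gm + f = - sg2 + sg"
    by (simp add: gm_def sg2_def sg_def minus_add add.assoc)
  also have "\<dots> = (sg + t) + Z (- c1) + sg" by (simp only: sg2_eq)
  also have "\<dots> = (t + sg + Z A) + Z (- c1) + sg" by (simp only: sg_t)
  \<comment> \<open>\<open>sg + sg\<close> is replaced by \<open>- sg\<close> plus the cube of
    \<open>sg\<close>, the origin of the \<open>1\<close> in \<open>B\<close>.\<close>
  also have "\<dots> = t + - sg + (sg + sg + sg) + Z (A - c1)" by (simp add: Zm algebra_simps)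
  also have "\<dots> = - sg + (sg + t) + - sg + Z (1 + A - c1)"
    by (simp only: sg3) (simp add: Zm algebra_simps)
  also have "\<dots> = - sg + (t + sg + Z A) + - sg + Z (1 + A - c1)" by (simp only: sg_t)
  also have "\<dots> = gm + Z (- B)" by (simp add: Zm gm_sg B_def algebra_simps)
  finally have "f + (- f + gm + f) = f + (gm + Z (- B))" by simp
  then have "gm + f = f + gm + Z (- B)" by (simp add: add.assoc)
  then have "gm + f + Z B = f + gm + Z (- B) + Z B" by simp
  then show ?thesis by (simp add: Zm Z_0)
qed

definition pt :: "int \<Rightarrow> int \<Rightarrow> 'a" where "pt n j = e \<triangleleft> (zmul n t + zmul j f)"

lemma f3: "zmul 3 f = Z e0"
  using zmul_add[of 2 1 f] zmul_add[of 1 1 f] E0 by (simp add: Z_def)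

lemma f2: "zmul 2 f = Z e0 + - f"
  using zmul_add[of 3 "-1" f] f3 by (simp add: zmul_minus)

lemma fm2: "zmul (- 2) f = Z (- e0) + f"
  using zmul_add[of "- 3" "1" f] f3 by (simp add: zmul_minus[of 3] Z_neg)

text \<open>Two words with equal values give a fixed point of
  \<open>zmul n t + zmul (j - i) f + zmul (- m) t\<close>. The cube of \<open>f\<close> reduces
  \<open>j - i\<close> to \<open>0\<close>, \<open>1\<close> or \<open>- 1\<close>, and
  \<open>fix_f\<close> and \<open>fix_nf\<close> exclude the last two.\<close>

lemma pt_inj: "inj_on (\<lambda>(n, j). pt n j) ({0..<9} \<times> {0..<3})"
proof (rule inj_onI, clarify)
  fix n j m i :: int
  assume b: "n \<in> {0..<9}" "j \<in> {0..<3}" "m \<in> {0..<9}" "i \<in> {0..<3}" and eq: "pt n j = pt m i"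
  have "zmul n t + zmul j f + - (zmul m t + zmul i f) = zmul n t + zmul (j - i) f + zmul (- m) t"
    by (simp add: minus_add zmul_diff zmul_minus add.assoc)
  then have fx: "e \<triangleleft> (zmul n t + zmul (j - i) f + zmul (- m) t) = e"
    using eq act_eq_iff by (metis pt_def)
  have "j - i \<in> {-2, -1, 0, 1, 2}" using b by auto
  moreover have "j - i \<noteq> 1" using fx fix_f[of e n "- m"] by auto
  moreover have "j - i \<noteq> - 1" using fx fix_nf[of e n "- m"] by (auto simp: zmul_minus[of 1])
  moreover have "j - i \<noteq> 2"
  proof
    assume "j - i = 2"
    then have "e \<triangleleft> (zmul (n + 3 * e0) t + - f + zmul (- m) t) = e"
      using fx by (simp add: f2 Z_def zmul_add add.assoc)
    then show False using fix_nf by blast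
  qed
  moreover have "j - i \<noteq> - 2"
  proof
    assume "j - i = - 2"
    then have "e \<triangleleft> (zmul (n + 3 * (- e0)) t + f + zmul (- m) t) = e"
      using fx by (simp only: fm2 Z_def zmul_add add.assoc)
    then show False using fix_f by blast
  qed
  ultimately have ji: "j = i" by auto
  then have "e \<triangleleft> zmul (n - m) t = e" using fx by (simp add: zmul_diff zmul_minus)
  then have "n = m" using b t_fix[of e "n - m"] by (intro eq_of_dvd_diff) auto
  then show "n = m \<and> j = i" using ji by simp
qed

lemma pt_bij: "bij_betw (\<lambda>(n, j). pt n j) ({0..<9} \<times> {0..<3}) UNIV"
proof -
  have "(\<lambda>(n, j). pt n j) ` ({0..<9} \<times> {0..<3}) = UNIV"
    using card_image[OF pt_inj] by (intro card_subset_eq) (auto simp: card27)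
  then show ?thesis using pt_inj by (simp add: bij_betw_def)
qed

text \<open>The identity moved by \<open>f + t\<close> has coordinates \<open>(n, j)\<close>. Every value of \<open>j\<close> and \<open>n\<close> other than
\<open>j = 1\<close>, \<open>n = 1\<close> modulo 3 gives a conjugate of a nonzero element of \<open>S\<close> with a fixed point.\<close>

lemma commutator_at_e: "\<exists>l. e \<triangleleft> (f + t) = e \<triangleleft> (t + f + zmul (3 * l) t)"
proof -
  obtain n j where j: "j \<in> {0..<3}" and "e \<triangleleft> (f + t) = pt n j"
  proof -
    have "e \<triangleleft> (f + t) \<in> (\<lambda>(n, j). pt n j) ` ({0..<9} \<times> {0..<3})"
      using bij_betw_imp_surj_on[OF pt_bij] by simp
    then show thesis using that by auto
  qed
  then have eq: "e \<triangleleft> (f + t + - (zmul n t + zmul j f)) = e" using act_eq_iff by (metis pt_def)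
  consider "j = 0" | "j = 1" | "j = 2" using j by fastforce
  then show ?thesis
  proof cases
    case 1
    then have "e \<triangleleft> (zmul 0 t + f + zmul (1 - n) t) = e" using eq by (simp add: zmul_diff add.assoc)
    then show ?thesis using fix_f by blast
  next
    case 3
    obtain k where k: "f + zmul 1 t + f = zmul k t + - f + zmul k t" using f_square by blast
    have "f + t + - (zmul n t + zmul 2 f) = f + zmul 1 t + f + (Z (- e0) + - zmul n t)"
      by (simp add: f2 minus_add add.assoc Z_neg)
    also have "\<dots> = zmul k t + - f + zmul (k + 3 * (- e0) + - n) t"
      by (simp only: k) (simp only: Z_def zmul_add zmul_minus add.assoc)
    finally show ?thesis using eq 3 fix_nf by auto
  next
    case 2
    have eq': "e \<triangleleft> (f + t + - f + zmul (- n) t) = e" using eq 2 by (simp add: minus_add zmul_minus add.assoc)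
    have "n = 3 * (n div 3) \<or> n = 3 * (n div 3) + 1 \<or> n = 3 * (n div 3 + 1) - 1" by presburger
    then consider l where "n = 3 * l" | l where "n = 3 * l + 1" | l where "n = 3 * l - 1" by metis
    then show ?thesis
    proof cases
      case (1 l)
      have "f + t + - f + zmul (- n) t = f + t + (- f + Z (- l))" by (simp add: 1 Z_def add.assoc)
      also have "\<dots> = - (- f) + (t + Z (- l)) + - f" by (simp add: Zm)
      also have "t + Z (- l) = zmul (1 + 3 * (- l)) t" unfolding Z_def by (simp only: zmul_add zmul_1)
      finally have "zmul (1 + 3 * (- l)) t = 0" using eq' S_fix_conj[OF S_zmul[OF tS]] by metis
      then show ?thesis by (simp only: t_dvd nine_dvd)
    next
      case (2 l)
      then have "e \<triangleleft> (f + t) = e \<triangleleft> (zmul (3 * l + 1) t + f)"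
        using \<open>e \<triangleleft> (f + t) = pt n j\<close> \<open>j = 1\<close> by (simp add: pt_def)
      also have "zmul (3 * l + 1) t + f = t + f + Z l"
        by (simp only: zmul_add Z_def[symmetric] zmul_1) (simp add: Zm)
      finally show ?thesis by (auto simp: Z_def)
    next
      \<comment> \<open>The cubes of \<open>f\<close> and of \<open>f + t\<close> turn the word into
        the conjugate by \<open>f + t\<close> of \<open>- t\<close> plus a central term.\<close>
      case (3 l)
      have a: "f + t + f = Z e1 + - t + - f + - t"
      proof -
        have "f + t + f = (f + t + f + t + f + t) + - t + - f + - t" by (simp add: add.assoc)
        then show ?thesis by (simp only: E1 Z_def[symmetric])
      qed
      have b: "- f = f + f + Z (- e0)"
      proof -
        have "- f = - (f + f + f) + (f + f)" by (simp add: minus_add add.assoc)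
        also have "\<dots> = Z (- e0) + (f + f)" by (simp only: E0 Z_def[symmetric] Z_neg)
        finally show ?thesis by (simp add: Zm)
      qed
      have "f + t + - f + zmul (- n) t = f + t + - f + (t + Z (- l))"
      proof -
        have "- n = 1 + 3 * - l" using 3 by simp
        then show ?thesis by (simp only: zmul_add zmul_1 Z_def)
      qed
      also have "\<dots> = f + t + (f + f + Z (- e0)) + (t + Z (- l))" by (simp only: b[symmetric])
      also have "\<dots> = (f + t + f) + f + t + Z (- e0 - l)" by (simp add: Zm algebra_simps)
      also have "\<dots> = (Z e1 + - t + - f + - t) + f + t + Z (- e0 - l)" by (simp only: a)
      also have "\<dots> = - (f + t) + (- t + Z (e1 - e0 - l)) + (f + t)"
        by (simp add: Zm minus_add algebra_simps)
      also have "- t + Z (e1 - e0 - l) = zmul (- 1 + 3 * (e1 - e0 - l)) t"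
        by (simp only: Z_def zmul_add zmul_minus zmul_1)
      finally have "zmul (- 1 + 3 * (e1 - e0 - l)) t = 0" using eq' S_fix_conj[OF S_zmul[OF tS]] by metis
      then show ?thesis by (simp only: t_dvd nine_dvd)
    qed
  qed
qed

end

section \<open>Evaluating \<open>t\<close> and \<open>f\<close> in coordinates\<close>

locale frame = cube_frame +
  fixes l :: int
  assumes El: "e \<triangleleft> (f + t) = e \<triangleleft> (t + f + zmul (3 * l) t)"
begin

text \<open>As \<open>gm\<close> need not be central, it is known only pointwise: \<open>l\<close>
  gives its effect after \<open>t\<close> and \<open>f\<close>, and \<open>mu\<close> is that effect
  carried back to \<open>e\<close>, losing \<open>A\<close> for \<open>t\<close> and
  \<open>B\<close> for \<open>f\<close>.\<close>

definition "mu = l - A - B"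

lemma gm_t: "v \<triangleleft> gm = v \<triangleleft> Z c \<longleftrightarrow> v \<triangleleft> t \<triangleleft> gm = v \<triangleleft> t \<triangleleft> Z (c + A)"
proof -
  have "v \<triangleleft> t \<triangleleft> gm = v \<triangleleft> gm \<triangleleft> (t + Z A)" by (simp add: t_gm add.assoc flip: act_plus)
  moreover have "v \<triangleleft> t \<triangleleft> Z (c + A) = v \<triangleleft> Z c \<triangleleft> (t + Z A)" by (simp add: Zm flip: act_plus)
  ultimately show ?thesis by (simp add: act_inj)
qed

lemma gm_f: "v \<triangleleft> gm = v \<triangleleft> Z c \<longleftrightarrow> v \<triangleleft> f \<triangleleft> gm = v \<triangleleft> f \<triangleleft> Z (c + B)"
proof -
  have "v \<triangleleft> f \<triangleleft> gm = v \<triangleleft> gm \<triangleleft> (f + Z B)" by (simp add: f_gm add.assoc flip: act_plus)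
  moreover have "v \<triangleleft> f \<triangleleft> Z (c + B) = v \<triangleleft> Z c \<triangleleft> (f + Z B)" by (simp add: Zm flip: act_plus)
  ultimately show ?thesis by (simp add: act_inj)
qed

lemma gm_e: "e \<triangleleft> gm = e \<triangleleft> Z mu"
proof -
  have "f + t = t + f + gm" by (simp add: gm_def add.assoc)
  then have "e \<triangleleft> t \<triangleleft> f \<triangleleft> gm = e \<triangleleft> t \<triangleleft> f \<triangleleft> Z (mu + A + B)"
    using El by (simp add: mu_def Z_def act_plus)
  then show ?thesis using gm_t gm_f by blast
qed

lemma gm_zt: "v \<triangleleft> gm = v \<triangleleft> Z c \<Longrightarrow> v \<triangleleft> zmul n t \<triangleleft> gm = v \<triangleleft> zmul n t \<triangleleft> Z (c + n * A)"
proof (induction n rule: int_induct[where k = 0])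
  case base
  then show ?case by simp
next
  case (step1 i)
  have "zmul (i + 1) t = zmul i t + t" by (simp add: zmul_add)
  then show ?case using step1 gm_t[of "v \<triangleleft> zmul i t" "c + i * A"] by (simp add: act_plus algebra_simps)
next
  case (step2 i)
  have "zmul i t = zmul (i - 1) t + t" using zmul_add[of "i - 1" 1 t] by simp
  then show ?case using step2 gm_t[of "v \<triangleleft> zmul (i - 1) t" "c + (i - 1) * A"] by (simp add: act_plus algebra_simps)
qed

lemma pt_f: "pt n j \<triangleleft> f = pt n (j + 1)"
  by (simp add: pt_def zmul_add flip: act_plus) (simp add: add.assoc)

lemma pt_Z: "pt n j \<triangleleft> Z k = pt (n + 3 * k) j"
proof -
  have "zmul j f + Z k = Z k + zmul j f" using comm_zmul[OF Zf[symmetric]] .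
  then show ?thesis by (simp add: pt_def zmul_add add.assoc flip: act_plus Z_def)
qed

lemma pt_3: "pt n 3 = pt (n + 3 * e0) 0"
  by (simp add: pt_def f3 zmul_add Z_def)

lemma pt_9: "n mod 9 = m mod 9 \<Longrightarrow> pt n j = pt m j"
  by (simp only: pt_def t9[of n m])

lemma pt0_t: "pt n 0 \<triangleleft> t = pt (n + 1) 0"
  by (simp add: pt_def zmul_add flip: act_plus)

text \<open>Moving \<open>t\<close> past one \<open>f\<close> costs a \<open>gm\<close>, acting at a
  point where its exponent is \<open>mu\<close> plus \<open>n + 1\<close> steps \<open>A\<close> and
  one step \<open>B\<close>. In \<open>pt2_t\<close> this happens twice.\<close>

lemma pt1_t: "pt n 1 \<triangleleft> t = pt (n + 1 + 3 * (mu + (n + 1) * A + B)) 1"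
proof -
  have "pt n 1 \<triangleleft> t = pt (n + 1) 1 \<triangleleft> gm"
    by (simp add: pt_def zmul_add flip: act_plus) (simp add: gm_def add.assoc)
  also have "\<dots> = pt (n + 1) 1 \<triangleleft> Z (mu + (n + 1) * A + B)"
    using gm_f gm_zt[OF gm_e, of "n + 1"] by (simp add: pt_def act_plus)
  finally show ?thesis by (simp add: pt_Z)
qed

lemma pt2_t: "pt n 2 \<triangleleft> t = pt (n + 1 + 3 * (mu + (n + 1) * A + B) +
    3 * (mu + (n + 1 + 3 * (mu + (n + 1) * A + B)) * A + B + B)) 2"
proof -
  define m where "m = n + 1 + 3 * (mu + (n + 1) * A + B)"
  have "f + t = t + f + gm" by (simp add: gm_def add.assoc)
  then have "pt n 2 \<triangleleft> t = pt n 1 \<triangleleft> t \<triangleleft> f \<triangleleft> gm"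
    using pt_f[of n 1] by (metis act_plus one_add_one)
  also have "\<dots> = pt m 2 \<triangleleft> gm" using pt_f[of m 1] by (simp add: pt1_t m_def)
  also have "\<dots> = pt m 2 \<triangleleft> Z (mu + m * A + B + B)"
  proof -
    have "pt m 0 \<triangleleft> gm = pt m 0 \<triangleleft> Z (mu + m * A)"
      using gm_zt[OF gm_e, of m] by (simp add: pt_def)
    then have "pt m 0 \<triangleleft> f \<triangleleft> f \<triangleleft> gm = pt m 0 \<triangleleft> f \<triangleleft> f \<triangleleft> Z (mu + m * A + B + B)"
      using gm_f by blast
    then show ?thesis using pt_f[of m 0] pt_f[of m 1] by simp
  qed
  finally show ?thesis by (simp add: pt_Z m_def)
qed

end

lemma (in pre_frame) frame_exists:
  "\<exists>e0 e1 e2 l. frame mul e t f e0 e1 e2 l"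
proof -
  obtain a0 where 0: "f + f + f = zmul (3 * (2 * a0)) t" using f_cube[of 0] by auto
  obtain a1 where 1: "f + t + f + t + f + t = zmul (3 * (2 * a1)) t" using f_cube[of 1] by auto
  obtain a2 where 2: "f + - t + f + - t + f + - t = zmul (3 * (2 * a2)) t"
    using f_cube[of "-1"] by (auto simp: zmul_minus)
  interpret cube_frame mul e t f "2 * a0" "2 * a1" "2 * a2"
    by unfold_locales (rule 0 1 2)+
  obtain l where "e \<triangleleft> (f + t) = e \<triangleleft> (t + f + zmul (3 * l) t)"
    using commutator_at_e by blast
  then have "frame mul e t f (2 * a0) (2 * a1) (2 * a2) l"
    by unfold_locales
  then show ?thesis by blast
qed

text \<open>In the coordinates \<open>pt\<close> the actions of \<open>t\<close> and \<open>f\<close> depend only on the four parameters, so matching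
coordinates gives an isomorphism.\<close>

locale two_frames = F: frame mul e t f e0 e1 e2 l + G: frame mul' e' t' f' e0 e1 e2 l
  for mul :: "'a::finite \<Rightarrow> 'a \<Rightarrow> 'a" and e t f
    and mul' :: "'b::finite \<Rightarrow> 'b \<Rightarrow> 'b" and e' t' f' and e0 e1 e2 l :: int
begin

definition phi :: "'a \<Rightarrow> 'b" where
  "phi v = (case inv_into ({0..<9} \<times> {0..<3}) (\<lambda>(n, j). F.pt n j) v of (n, j) \<Rightarrow> G.pt n j)"

lemma phi_pt: "j \<in> {0..<3} \<Longrightarrow> phi (F.pt n j) = G.pt n j"
proof -
  assume j: "j \<in> {0..<3}"
  have "F.pt n j = F.pt (n mod 9) j" "G.pt n j = G.pt (n mod 9) j"
    by (rule F.pt_9 G.pt_9; simp)+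
  moreover have "(n mod 9, j) \<in> {0..<9} \<times> {0..<3}" using j by simp
  ultimately show ?thesis
    using inv_into_f_f[OF F.pt_inj, of "(n mod 9, j)"] by (simp add: phi_def)
qed

lemma pt_cases: obtains n j where "j = 0 \<or> j = 1 \<or> j = 2" "v = F.pt n j"
proof -
  have "v \<in> (\<lambda>(n, j). F.pt n j) ` ({0..<9} \<times> {0..<3})"
    using bij_betw_imp_surj_on[OF F.pt_bij] by simp
  then obtain n j where "j \<in> {0..<3}" "v = F.pt n j" by auto
  moreover from this have "j = 0 \<or> j = 1 \<or> j = 2" by auto
  ultimately show thesis using that by blast
qed

lemma phi_bij: "bij phi"
proof -
  have "bij_betw (inv_into ({0..<9} \<times> {0..<3}) (\<lambda>(n, j). F.pt n j)) UNIV ({0..<9} \<times> {0..<3})"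
    by (rule bij_betw_inv_into[OF F.pt_bij])
  from bij_betw_trans[OF this G.pt_bij] show ?thesis
    by (simp add: phi_def[abs_def] comp_def)
qed

lemma phi_f: "phi (v \<triangleleft> f) = phi v \<triangleleft> f'"
proof -
  obtain n j where "j = 0 \<or> j = 1 \<or> j = 2" and v: "v = F.pt n j" by (rule pt_cases)
  then consider "j = 0" | "j = 1" | "j = 2" by blast
  then show ?thesis
    by cases (simp_all add: v phi_pt F.pt_f G.pt_f F.pt_3 G.pt_3)
qed

lemma phi_pts: "phi (F.pt n 0) = G.pt n 0" "phi (F.pt n 1) = G.pt n 1" "phi (F.pt n 2) = G.pt n 2"
  by (simp_all add: phi_pt)

lemma phi_t: "phi (v \<triangleleft> t) = phi v \<triangleleft> t'"
proof -
  obtain n j where "j = 0 \<or> j = 1 \<or> j = 2" and v: "v = F.pt n j" by (rule pt_cases)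
  then consider "j = 0" | "j = 1" | "j = 2" by blast
  then show ?thesis
  proof cases
    case 1
    show ?thesis unfolding v 1 F.pt0_t phi_pts G.pt0_t ..
  next
    case 2
    show ?thesis unfolding v 2 F.pt1_t phi_pts G.pt1_t ..
  next
    case 3
    show ?thesis unfolding v 3 F.pt2_t phi_pts G.pt2_t ..
  qed
qed

definition "intertwines p q \<longleftrightarrow> (\<forall>v. phi (v \<triangleleft> p) = phi v \<triangleleft> q)"

lemma intertwines_plus: "intertwines p q \<Longrightarrow> intertwines p' q' \<Longrightarrow> intertwines (p + p') (q + q')"
  by (simp add: intertwines_def act_plus)

lemma intertwines_neg: "intertwines p q \<Longrightarrow> intertwines (- p) (- q)"
  unfolding intertwines_def by (metis act_neg)

lemma intertwines_nmul: "intertwines p q \<Longrightarrow> intertwines (nmul n p) (nmul n q)"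
  by (induction n) (simp_all add: intertwines_plus, simp add: intertwines_def)

lemma intertwines_zmul: "intertwines p q \<Longrightarrow> intertwines (zmul n p) (zmul n q)"
  by (simp add: zmul_def intertwines_nmul intertwines_plus intertwines_neg diff_conv_add_uminus del: add_uminus_conv_diff)

lemma phi_e: "phi e = e'"
  using phi_pt[of 0 0] by (simp add: F.pt_def G.pt_def)

lemma intertwines_S: "s \<in> F.S \<Longrightarrow> \<exists>s' \<in> G.S. intertwines s s'"
proof -
  assume "s \<in> F.S"
  have t: "intertwines (zmul n t) (zmul n t')" for n using intertwines_zmul phi_t by (simp add: intertwines_def)
  have f: "intertwines f f'" using phi_f by (simp add: intertwines_def)
  from \<open>s \<in> F.S\<close> show ?thesis
  proof (cases rule: F.S_cases)
    case (1 n)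
    then show ?thesis using t G.S_zmul[OF G.tS] by blast
  next
    case (2 n)
    then show ?thesis using t f intertwines_plus G.S_tw[OF G.S_zmul[OF G.tS] G.fS] by blast
  next
    case (3 n)
    then show ?thesis using t intertwines_neg[OF f] intertwines_plus G.S_tw[OF G.S_zmul[OF G.tS] G.S_neg[OF G.fS]] by blast
  qed
qed

text \<open>The counterpart of \<open>F.R v\<close> lies in \<open>G.S\<close> and sends
  \<open>e'\<close> to \<open>phi v\<close>, so it is \<open>G.R (phi v)\<close>.\<close>

lemma phi_mul: "phi (mul u v) = mul' (phi u) (phi v)"
proof -
  obtain s' where s': "s' \<in> G.S" "intertwines (F.R v) s'" using intertwines_S F.S_R by blast
  have "phi v = phi (e \<triangleleft> F.R v)" by simp
  also have "\<dots> = e' \<triangleleft> s'" using s'(2) phi_e by (simp add: intertwines_def del: F.act_R)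
  finally have "G.R (phi v) = s'" using G.S_pt[OF s'(1)] by simp
  moreover have "phi (u \<triangleleft> F.R v) = phi u \<triangleleft> s'" using s'(2) by (simp add: intertwines_def del: F.act_R)
  ultimately show ?thesis using G.act_R F.act_R by metis
qed

end

subsection \<open>Loops of exponent 3\<close>

lemma f3_cases: "(x::3) = 0 \<or> x = 1 \<or> x = 2"
proof (cases x)
  case (of_int z)
  then have "z = 0 \<or> z = 1 \<or> z = 2" by auto
  then show ?thesis using of_int by auto
qed

lemma f3_numerals [simp]: "(3::3) = 0" "(4::3) = 1" "(5::3) = 2" "(6::3) = 0" "(8::3) = 2"
  "(-1::3) = 2" "(-2::3) = 1" "(-4::3) = 2" "(-8::3) = 1"
  by simp_all

text \<open>Scalars live in the field type \<open>3\<close>, so that exponents become polynomials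
  that the simplifier can compare.\<close>

definition tmul :: "3 \<Rightarrow> 'g::group_add \<Rightarrow> 'g" where
  "tmul x s = (if x = 0 then 0 else if x = 1 then s else s + s)"

lemma tmul_simps [simp]: "tmul 0 s = 0" "tmul 1 s = s" "tmul 2 s = s + s" "tmul x 0 = 0"
  by (simp_all add: tmul_def)

lemma tmul_add: "s + s + s = 0 \<Longrightarrow> tmul (x + y) s = tmul x s + tmul y s"
  using f3_cases[of x] f3_cases[of y] by (elim disjE) (simp_all add: add.assoc)

lemma tmul_mult: "s + s + s = 0 \<Longrightarrow> tmul x (tmul y s) = tmul (x * y) s"
  using f3_cases[of x] f3_cases[of y] by (elim disjE) (simp_all add: add.assoc)

lemma tmul_comm: "s + t = t + s \<Longrightarrow> tmul x s + t = t + tmul x s" for s :: "'g::group_add"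
  using f3_cases[of x] by (elim disjE) (simp_all add: comm_plus)

lemma tmul_plus: "s + t = t + s \<Longrightarrow> tmul x (s + t) = tmul x s + tmul x t" for s :: "'g::group_add"
  using f3_cases[of x] by (elim disjE) (simp_all add: add.assoc, metis add.assoc)

lemma tmul_neg: "s + s + s = 0 \<Longrightarrow> tmul (- x) s = - tmul x s"
  using tmul_add[of s "- x" x] by (simp add: eq_neg_iff_add_eq_0)

lemma tmul_conj: "tmul x (- g + s + g) = - g + tmul x s + g"
  using f3_cases[of x] by (elim disjE) (simp_all add: add.assoc)

lemma cube_comm:
  fixes f :: "'g::group_add"
  assumes "f + f + f = 0" "f + t + f + t + f + t = 0" "f + - t + f + - t + f + - t = 0"
  shows "t + (- f + t + f) = (- f + t + f) + t"
  using cube_conj[OF assms] by (metis minus_minus)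

definition gcomm :: "'g::group_add \<Rightarrow> 'g \<Rightarrow> 'g" where
  "gcomm s t = - s + - t + s + t"

lemma gcomm_swap: "s + t = t + s + gcomm s t"
  by (simp add: gcomm_def add.assoc)

lemma gcomm_neg: "gcomm t s = - gcomm s t"
  by (simp add: gcomm_def minus_add add.assoc)

lemma gcomm_zeroD: "gcomm s t = 0 \<Longrightarrow> s + t = t + s"
  using gcomm_swap[of s t] by simp

lemma gcomm_zeroI: "s + t = t + s \<Longrightarrow> gcomm s t = 0"
  by (metis add.right_neutral add_left_cancel gcomm_swap)

text \<open>Bilinearity of a central commutator: conjugation by \<open>t\<close> adds
  \<open>gcomm s t\<close> to \<open>s\<close>, hence \<open>tmul m (gcomm s t)\<close> to
  \<open>tmul m s\<close>; conjugating multiples of \<open>t\<close> by \<open>tmul m s\<close>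
  gives the other variable.\<close>

lemma gcomm_tmul:
  assumes s3: "s + s + s = 0" and t3: "t + t + t = 0" and c3: "gcomm s t + gcomm s t + gcomm s t = 0"
    and cs: "gcomm s t + s = s + gcomm s t" and ct: "gcomm s t + t = t + gcomm s t"
  shows "tmul m s + tmul n t = tmul n t + tmul m s + tmul (m * n) (gcomm s t)"
proof -
  let ?c = "gcomm s t"
  have "- t + s + t = s + ?c" by (simp add: gcomm_def add.assoc)
  then have "- t + tmul m s + t = tmul m s + tmul m ?c"
    by (metis tmul_conj tmul_plus cs)
  then have "t + (- t + tmul m s + t) + - (tmul m ?c) = t + (tmul m s + tmul m ?c) + - (tmul m ?c)" by simp
  then have 1: "tmul m s + t + - tmul m ?c = t + tmul m s" by (simp add: add.assoc)
  have 2: "t + - tmul m ?c = - tmul m ?c + t" using comm_neg[OF tmul_comm[OF ct]] by simp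
  have "- tmul m s + t + tmul m s = - tmul m s + (tmul m s + t + - tmul m ?c)"
    by (simp only: add.assoc 1[symmetric])
  also have "\<dots> = t + - tmul m ?c" by (simp add: add.assoc)
  finally have "- tmul m s + tmul n t + tmul m s = tmul n t + tmul n (- tmul m ?c)"
    by (metis tmul_conj tmul_plus 2)
  also have "tmul n (- tmul m ?c) = - tmul (m * n) ?c"
    using c3 by (simp add: tmul_neg[symmetric] tmul_mult mult.commute)
  finally have "tmul m s + (- tmul m s + tmul n t + tmul m s) + tmul (m * n) ?c = tmul m s + (tmul n t + - tmul (m * n) ?c) + tmul (m * n) ?c"
    by simp
  then show ?thesis by (simp add: add.assoc)
qed

lemma fix_tmul: "x \<triangleleft> p = x \<Longrightarrow> x \<triangleleft> tmul n p = x"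
  using f3_cases[of n] by (elim disjE) (simp_all add: act_plus)

text \<open>Both the right multiplications \<open>R x\<close> and the maps \<open>P x\<close> sending \<open>y\<close> to \<open>(x y) x\<close> form such a set.
Two elements generate a quotient of the Heisenberg group of order 27.\<close>

locale cube_set =
  fixes T :: "'a::finite sym set"
  assumes card27: "CARD('a) = 27"
    and T0: "0 \<in> T" and T_tw: "s \<in> T \<Longrightarrow> t \<in> T \<Longrightarrow> s + t + s \<in> T"
    and T_cube: "s \<in> T \<Longrightarrow> s + s + s = 0" and T_fix: "s \<in> T \<Longrightarrow> v \<triangleleft> s = v \<Longrightarrow> s = 0"
begin

lemma T_dbl: "s \<in> T \<Longrightarrow> s + s \<in> T"
  using T_tw[OF _ T0] by simp

lemma double_eq_neg: "s \<in> T \<Longrightarrow> s + s = - s"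
  using T_cube[of s] by (simp add: eq_neg_iff_add_eq_0 add.assoc)

lemma T_neg: "s \<in> T \<Longrightarrow> - s \<in> T"
  using T_dbl double_eq_neg by metis

lemma T_tmul: "s \<in> T \<Longrightarrow> tmul n s \<in> T"
  by (simp add: tmul_def T0 T_dbl)

text \<open>\<open>s + t\<close> need not lie in \<open>T\<close>, but \<open>- t + s + - t\<close>
  does; as \<open>- t + - t = t\<close>, its cube is a conjugate of the cube of
  \<open>s + t\<close>.\<close>

lemma T_prod_cube: "s \<in> T \<Longrightarrow> t \<in> T \<Longrightarrow> s + t + s + t + s + t = 0"
proof -
  assume st: "s \<in> T" "t \<in> T"
  have "- t + s + - t \<in> T" using st by (intro T_tw T_neg)
  then have "(- t + s + - t) + (- t + s + - t) + (- t + s + - t) = 0" by (rule T_cube)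
  then have "- t + s + (- t + - t) + s + (- t + - t) + s + - t = 0" by (simp only: add.assoc)
  moreover have "- t + - t = t" using double_eq_neg[OF T_neg[OF st(2)]] by simp
  ultimately have "- t + s + t + s + t + s + - t = 0" by simp
  then have "t + (- t + s + t + s + t + s + - t) + t + t = t + 0 + t + t" by simp
  then have "s + t + s + t + s + t = t + t + t" by (simp add: add.assoc)
  then show ?thesis using T_cube[OF st(2)] by simp
qed

lemma gcomm_right: "s \<in> T \<Longrightarrow> t \<in> T \<Longrightarrow> gcomm s t + t = t + gcomm s t"
proof -
  assume st: "s \<in> T" "t \<in> T"
  have "t + (- s + t + s) = (- s + t + s) + t"
    using st by (intro cube_comm T_cube T_prod_cube T_neg)
  then have "- (- s + t + s) + t = t + - (- s + t + s)" by (metis comm_neg)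
  then have "- (- s + t + s) + t + t = t + (- (- s + t + s) + t)" by (simp add: add.assoc)
  then show ?thesis by (simp add: gcomm_def minus_add add.assoc)
qed

lemma gcomm_left: "s \<in> T \<Longrightarrow> t \<in> T \<Longrightarrow> gcomm s t + s = s + gcomm s t"
  using gcomm_right[of t s] comm_neg[of "gcomm t s" s] by (simp add: gcomm_neg[of s t])

lemma gcomm_cube: "s \<in> T \<Longrightarrow> t \<in> T \<Longrightarrow> gcomm s t + gcomm s t + gcomm s t = 0"
proof -
  assume st: "s \<in> T" "t \<in> T"
  have a: "gcomm s t = - s + (- t + s + t)" by (simp add: gcomm_def add.assoc)
  have "- t + s + t = s + gcomm s t" by (simp add: gcomm_def add.assoc)
  moreover have "(- t + s + t) + (- t + s + t) + (- t + s + t) = 0"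
    using T_cube[OF st(1)] by (simp add: add.assoc) (metis add.assoc add.left_inverse add_0)
  ultimately have "(s + gcomm s t) + (s + gcomm s t) + (s + gcomm s t) = 0" by simp
  then have "s + (gcomm s t + s) + (gcomm s t + s) + gcomm s t = 0" by (simp only: add.assoc)
  then have "s + (s + gcomm s t) + (s + gcomm s t) + gcomm s t = 0" by (simp only: gcomm_left[OF st])
  then have "s + s + (gcomm s t + s) + gcomm s t + gcomm s t = 0" by (simp only: add.assoc)
  then have "(s + s + s) + (gcomm s t + gcomm s t + gcomm s t) = 0" by (simp only: gcomm_left[OF st] add.assoc)
  then show ?thesis by (simp add: T_cube[OF st(1)])
qed

lemma gcomm_tmul_T:
  "s \<in> T \<Longrightarrow> t \<in> T \<Longrightarrow> tmul m s + tmul n t = tmul n t + tmul m s + tmul (m * n) (gcomm s t)"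
  by (intro gcomm_tmul T_cube gcomm_cube gcomm_left gcomm_right)

text \<open>Conjugation by a multiple of \<open>s\<close> balances the word into
  \<open>tmul (2 * a) s + tmul b t + tmul (2 * a) s\<close>, which lies in \<open>T\<close>. With a
  fixed point it vanishes, and \<open>s\<close> and \<open>t\<close> would commute unless both
  scalars are zero.\<close>

lemma comb_fix:
  assumes st: "s \<in> T" "t \<in> T" and c: "gcomm s t \<noteq> 0"
    and fx: "y \<triangleleft> (tmul a s + tmul b t) = y"
  shows "a = 0 \<and> b = 0"
proof -
  have "tmul a s = tmul (2 * a) s + tmul (2 * a) s"
    using f3_cases[of a] by (elim disjE) (simp_all add: double_eq_neg[OF st(1)] double_eq_neg[OF T_neg[OF st(1)]])
  then have "tmul a s + tmul b t = - (- tmul (2 * a) s) + (tmul (2 * a) s + tmul b t + tmul (2 * a) s) + - tmul (2 * a) s"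
    by (simp add: add.assoc)
  then have "(y \<triangleleft> - (- tmul (2 * a) s)) \<triangleleft> (tmul (2 * a) s + tmul b t + tmul (2 * a) s) = y \<triangleleft> - (- tmul (2 * a) s)"
    using fx fix_conj by metis
  then have "tmul (2 * a) s + tmul b t + tmul (2 * a) s = 0"
    using T_fix T_tw T_tmul st by metis
  then have "- tmul (2 * a) s + (tmul (2 * a) s + tmul b t + tmul (2 * a) s) + - tmul (2 * a) s = - tmul (2 * a) s + 0 + - tmul (2 * a) s"
    by simp
  then have bt: "tmul b t = - tmul (2 * a) s + - tmul (2 * a) s" by (simp add: add.assoc)
  then have bt': "tmul b t = tmul (- a) s"
    using f3_cases[of a] by (elim disjE) (simp_all add: double_eq_neg[OF st(1)] double_eq_neg[OF T_neg[OF st(1)]])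
  have "b = 0"
  proof (rule ccontr)
    assume "b \<noteq> 0"
    then have "b * b = 1" using f3_cases[of b] by auto
    then have "t = tmul (b * (- a)) s"
      using bt' tmul_mult[OF T_cube[OF st(2)], of b b] tmul_mult[OF T_cube[OF st(1)], of b "- a"] by simp
    then have "s + t = t + s" using tmul_comm[of s s] by metis
    then show False using c gcomm_zeroI by blast
  qed
  moreover have "a = 0"
  proof (rule ccontr)
    assume "a \<noteq> 0"
    moreover have "tmul (- a) s = 0" using bt' \<open>b = 0\<close> by simp
    ultimately have "s = 0" using f3_cases[of a] double_eq_neg[OF st(1)] by auto
    then show False using c by (simp add: gcomm_def)
  qed
  ultimately show ?thesis by simp
qed

lemma comb3_fix:
  assumes st: "s \<in> T" "t \<in> T" and ny: "y \<triangleleft> gcomm s t \<noteq> y"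
    and fx: "y \<triangleleft> (tmul a s + tmul b t + tmul k (gcomm s t)) = y"
  shows "a = 0 \<and> b = 0 \<and> k = 0"
proof -
  let ?c = "gcomm s t"
  have c0: "?c \<noteq> 0" using ny by auto
  have c3: "?c + ?c + ?c = 0" using gcomm_cube[OF st] .
  have cs: "tmul k ?c + tmul m s = tmul m s + tmul k ?c" for k m using tmul_comm tmul_comm[symmetric] gcomm_left[OF st] by metis
  have ct: "tmul k ?c + tmul m t = tmul m t + tmul k ?c" for k m using tmul_comm tmul_comm[symmetric] gcomm_right[OF st] by metis
  have ab: "a = 0 \<and> b = 0"
  proof (cases "b = 0")
    case False
    then have bb: "b * b = 1" using f3_cases[of b] by auto
    \<comment> \<open>Since \<open>b * b = 1\<close>, conjugation by \<open>tmul m s\<close>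
      produces exactly the central term \<open>tmul k ?c\<close>, so the word is conjugate to one
      without it.\<close>
    define m where "m = k * b"
    have "tmul m s + (tmul a s + tmul b t) = tmul a s + (tmul b t + tmul m s) + tmul k ?c"
    proof -
      have "tmul m s + (tmul a s + tmul b t) = tmul a s + (tmul m s + tmul b t)"
        by (simp only: add.assoc[symmetric] tmul_add[OF T_cube[OF st(1)], symmetric] add.commute[of m a])
      also have "\<dots> = tmul a s + (tmul b t + tmul m s + tmul (m * b) ?c)" by (simp only: gcomm_tmul_T[OF st])
      also have "m * b = k" using bb by (simp add: m_def mult.assoc)
      finally show ?thesis by (simp add: add.assoc)
    qed
    then have "tmul m s + (tmul a s + tmul b t) + - tmul m s = tmul a s + tmul b t + (tmul m s + tmul k ?c) + - tmul m s"
      by (simp add: add.assoc)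
    also have "\<dots> = tmul a s + tmul b t + tmul k ?c" by (simp only: cs[symmetric]) (simp add: add.assoc)
    finally have "y \<triangleleft> (- (- tmul m s) + (tmul a s + tmul b t) + - tmul m s) = y" using fx by simp
    from fix_conj[OF this] show ?thesis using comb_fix[OF st c0] by blast
  next
    case b: True
    show ?thesis
    proof (cases "a = 0")
      case False
      then have aa: "a * a = 1" using f3_cases[of a] by auto
      define m where "m = - (k * a)"
      have am: "a * m = - k" using aa f3_cases[of a] f3_cases[of k] by (auto simp: m_def)
      have H: "tmul a s + tmul m t = tmul m t + tmul a s + tmul (- k) ?c" by (simp only: gcomm_tmul_T[OF st] am)
      have "tmul m t + tmul a s + tmul (- k) ?c + tmul k ?c + - tmul m t = tmul a s + (tmul m t + tmul k ?c) + - tmul m t"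
        by (simp only: H[symmetric]) (simp only: add.assoc)
      also have "\<dots> = tmul a s + tmul k ?c" by (simp only: ct[symmetric]) (simp add: add.assoc)
      finally have "tmul m t + tmul a s + - tmul m t = tmul a s + tmul k ?c"
        by (simp add: tmul_neg[OF c3] add.assoc)
      then have "y \<triangleleft> (- (- tmul m t) + (tmul a s + tmul b t) + - tmul m t) = y" using fx b by simp
      from fix_conj[OF this] show ?thesis using comb_fix[OF st c0] by blast
    qed (simp add: b)
  qed
  then have "y \<triangleleft> tmul k ?c = y" using fx by simp
  then have "y \<triangleleft> tmul k (tmul k ?c) = y" by (rule fix_tmul)
  then have "y \<triangleleft> tmul (k * k) ?c = y" by (simp add: tmul_mult[OF c3])
  moreover have "k = 0 \<or> k * k = 1" using f3_cases[of k] by auto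
  ultimately have "k = 0" using ny by auto
  then show ?thesis using ab by simp
qed

text \<open>If the commutator moves \<open>z\<close>, then the group generated by \<open>s\<close> and \<open>t\<close> acts regularly on the orbit of
\<open>z\<close>, since its noncentral elements are conjugate to elements of \<open>T\<close>. This orbit is everything, and a central
element fixing one of its points is trivial.\<close>

lemma gcomm_fix_zero:
  assumes st: "s \<in> T" "t \<in> T" and fx: "e \<triangleleft> gcomm s t = e"
  shows "gcomm s t = 0"
proof (rule ccontr)
  let ?c = "gcomm s t"
  assume "?c \<noteq> 0"
  then obtain z where z: "z \<triangleleft> ?c \<noteq> z" using act_ext[of ?c 0] by auto
  define g where "g = (\<lambda>(a, b, k). tmul a s + tmul b t + tmul k ?c)"
  have gc: "g w + ?c = ?c + g w" for w
    unfolding g_def by (auto split: prod.split intro!: comm_plus tmul_comm gcomm_left[OF st, symmetric] gcomm_right[OF st, symmetric])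
  have "inj (\<lambda>w. z \<triangleleft> g w)"
  proof (rule injI)
    fix w w' :: "3 \<times> 3 \<times> 3"
    obtain a b k a' b' k' where w: "w = (a, b, k)" "w' = (a', b', k')" by (metis prod_cases3)
    assume "z \<triangleleft> g w = z \<triangleleft> g w'"
    then have "z \<triangleleft> g (a, b, k) = z \<triangleleft> g (a', b', k')" by (simp add: w)
    then have "z \<triangleleft> (g (a, b, k) + - g (a', b', k')) = z" by (simp add: act_eq_iff)
    moreover have "g (a, b, k) + - g (a', b', k') = tmul a s + (tmul (b - b') t + tmul (k - k') ?c) + - tmul a' s"
    proof -
      have m: "tmul (x - y) u = tmul x u + - tmul y u" if "u + u + u = 0" for x y and u :: "'a sym"
        using tmul_add[OF that, of x "- y"] tmul_neg[OF that, of y] by simp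
      have cc: "(tmul k ?c + - tmul k' ?c) + - tmul b' t = - tmul b' t + (tmul k ?c + - tmul k' ?c)"
        by (intro comm_plus comm_neg tmul_comm) (metis tmul_comm comm_neg gcomm_right[OF st])+
      have "g (a, b, k) + - g (a', b', k') = tmul a s + (tmul b t + ((tmul k ?c + - tmul k' ?c) + - tmul b' t)) + - tmul a' s"
        by (simp add: g_def minus_add add.assoc)
      then show ?thesis
        by (simp only: cc) (simp only: m[OF T_cube[OF st(2)]] m[OF gcomm_cube[OF st]] add.assoc)
    qed
    ultimately have "z \<triangleleft> (tmul a s + (tmul (b - b') t + tmul (k - k') ?c) + - tmul a' s) = z" by simp
    then have "(z \<triangleleft> tmul a' s) \<triangleleft> (- tmul a' s + tmul a s + (tmul (b - b') t + tmul (k - k') ?c)) = z \<triangleleft> tmul a' s"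
      by (metis (no_types) act_neg act_plus)
    moreover have "- tmul a' s + tmul a s = tmul (a - a') s"
      using tmul_add[OF T_cube[OF st(1)], of "- a'" a] tmul_neg[OF T_cube[OF st(1)], of a'] by simp
    ultimately have "(z \<triangleleft> tmul a' s) \<triangleleft> (tmul (a - a') s + tmul (b - b') t + tmul (k - k') ?c) = z \<triangleleft> tmul a' s"
      by (simp add: add.assoc)
    moreover have "(z \<triangleleft> tmul a' s) \<triangleleft> ?c \<noteq> z \<triangleleft> tmul a' s"
    proof -
      have "(z \<triangleleft> tmul a' s) \<triangleleft> ?c = (z \<triangleleft> ?c) \<triangleleft> tmul a' s"
        using tmul_comm[OF gcomm_left[OF st, symmetric], of a'] by (simp flip: act_plus)
      then show ?thesis using z by (simp add: act_inj)
    qed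
    ultimately have "a - a' = 0 \<and> b - b' = 0 \<and> k - k' = 0" using comb3_fix[OF st] by blast
    then show "w = w'" by (simp add: w)
  qed
  then have "range (\<lambda>w. z \<triangleleft> g w) = UNIV"
    by (intro card_subset_eq) (auto simp: card_image card27 card_prod)
  then obtain w where "e = z \<triangleleft> g w" by (metis UNIV_I imageE)
  then have "z \<triangleleft> ?c \<triangleleft> g w = z \<triangleleft> g w" using fx gc[of w] by (metis act_plus)
  then show False using z by (simp add: act_inj)
qed

end

section \<open>The maps \<open>P x\<close>, and central permutations\<close>

locale exp3 = rbol27 +
  assumes three: "s \<in> S \<Longrightarrow> s + s + s = 0"
begin

sublocale cs: cube_set S
  by unfold_locales (auto simp: card27 S_tw three intro: S_fix)

lemma R_eq_iff: "R x = R y \<longleftrightarrow> x = y"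
  using R_inj by metis

definition P :: "'a \<Rightarrow> 'a sym" where "P x = Abs_sym (\<lambda>y. (x \<cdot> y) \<cdot> x)"

lemma act_P: "y \<triangleleft> P x = (x \<cdot> y) \<cdot> x"
proof -
  have "inj (\<lambda>y. (x \<cdot> y) \<cdot> x)" by (meson injI injL injR)
  then have "bij (\<lambda>y. (x \<cdot> y) \<cdot> x)" by (simp add: bij_def finite_UNIV_inj_surj)
  then show ?thesis by (simp add: act_def P_def Abs_sym_inverse)
qed

lemma R_P: "R (y \<triangleleft> P x) = R x + R y + R x"
  by (simp add: act_P R_bol)

lemma R_neg_P: "R (y \<triangleleft> - P x) = - R x + R y + - R x"
proof -
  have "R y = R x + R (y \<triangleleft> - P x) + R x" using R_P[of "y \<triangleleft> - P x" x] by simp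
  then show ?thesis by (simp add: add.assoc)
qed

lemma P_ext: "(\<And>y. R (y \<triangleleft> p) = R (y \<triangleleft> q)) \<Longrightarrow> p = q"
  by (rule act_ext) (simp add: R_eq_iff)

text \<open>Applying \<open>R\<close> turns \<open>P x\<close> into the sandwich by
  \<open>R x\<close>, so each requirement reduces to one on \<open>S\<close>; fixed points are
  excluded by \<open>P_fix\<close>.\<close>

sublocale ps: cube_set "range P"
proof
  have Pe: "P e = 0" by (rule act_ext) (simp add: act_P)
  then show "0 \<in> range P" by (metis rangeI)
  show "s + t + s \<in> range P" if st: "s \<in> range P" "t \<in> range P" for s t
  proof -
    obtain x y where "s = P x" "t = P y" using st by blast
    moreover have "P x + P y + P x = P ((x \<cdot> y) \<cdot> x)"
      by (rule P_ext) (simp add: act_plus R_P R_bol add.assoc)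
    ultimately show ?thesis by simp
  qed
  show "s + s + s = 0" if s: "s \<in> range P" for s
  proof -
    obtain x where "s = P x" using s by blast
    moreover have "P x + P x + P x = 0"
    proof (rule P_ext)
      fix y
      have "R (y \<triangleleft> (P x + P x + P x)) = (R x + R x + R x) + R y + (R x + R x + R x)"
        by (simp add: act_plus R_P add.assoc)
      then show "R (y \<triangleleft> (P x + P x + P x)) = R (y \<triangleleft> 0)" by (simp only: three[OF S_R]) simp
    qed
    ultimately show ?thesis by simp
  qed
  show "s = 0" if s: "s \<in> range P" "v \<triangleleft> s = v" for s v
  proof -
    obtain x where x: "s = P x" using s by blast
    then have "R x + R v + R x = R v" using s R_P by metis
    then have "R x = R e" using P_fix[OF S_R S_R] by simp
    then have "x = e" by (rule R_eq_iff[THEN iffD1])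
    then show ?thesis using x Pe by simp
  qed
qed (rule card27)

text \<open>\<open>R\<close> takes the value of the commutator at \<open>e\<close> to
  \<open>?t + ?s + - ?t + - ?s + ?c\<close>. As \<open>?c\<close> commutes with \<open>?s\<close>
  and \<open>?t\<close>, this is \<open>- ?c + ?c\<close>, so \<open>e\<close> is fixed and
  \<open>gcomm_fix_zero\<close> applies.\<close>

lemma P_comm: "P x + P y = P y + P x"
proof -
  let ?s = "R x" and ?t = "R y"
  let ?c = "gcomm ?s ?t"
  have ct: "?c + ?t = ?t + ?c" and csx: "?c + ?s = ?s + ?c" using cs.gcomm_right cs.gcomm_left by auto
  have "?t + ?s + - ?t + - ?s = (?s + ?t) + - ?c + - ?t + - ?s"
    by (simp only: gcomm_swap[of ?s ?t]) (simp add: add.assoc)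
  also have "\<dots> = ?s + (?t + - ?c) + - ?t + - ?s" by (simp only: add.assoc)
  also have "?t + - ?c = - ?c + ?t" by (rule comm_neg[OF ct, symmetric])
  also have "?s + (- ?c + ?t) + - ?t + - ?s = (?s + - ?c) + - ?s" by (simp add: add.assoc)
  also have "?s + - ?c = - ?c + ?s" by (rule comm_neg[OF csx, symmetric])
  finally have X: "?t + ?s + - ?t + - ?s = - ?c" by (simp add: add.assoc)
  have "R (e \<triangleleft> gcomm (P x) (P y)) = (?t + ?s + - ?t + - ?s) + ?c"
    by (simp only: gcomm_def act_plus R_P R_neg_P) (simp add: add.assoc)
  then have "R (e \<triangleleft> gcomm (P x) (P y)) = R e" by (simp add: X)
  then have "e \<triangleleft> gcomm (P x) (P y) = e" by (simp only: R_eq_iff)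
  then have "gcomm (P x) (P y) = 0" by (intro ps.gcomm_fix_zero) auto
  then show ?thesis by (rule gcomm_zeroD)
qed

definition "central z \<longleftrightarrow> (\<forall>x. z + R x = R x + z)"

lemma centralD: "central z \<Longrightarrow> s \<in> S \<Longrightarrow> z + s = s + z"
  by (auto simp: central_def S_def)

text \<open>Commutativity of \<open>P x\<close> and \<open>P y\<close>, applied to \<open>R z\<close>, says exactly that the commutator is central.\<close>

lemma gcomm_central: "central (gcomm (R x) (R y))"
  unfolding central_def
proof
  fix z
  let ?s = "R x" and ?t = "R y" and ?r = "R z"
  let ?c = "gcomm ?s ?t"
  have "R (z \<triangleleft> P x \<triangleleft> P y) = R (z \<triangleleft> P y \<triangleleft> P x)" using P_comm[of x y] by (simp flip: act_plus)
  then have a: "?t + ?s + ?r + ?s + ?t = ?s + ?t + ?r + ?t + ?s" by (simp add: R_P add.assoc)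
  have "- (?t + ?s) + (?s + ?t + ?r + ?t + ?s) = ?r + (?s + ?t)"
    by (simp only: a[symmetric]) (simp add: minus_add add.assoc)
  moreover have "- (?t + ?s) + (?s + ?t + ?r + ?t + ?s) = ?c + ?r + (?t + ?s)"
    by (simp add: gcomm_def minus_add add.assoc)
  moreover have "?s + ?t = ?c + (?t + ?s)"
    using cs.gcomm_right[of ?s ?t] cs.gcomm_left[of ?s ?t] gcomm_swap[of ?s ?t] by simp (metis add.assoc)
  ultimately have "?c + ?r + (?t + ?s) = ?r + ?c + (?t + ?s)" by (simp add: add.assoc)
  then show "?c + ?r = ?r + ?c" by (rule add_right_imp_eq)
qed

lemma central_plus: "central a \<Longrightarrow> central b \<Longrightarrow> central (a + b)"
  unfolding central_def by (blast intro: comm_plus)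

lemma central_neg: "central a \<Longrightarrow> central (- a)"
  unfolding central_def by (blast intro: comm_neg)

lemma central_tmul: "central a \<Longrightarrow> central (tmul k a)"
  unfolding central_def by (blast intro: tmul_comm)

lemma central_0: "central 0"
  by (simp add: central_def)

lemma central_fix: "central z \<Longrightarrow> v \<triangleleft> z = v \<Longrightarrow> z = 0"
proof (rule act_ext)
  fix y
  assume z: "central z" "v \<triangleleft> z = v"
  have "inj ((\<cdot>) v)" by (meson injI injL)
  then obtain w where "y = v \<cdot> w" by (metis finite_UNIV_inj_surj finite_class.finite_UNIV surjD)
  then have "y \<triangleleft> z = v \<triangleleft> z \<triangleleft> R w" using z(1) by (simp add: central_def flip: act_plus act_R)
  then show "y \<triangleleft> z = y \<triangleleft> 0" using z(2) \<open>y = v \<cdot> w\<close> by simp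
qed

lemma central_eq: "central z \<Longrightarrow> central z' \<Longrightarrow> v \<triangleleft> z = v \<triangleleft> z' \<Longrightarrow> z = z'"
proof -
  assume z: "central z" "central z'" "v \<triangleleft> z = v \<triangleleft> z'"
  then have "z + - z' = 0" by (intro central_fix[of _ v] central_plus central_neg) (simp_all add: act_eq_iff)
  then show "z = z'" using eq_neg_iff_add_eq_0[of z "- z'"] by simp
qed

lemma central_gcomm: "central z \<Longrightarrow> s \<in> S \<Longrightarrow> t \<in> S \<Longrightarrow> z + gcomm s t = gcomm s t + z"
  unfolding gcomm_def using centralD[of z] by (metis comm_plus comm_neg)

lemma gcomm_S_central: "s \<in> S \<Longrightarrow> t \<in> S \<Longrightarrow> central (gcomm s t)"
  using gcomm_central by (auto simp: S_def)

text \<open>At \<open>e\<close> both \<open>s + t\<close> and \<open>t + s\<close> act as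
  \<open>z + z'\<close>, so the central permutation \<open>gcomm s t\<close> has a fixed
  point.\<close>

lemma central_points_commute:
  assumes s: "s \<in> S" "e \<triangleleft> s = e \<triangleleft> z" "central z" and t: "t \<in> S" "e \<triangleleft> t = e \<triangleleft> z'" "central z'"
    and zz: "z + z' = z' + z"
  shows "gcomm s t = 0"
proof -
  have "e \<triangleleft> (s + t) = e \<triangleleft> (z + t)" by (simp add: act_plus s)
  also have "\<dots> = e \<triangleleft> (t + z)" by (simp only: centralD[OF s(3) t(1)])
  also have "\<dots> = e \<triangleleft> (z + z')" by (simp only: zz) (simp add: act_plus t)
  also have "\<dots> = e \<triangleleft> (s + z')" by (simp add: act_plus s)
  also have "\<dots> = e \<triangleleft> (z' + s)" by (simp only: centralD[OF t(3) s(1)])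
  also have "\<dots> = e \<triangleleft> (t + s)" by (simp add: act_plus t)
  finally have "(e \<triangleleft> (t + s)) \<triangleleft> gcomm s t = e \<triangleleft> (t + s)"
    using gcomm_swap[of s t] by (simp flip: act_plus)
  then show ?thesis using central_fix gcomm_S_central s(1) t(1) by blast
qed

end

section \<open>Coordinates for noncommutative \<open>S\<close> in exponent 3\<close>

lemma tmul_inj: "s + s + s = 0 \<Longrightarrow> s \<noteq> 0 \<Longrightarrow> tmul x s = tmul y s \<Longrightarrow> x = y"
proof -
  assume s: "s + s + s = 0" "s \<noteq> 0" "tmul x s = tmul y s"
  then have "s + s \<noteq> 0" by (metis add_0)
  have "s + s \<noteq> s" using s(2) by (metis add.right_neutral add_left_cancel)
  then show ?thesis
    using f3_cases[of x] f3_cases[of y] s(2,3) \<open>s + s \<noteq> 0\<close> by (elim disjE) auto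
qed

text \<open>\<open>U\<close>, \<open>W\<close>, \<open>T\<close> play the role of a basis. The
  central \<open>zr\<close> need not lie in \<open>S\<close>; \<open>W\<close> replaces it there.
  The sign in \<open>cUT\<close> is the one that leads to a companion matrix.\<close>

locale exp3_frame0 = exp3 mul e for mul :: "'a::finite \<Rightarrow> 'a \<Rightarrow> 'a" (infixl "\<cdot>" 70) and e +
  fixes U W T zr :: "'a sym"
  assumes US: "U \<in> S" and WS: "W \<in> S" and TS: "T \<in> S"
    and cUT: "gcomm U T = - zr" and zr: "central zr" "zr \<noteq> 0"
    and cUW: "gcomm U W = 0" and eW: "e \<triangleleft> W = e \<triangleleft> zr"
    and indep: "\<And>i j. tmul i U + tmul j W = 0 \<Longrightarrow> i = 0 \<and> j = 0"
begin

definition "g = gcomm U T"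
definition "h = gcomm W T"

lemma g: "central g" "g + g + g = 0" "g \<noteq> 0"
  using gcomm_S_central[OF US TS] cs.gcomm_cube[OF US TS] zr(2) by (simp_all add: g_def cUT)

lemma h: "central h" "h + h + h = 0"
  using gcomm_S_central[OF WS TS] cs.gcomm_cube[OF WS TS] by (simp_all add: h_def)

lemma TU: "tmul k T + tmul i U = tmul i U + tmul k T + tmul (- (k * i)) g"
proof -
  have "tmul (k * i) (gcomm T U) = tmul (- (k * i)) g"
    using g(2) tmul_neg[OF g(2)] f3_cases[of "k * i"]
    by (auto simp: gcomm_neg[of T U] g_def[symmetric] minus_add[symmetric] simp del: f3_numerals)
  then show ?thesis using cs.gcomm_tmul_T[OF TS US, of k i] by simp
qed

lemma TW: "tmul k T + tmul i W = tmul i W + tmul k T + tmul (- (k * i)) h"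
proof -
  have "tmul (k * i) (gcomm T W) = tmul (- (k * i)) h"
    using h(2) tmul_neg[OF h(2)] f3_cases[of "k * i"]
    by (auto simp: gcomm_neg[of T W] h_def[symmetric] minus_add[symmetric] simp del: f3_numerals)
  then show ?thesis using cs.gcomm_tmul_T[OF TS WS, of k i] by simp
qed

lemma WU: "tmul j W + tmul i U = tmul i U + tmul j W"
  using gcomm_zeroD[OF cUW] by (metis tmul_comm)

definition N :: "3 \<Rightarrow> 3 \<Rightarrow> 3 \<Rightarrow> 'a sym \<Rightarrow> 'a sym" where
  "N i j k z = tmul i U + tmul j W + tmul k T + z"

lemma N_add:
  assumes z: "central z"
  shows "N i j k z + N i' j' k' z' = N (i + i') (j + j') (k + k') (tmul (- (k * j')) h + tmul (- (k * i')) g + z + z')"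
proof -
  have c: "z' + tmul m s = tmul m s + z'" if "central z'" "s \<in> S" for z' s m
    using tmul_comm centralD[OF that] by metis
  note zU = c[OF z US] and zW = c[OF z WS] and zT = c[OF z TS]
  have gW: "tmul n g + tmul m W = tmul m W + tmul n g" and gT: "tmul n g + tmul m T = tmul m T + tmul n g"
    and hT: "tmul n h + tmul m T = tmul m T + tmul n h" for n m
    using c central_tmul g(1) h(1) WS TS by auto
  let ?g = "tmul (- (k * i')) g" and ?h = "tmul (- (k * j')) h"
  have "N i j k z + N i' j' k' z' = tmul i U + tmul j W + tmul k T + (z + tmul i' U) + tmul j' W + tmul k' T + z'"
    by (simp only: N_def add.assoc)
  also have "\<dots> = tmul i U + tmul j W + (tmul k T + tmul i' U) + (z + tmul j' W) + tmul k' T + z'"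
    by (simp only: zU) (simp only: add.assoc)
  also have "\<dots> = tmul i U + tmul j W + tmul i' U + tmul k T + (?g + tmul j' W) + (z + tmul k' T) + z'"
    by (simp only: zW TU) (simp only: add.assoc)
  also have "\<dots> = tmul i U + (tmul j W + tmul i' U) + (tmul k T + tmul j' W) + (?g + tmul k' T) + z + z'"
    by (simp only: zT gW) (simp only: add.assoc)
  also have "\<dots> = tmul i U + tmul i' U + tmul j W + tmul j' W + tmul k T + (?h + tmul k' T) + ?g + z + z'"
    by (simp only: gT TW WU) (simp only: add.assoc)
  also have "\<dots> = (tmul i U + tmul i' U) + (tmul j W + tmul j' W) + (tmul k T + tmul k' T) + (?h + ?g + z + z')"
    by (simp only: hT) (simp only: add.assoc)
  finally show ?thesis
    by (simp only: N_def tmul_add[OF three[OF US]] tmul_add[OF three[OF WS]] tmul_add[OF three[OF TS]])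
qed

text \<open>The central commutator of \<open>T\<close> with
  \<open>tmul i U + tmul j W\<close>.\<close>

definition Y :: "3 \<Rightarrow> 3 \<Rightarrow> 'a sym" where "Y i j = tmul (- j) h + tmul (- i) g"

lemma Y: "central (Y i j)"
  by (simp add: Y_def central_plus central_tmul g h)

lemma hg: "h + g = g + h"
  using central_gcomm[OF h(1) US TS] by (simp add: g_def)

lemma tmul_Y: "tmul (- k) (Y i j) = tmul (k * j) h + tmul (k * i) g"
proof -
  have c: "tmul (- j) h + tmul (- i) g = tmul (- i) g + tmul (- j) h" using hg by (metis tmul_comm)
  show ?thesis by (simp add: Y_def tmul_plus[OF c] tmul_mult g h)
qed

text \<open>The central part is the one for which the normal form lies in \<open>S\<close>, namely
\<open>2k T + (i U + j W) + 2k T\<close>.\<close>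

definition PT :: "3 \<Rightarrow> 3 \<Rightarrow> 3 \<Rightarrow> 'a sym" where "PT i j k = N i j k (tmul (- k) (Y i j))"

lemma PT_S: "PT i j k \<in> S"
proof -
  \<comment> \<open>\<open>U\<close> and \<open>W\<close> commute, so splitting \<open>j\<close> as
    \<open>2 * j + 2 * j\<close> makes the sum a sandwich.\<close>
  have "tmul i U + tmul j W = tmul (2 * j) W + tmul i U + tmul (2 * j) W"
  proof -
    have "tmul j W = tmul (2 * j) W + tmul (2 * j) W"
      using tmul_add[OF three[OF WS], of "2 * j" "2 * j"] f3_cases[of j] by auto
    then show ?thesis using WU by (metis add.assoc)
  qed
  then have "tmul i U + tmul j W \<in> S" using S_tw cs.T_tmul US WS by metis
  then have "tmul (2 * k) T + (tmul i U + tmul j W) + tmul (2 * k) T \<in> S"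
    using S_tw cs.T_tmul TS by blast
  also have "tmul (2 * k) T + (tmul i U + tmul j W) + tmul (2 * k) T = N 0 0 (2 * k) 0 + N i j 0 0 + N 0 0 (2 * k) 0"
    by (simp add: N_def add.assoc)
  also have "\<dots> = PT i j k"
  proof -
    have eqs: "2 * k + 2 * k = k" "- (2 * k * j) = k * j" "- (2 * k * i) = k * i"
      using f3_cases[of k] f3_cases[of i] f3_cases[of j] by (elim disjE; simp)+
    show ?thesis
      by (simp add: N_add central_0 central_plus central_tmul g h PT_def tmul_Y eqs)
  qed
  finally show ?thesis .
qed

definition pt :: "3 \<times> 3 \<times> 3 \<Rightarrow> 'a" where "pt = (\<lambda>(i, j, k). e \<triangleleft> PT i j k)"

lemma gcomm_PT_U: "gcomm (PT i j k) U = tmul (- k) g"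
proof -
  have cz: "central (tmul (- k) (Y i j))" by (intro central_tmul Y)
  have "- (N 1 0 0 0 + PT i j k) + (PT i j k + N 1 0 0 0) = tmul (- k) g"
  proof -
    have "N 1 0 0 0 + PT i j k = N (i + 1) j k (tmul (- k) (Y i j))"
      by (simp add: PT_def N_add central_0 add.commute)
    moreover have "PT i j k + N 1 0 0 0 = N (i + 1) j k (tmul (- k) g + tmul (- k) (Y i j))"
      by (simp add: PT_def N_add cz)
    moreover have "tmul (- k) g + tmul (- k) (Y i j) = tmul (- k) (Y i j) + tmul (- k) g"
      using central_gcomm[OF cz US TS] by (metis g_def tmul_comm)
    ultimately show ?thesis by (simp add: N_def minus_add add.assoc)
  qed
  then show ?thesis by (simp add: gcomm_def N_def minus_add add.assoc)
qed

text \<open>Commutators recover the coordinates: that with \<open>U\<close> gives \<open>k\<close>,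
  that with \<open>T\<close> gives \<open>Y i j\<close>, and what remains is
  \<open>tmul i U + tmul j W\<close>, decided by \<open>indep\<close>.\<close>

lemma pt_inj: "inj pt"
proof (rule injI)
  fix v w :: "3 \<times> 3 \<times> 3"
  obtain i j k i' j' k' where vw: "v = (i, j, k)" "w = (i', j', k')" by (metis prod_cases3)
  assume "pt v = pt w"
  then have eq: "PT i j k = PT i' j' k'" using S_eq[OF PT_S PT_S] by (simp add: pt_def vw)
  have cz: "central (tmul (- k) (Y i j))" for i j k by (intro central_tmul Y)
  have "tmul (- k) g = tmul (- k') g" using eq gcomm_PT_U by metis
  then have k: "k = k'" using tmul_inj[OF g(2,3)] by (metis neg_equal_iff_equal)
  have "- (PT i j k + N 0 0 1 0) + (N 0 0 1 0 + PT i j k) = Y i j" for i j k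
  proof -
    have "N 0 0 1 0 + PT i j k = N i j (k + 1) (Y i j + tmul (- k) (Y i j))"
      by (simp add: PT_def N_add central_0 add.commute[of 1 k] Y_def)
    moreover have "PT i j k + N 0 0 1 0 = N i j (k + 1) (tmul (- k) (Y i j))"
      by (simp add: PT_def N_add cz)
    moreover have "Y i j + tmul (- k) (Y i j) = tmul (- k) (Y i j) + Y i j"
      using tmul_comm[of "Y i j" "Y i j"] by simp
    ultimately show ?thesis by (simp add: N_def minus_add add.assoc)
  qed
  then have "Y i j = Y i' j'" using eq by metis
  then have "tmul i U + tmul j W = tmul i' U + tmul j' W"
    using eq k by (simp add: PT_def N_def)
  then have "- tmul i' U + (tmul i U + tmul j W) + - tmul j' W = - tmul i' U + (tmul i' U + tmul j' W) + - tmul j' W"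
    by simp
  then have "(- tmul i' U + tmul i U) + (tmul j W + - tmul j' W) = 0" by (simp add: add.assoc)
  moreover have "- tmul i' U + tmul i U = tmul (i - i') U" "tmul j W + - tmul j' W = tmul (j - j') W"
    using tmul_add[OF three[OF US], of "- i'" i] tmul_neg[OF three[OF US], of i']
      tmul_add[OF three[OF WS], of j "- j'"] tmul_neg[OF three[OF WS], of j']
    by simp_all
  ultimately have "i - i' = 0 \<and> j - j' = 0" using indep by metis
  then show "v = w" using k by (simp add: vw)
qed

lemma pt_bij: "bij pt"
proof -
  have "range pt = UNIV"
    using card_image[OF pt_inj] by (intro card_subset_eq) (auto simp: card27 card_prod)
  then show ?thesis using pt_inj by (simp add: bij_def)
qed

end

text \<open>With \<open>A\<close> the companion matrix of \<open>X\<^sup>2 - q X - p\<close>, commutation with \<open>k T\<close> acts on the span of \<open>U\<close> and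
\<open>W\<close> as \<open>k A\<close>, and the product of two elements is their sum corrected by \<open>(1 - n A)\<^sup>-\<^sup>1\<close> applied to
their commutator. The factor \<open>companion_loop_d\<close> is the determinant of \<open>1 - n A\<close>, which is its own inverse when
it is nonzero.\<close>

definition companion_loop_d :: "3 \<Rightarrow> 3 \<Rightarrow> 3 \<Rightarrow> 3" where "companion_loop_d p q n = 1 - n * q - n * n * p"

definition companion_loop_b :: "3 \<Rightarrow> 3 \<Rightarrow> 3 \<Rightarrow> 3 \<Rightarrow> 3 \<Rightarrow> 3" where
  "companion_loop_b p q n m1 m2 = companion_loop_d p q n * (m1 + m2 * q + n * m2 * p)"

definition companion_loop_a :: "3 \<Rightarrow> 3 \<Rightarrow> 3 \<Rightarrow> 3 \<Rightarrow> 3 \<Rightarrow> 3" where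
  "companion_loop_a p q n m1 m2 = p * (m2 + n * companion_loop_b p q n m1 m2)"

fun companion_loop :: "3 \<Rightarrow> 3 \<Rightarrow> 3 \<times> 3 \<times> 3 \<Rightarrow> 3 \<times> 3 \<times> 3 \<Rightarrow> 3 \<times> 3 \<times> 3" where
  "companion_loop p q (i, j, k) (i', j', k') =
    (i + i' + companion_loop_a p q (k + k') (i * k' - k * i') (j * k' - k * j'),
     j + j' + companion_loop_b p q (k + k') (i * k' - k * i') (j * k' - k * j'), k + k')"

text \<open>At \<open>e\<close>, \<open>zu\<close> and \<open>zr\<close> look like \<open>U\<close>
  and \<open>W\<close>; so, up to sign, commutation with \<open>T\<close> sends \<open>U\<close> to
  \<open>W\<close> and \<open>W\<close> to \<open>p U + q W\<close>. The second alternative of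
  \<open>eU\<close> covers the Heisenberg group, where \<open>zu\<close> is taken to be
  zero.\<close>

locale exp3_frame = exp3_frame0 +
  fixes zu p q
  assumes zu: "central zu" "zu + zu + zu = 0" "zu + zr = zr + zu"
    and hpq: "gcomm W T = - (tmul p zu + tmul q zr)"
    and eU: "e \<triangleleft> U = e \<triangleleft> zu \<or> p = 0 \<and> q = 0"
begin

definition zz :: "3 \<Rightarrow> 3 \<Rightarrow> 'a sym" where "zz a b = tmul a zu + tmul b zr"

lemma zr3: "zr + zr + zr = 0"
proof -
  have "zr = - g" by (simp add: g_def cUT)
  then have "zr + zr + zr = - (g + g + g)" by (simp add: minus_add add.assoc)
  then show ?thesis using g(2) by simp
qed

lemma zz_add: "zz a b + zz a' b' = zz (a + a') (b + b')"
proof -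
  have "tmul b zr + tmul a' zu = tmul a' zu + tmul b zr" using zu(3) by (metis tmul_comm)
  then show ?thesis unfolding zz_def tmul_add[OF zr3] tmul_add[OF zu(2)] by (metis add.assoc)
qed

lemma zz_0: "zz 0 0 = 0"
  by (simp add: zz_def)

lemma zz_neg: "- zz a b = zz (- a) (- b)"
  using zz_add[of "- a" "- b" a b] by (simp add: zz_0 eq_neg_iff_add_eq_0 neg_eq_iff_add_eq_0)
    (metis add.left_inverse add_eq_0_iff neg_eq_iff_add_eq_0 zz_0 zz_add)

lemma zz_central: "central (zz a b)"
  by (simp add: zz_def central_plus central_tmul zu zr)

lemma zz_tmul: "tmul x (zz a b) = zz (x * a) (x * b)"
proof -
  have c: "tmul a zu + tmul b zr = tmul b zr + tmul a zu" using zu(3) by (metis tmul_comm)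
  show ?thesis by (simp add: zz_def tmul_plus[OF c] tmul_mult zr3 zu)
qed

lemma g_zz: "g = zz 0 (- 1)"
  using zz_neg[of 0 1] by (simp add: g_def cUT zz_def)

lemma h_zz: "h = zz (- p) (- q)"
  using zz_neg[of p q] by (simp add: h_def hpq zz_def)

text \<open>At \<open>e\<close> the central \<open>zz a b\<close> does the work of
  \<open>tmul a U + tmul b W\<close>, so a shift of coordinates can be traded for a central term.
  The shift in turn changes the central part prescribed by \<open>PT\<close>, which is where the
  inverse of \<open>1 - n A\<close> comes from.\<close>

lemma pt_shift:
  assumes a: "p = 0 \<and> q = 0 \<Longrightarrow> a = 0"
  shows "pt (i + a, j + b, k) =
    e \<triangleleft> N i j k (zz (a - k * (j + b) * p) (b - k * (j + b) * q - k * (i + a)))"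
proof -
  have eW': "e \<triangleleft> tmul b W = e \<triangleleft> tmul b zr"
  proof -
    have "e \<triangleleft> (W + W) = e \<triangleleft> (W + zr)"
      using centralD[OF zr(1) WS] by (metis act_plus eW)
    then have "e \<triangleleft> (W + W) = e \<triangleleft> (zr + zr)" by (simp add: act_plus eW)
    then show ?thesis using f3_cases[of b] eW by auto
  qed
  have eU': "e \<triangleleft> tmul a U = e \<triangleleft> tmul a zu"
  proof (cases "p = 0 \<and> q = 0")
    case True
    then show ?thesis using a by simp
  next
    case False
    then have eU: "e \<triangleleft> U = e \<triangleleft> zu" using eU by blast
    have "e \<triangleleft> (U + U) = e \<triangleleft> (U + zu)"
      using centralD[OF zu(1) US] by (metis act_plus eU)
    then have "e \<triangleleft> (U + U) = e \<triangleleft> (zu + zu)" by (simp add: act_plus eU)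
    then show ?thesis using f3_cases[of a] eU by auto
  qed
  define z where "z = tmul (- k) (Y (i + a) (j + b))"
  have z: "z = zz (- (k * (j + b) * p)) (- (k * (j + b) * q) - k * (i + a))"
    by (simp only: z_def tmul_Y g_zz h_zz zz_tmul zz_add) (rule arg_cong2[where f = zz]; simp add: algebra_simps del: f3_numerals)
  have "pt (i + a, j + b, k) = e \<triangleleft> (N a b 0 0 + N i j k z)"
    by (simp add: N_add central_0 pt_def PT_def z_def add.commute)
  also have "\<dots> = e \<triangleleft> tmul a U \<triangleleft> tmul b W \<triangleleft> N i j k z"
    by (simp add: N_def[of a b 0 0] act_plus)
  also have "e \<triangleleft> tmul a U \<triangleleft> tmul b W = e \<triangleleft> zz a b"
  proof -
    have "e \<triangleleft> tmul a U \<triangleleft> tmul b W = e \<triangleleft> (tmul a zu + tmul b W)" by (simp add: eU' act_plus)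
    also have "\<dots> = e \<triangleleft> (tmul b W + tmul a zu)"
      using centralD[OF central_tmul[OF zu(1)] cs.T_tmul[OF WS]] by simp
    also have "\<dots> = e \<triangleleft> (tmul b zr + tmul a zu)" by (simp add: act_plus eW')
    also have "tmul b zr + tmul a zu = zz a b" using zu(3) unfolding zz_def by (metis tmul_comm)
    finally show ?thesis .
  qed
  also have "e \<triangleleft> zz a b \<triangleleft> N i j k z = e \<triangleleft> (zz a b + N i j k z)" by (simp add: act_plus)
  also have "zz a b + N i j k z = N i j k (zz a b + z)"
  proof -
    have c: "zz a b + tmul m s = tmul m s + zz a b" if "s \<in> S" for m s
      using centralD[OF zz_central cs.T_tmul[OF that]] .
    show ?thesis
      unfolding N_def using c[OF US, of i] c[OF WS, of j] c[OF TS, of k] by (metis add.assoc)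
  qed
  also have "zz a b + z = zz (a - k * (j + b) * p) (b - k * (j + b) * q - k * (i + a))"
    by (simp only: z zz_add) (rule arg_cong2[where f = zz]; simp add: algebra_simps)
  finally show ?thesis .
qed

text \<open>A zero determinant would make the points with coordinates \<open>(n * p, 1, n)\<close>
  and \<open>(0, 0, n)\<close> coincide.\<close>

lemma d_nonzero: "companion_loop_d p q n \<noteq> 0"
proof
  assume d: "companion_loop_d p q n = 0"
  have pq: "\<not> (p = 0 \<and> q = 0)" using d by (auto simp: companion_loop_d_def)
  have "pt (0 + n * p, 0 + 1, n) = e \<triangleleft> N 0 0 n (zz 0 (companion_loop_d p q n))"
    using pq by (subst pt_shift) (auto simp: companion_loop_d_def algebra_simps)
  also have "\<dots> = pt (0, 0, n)" by (simp add: d zz_0 pt_def PT_def Y_def)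
  finally show False using pt_inj by (auto dest: injD)
qed

lemma d_square: "companion_loop_d p q n * companion_loop_d p q n = 1"
  using d_nonzero[of n] f3_cases[of "companion_loop_d p q n"] by auto

text \<open>The sum of two elements \<open>PT\<close> has a normal form with the wrong central part.
  By \<open>pt_shift\<close> the corrections \<open>a\<close> and \<open>b\<close> must solve a
  linear system of determinant \<open>companion_loop_d\<close>, inverted through
  \<open>d_square\<close>.\<close>

lemma pt_mul: "pt (companion_loop p q v w) = pt v \<cdot> pt w"
proof -
  obtain i j k i' j' k' where vw: "v = (i, j, k)" "w = (i', j', k')" by (metis prod_cases3)
  define b where "b = companion_loop_b p q (k + k') (i * k' - k * i') (j * k' - k * j')"
  define a where "a = companion_loop_a p q (k + k') (i * k' - k * i') (j * k' - k * j')"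
  have ab: "a = p * ((j * k' - k * j') + (k + k') * b)" by (simp add: a_def b_def companion_loop_a_def)
  have bb: "companion_loop_d p q (k + k') * b = (i * k' - k * i') + (j * k' - k * j') * q + (k + k') * (j * k' - k * j') * p"
  proof -
    have "companion_loop_d p q n * (companion_loop_d p q n * x) = x" for n x
      by (simp only: mult.assoc[symmetric] d_square) simp
    then show ?thesis by (simp only: b_def companion_loop_b_def)
  qed
  have "pt v \<cdot> pt w = e \<triangleleft> (PT i j k + PT i' j' k')"
    using S_pt[OF PT_S, of i' j' k'] act_R[of "pt v" "pt w"] by (simp add: pt_def vw act_plus)
  also have "PT i j k + PT i' j' k' = N (i + i') (j + j') (k + k')
    (zz (k * j' * p - k * j * p - k' * j' * p)
      (k * j' * q + k * i' - k * j * q - k * i - k' * j' * q - k' * i'))"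
    unfolding PT_def
    by (subst N_add, intro central_tmul Y) (simp add: tmul_Y g_zz h_zz zz_tmul zz_add algebra_simps del: f3_numerals)
  also have "e \<triangleleft> \<dots> = pt (i + i' + a, j + j' + b, k + k')"
  proof -
    have 1: "a - (k + k') * (j + j' + b) * p = k * j' * p - k * j * p - k' * j' * p"
      by (simp add: ab algebra_simps)
    have 2: "b - (k + k') * (j + j' + b) * q - (k + k') * (i + i' + a)
      = companion_loop_d p q (k + k') * b - (k + k') * (j + j') * q - (k + k') * (i + i') - (k + k') * p * (j * k' - k * j')"
      by (simp add: ab companion_loop_d_def algebra_simps)
    have 3: "\<dots> = k * j' * q + k * i' - k * j * q - k * i - k' * j' * q - k' * i'"
      unfolding bb by (simp add: algebra_simps)
    have "p = 0 \<and> q = 0 \<Longrightarrow> a = 0" by (simp add: ab)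
    from pt_shift[OF this, of "i + i'" "j + j'" b "k + k'"] show ?thesis
      by (simp only: 1 2 3)
  qed
  finally show ?thesis by (simp add: vw a_def b_def)
qed

end

fun additive_loop :: "3 \<times> 3 \<times> 3 \<Rightarrow> 3 \<times> 3 \<times> 3 \<Rightarrow> 3 \<times> 3 \<times> 3" where
  "additive_loop (i, j, k) (i', j', k') = (i + i', j + j', k + k')"

section \<open>Case analysis in exponent 3\<close>

context exp3
begin

lemma tmul_scale: "s \<in> S \<Longrightarrow> a \<noteq> 0 \<Longrightarrow> tmul a s = tmul b t \<Longrightarrow> t \<in> S \<Longrightarrow> s = tmul (a * b) t"
proof -
  assume a: "s \<in> S" "a \<noteq> 0" "tmul a s = tmul b t" "t \<in> S"
  have "a * a = 1" using a(2) f3_cases[of a] by auto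
  then have "s = tmul a (tmul a s)" by (simp add: tmul_mult three a(1))
  then show ?thesis by (simp add: a tmul_mult three)
qed

text \<open>Commutativity gives \<open>s + t = tmul 2 s + t + tmul 2 s\<close>, so \<open>S\<close>
  is a group, and three independent elements form a basis.\<close>

lemma abelian_case:
  assumes comm: "\<And>s t. s \<in> S \<Longrightarrow> t \<in> S \<Longrightarrow> s + t = t + s"
  shows "\<exists>h. bij h \<and> (\<forall>v w. h (additive_loop v w) = h v \<cdot> h w)"
proof -
  have plus: "s + t \<in> S" if "s \<in> S" "t \<in> S" for s t
  proof -
    have "tmul 2 s + t + tmul 2 s \<in> S" using that by (intro S_tw cs.T_tmul)
    also have "tmul 2 s + t + tmul 2 s = (tmul 2 s + tmul 2 s) + t"
      using comm[OF that(2) cs.T_tmul[OF that(1), of 2]] by (simp only: add.assoc)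
    also have "tmul 2 s + tmul 2 s = s" by (simp only: tmul_add[OF three[OF that(1)], symmetric]) simp
    finally show ?thesis .
  qed
  have ex: "\<exists>s\<in>S. s \<notin> A" if "card A < 27" "finite A" for A
    using that card_S card_mono[of A S] by (metis leD subsetI)
  obtain U where U: "U \<in> S" "U \<noteq> 0" using ex[of "{0}"] by auto
  have "card (range (\<lambda>i::3. tmul i U)) \<le> CARD(3)" by (rule card_image_le) simp
  then obtain W where W: "W \<in> S" "W \<notin> range (\<lambda>i. tmul i U)" using ex[of "range (\<lambda>i. tmul i U)"] by auto
  have "card (range (\<lambda>(i::3, j::3). tmul i U + tmul j W)) \<le> CARD(3 \<times> 3)" by (rule card_image_le) simp
  then obtain T where T: "T \<in> S" "T \<notin> range (\<lambda>(i, j). tmul i U + tmul j W)"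
    using ex[of "range (\<lambda>(i::3, j::3). tmul i U + tmul j W)"] by (auto simp: card_prod)
  define G where "G = (\<lambda>(i, j, k). tmul i U + tmul j W + tmul k T)"
  have GS: "G v \<in> S" for v
    by (auto simp: G_def split: prod.split intro!: plus cs.T_tmul U W T)
  have Gadd: "G (additive_loop v w) = G v + G w" for v w
  proof -
    obtain i j k i' j' k' where vw: "v = (i, j, k)" "w = (i', j', k')" by (metis prod_cases3)
    note S = cs.T_tmul[OF U(1)] cs.T_tmul[OF W(1)] cs.T_tmul[OF T(1)]
    have "tmul k T + (tmul i' U + tmul j' W) = (tmul i' U + tmul j' W) + tmul k T"
      by (intro comm plus S)
    moreover have "tmul j W + tmul i' U = tmul i' U + tmul j W" by (intro comm S)
    ultimately show ?thesis
      by (simp add: vw G_def tmul_add three U W T) (metis add.assoc)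
  qed
  have G0: "v = (0, 0, 0)" if "G v = 0" for v
  proof -
    obtain i j k where v: "v = (i, j, k)" by (metis prod_cases3)
    then have eq: "tmul i U + tmul j W + tmul k T = 0" using that by (simp add: G_def)
    have c: "tmul i U + tmul j W = tmul j W + tmul i U" by (intro comm cs.T_tmul U W)
    have k: "k = 0"
    proof (rule ccontr)
      assume "k \<noteq> 0"
      then have "k * k = 1" using f3_cases[of k] by auto
      then have "T = tmul k (tmul k T)" by (simp add: tmul_mult three T(1))
      also have "tmul k T = - (tmul i U + tmul j W)" using eq by (simp add: neg_eq_iff_add_eq_0 eq_neg_iff_add_eq_0)
        (metis add.inverse_inverse add_eq_0_iff minus_add)
      also have "\<dots> = tmul (- i) U + tmul (- j) W"
        by (simp only: c) (simp add: minus_add tmul_neg three U W)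
      also have "tmul k \<dots> = tmul (k * (- i)) U + tmul (k * (- j)) W"
        by (subst tmul_plus) (auto simp: tmul_mult three U W intro!: comm cs.T_tmul simp del: mult_minus_right)
      finally show False using T(2) by auto
    qed
    have j: "j = 0"
    proof (rule ccontr)
      assume j: "j \<noteq> 0"
      have "tmul j W = - tmul i U" using eq k c by (simp add: eq_neg_iff_add_eq_0)
      then have "tmul j W = tmul (- i) U" by (simp add: tmul_neg three U)
      from tmul_scale[OF W(1) j this U(1)] show False using W(2) by auto
    qed
    have "i = 0" using eq j k U tmul_inj[OF three[OF U(1)], of i 0] by simp
    then show ?thesis using v j k by simp
  qed
  define h where "h v = e \<triangleleft> G v" for v
  have "inj h"
  proof (rule injI)
    fix v w assume "h v = h w"
    then have eq: "G v = G w" using S_eq[OF GS GS] by (simp add: h_def)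
    obtain i j k i' j' k' where vw: "v = (i, j, k)" "w = (i', j', k')" by (metis prod_cases3)
    have "G (additive_loop (i - i', j - j', k - k') w) = G w" using eq by (simp add: vw)
    then have "G (i - i', j - j', k - k') + G w = 0 + G w" by (simp add: Gadd)
    then have "(i - i', j - j', k - k') = (0, 0, 0)" by (intro G0) (rule add_right_imp_eq)
    then show "v = w" by (simp add: vw)
  qed
  moreover from this have "range h = UNIV"
    by (intro card_subset_eq) (auto simp: card_image card27 card_prod)
  moreover have "h (additive_loop v w) = h v \<cdot> h w" for v w
    using S_pt[OF GS, of w] act_R[of "h v" "h w"] by (simp add: h_def Gadd act_plus)
  ultimately show ?thesis unfolding bij_def by blast
qed

text \<open>Here some \<open>U\<close> in \<open>S\<close> agrees at \<open>e\<close> with a central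
  permutation without being central itself. The commutator with \<open>T\<close> yields
  \<open>zr\<close> and \<open>W\<close>; the point is that \<open>gcomm W T\<close> falls into the
  span of \<open>zu\<close> and \<open>zr\<close>.\<close>

lemma central_case:
  assumes U: "U \<in> S" "e \<triangleleft> U = e \<triangleleft> zu" "central zu" and T: "T \<in> S" "gcomm U T \<noteq> 0"
  shows "\<exists>W zr p q. exp3_frame mul e U W T zr zu p q"
proof -
  define zr where "zr = - gcomm U T"
  define W where "W = R (e \<triangleleft> zr)"
  have W: "W \<in> S" "e \<triangleleft> W = e \<triangleleft> zr" by (simp_all add: W_def)
  have zr: "central zr" "zr \<noteq> 0" using gcomm_S_central[OF U(1) T(1)] T(2) by (simp_all add: zr_def central_neg)
  have zuzr: "zu + zr = zr + zu"
    unfolding zr_def using comm_neg central_gcomm[OF U(3,1) T(1)] by metis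
  have cUW: "gcomm U W = 0" using central_points_commute[OF U W zr(1) zuzr] .
  have e2: "e \<triangleleft> (U + U) = e \<triangleleft> (zu + zu)"
  proof -
    have "e \<triangleleft> (U + U) = e \<triangleleft> (U + zu)" using centralD[OF U(3,1)] U(2) by (metis act_plus)
    then show ?thesis by (simp add: act_plus U)
  qed
  have "e \<triangleleft> (U + U + U) = e \<triangleleft> (zu + zu + zu)"
  proof -
    have "e \<triangleleft> (U + U + U) = e \<triangleleft> (zu + zu + U)" by (simp add: act_plus e2[unfolded act_plus])
    also have "\<dots> = e \<triangleleft> (U + (zu + zu))" using centralD[OF central_plus[OF U(3,3)] U(1)] by simp
    finally show ?thesis by (simp add: act_plus U)
  qed
  then have zu3: "zu + zu + zu = 0"
    using three[OF U(1)] by (intro central_fix[of _ e] central_plus U) simp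
  have U0: "U \<noteq> 0" using T(2) by (auto simp: gcomm_def)
  have indep: "i = 0 \<and> j = 0" if ij: "tmul i U + tmul j W = 0" for i j
  proof (cases "j = 0")
    case True
    then show ?thesis using ij tmul_inj[OF three[OF U(1)] U0, of i 0] by simp
  next
    case False
    have "tmul i U + tmul j W = tmul j W + tmul i U" using gcomm_zeroD[OF cUW] by (metis tmul_comm)
    then have "tmul j W = tmul (- i) U"
      using ij by (simp add: tmul_neg three U eq_neg_iff_add_eq_0)
    from tmul_scale[OF W(1) False this U(1)] obtain k where k: "W = tmul k U" by blast
    have "e \<triangleleft> tmul k U = e \<triangleleft> tmul k zu" using f3_cases[of k] U(2) e2 by auto
    then have zrk: "zr = tmul k zu"
      using central_eq[OF zr(1) central_tmul[OF U(3)]] W(2) k by metis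
    then have "k * k = 1" using zr(2) f3_cases[of k] by auto
    \<comment> \<open>As \<open>k * k = 1\<close>, this makes \<open>zu + tmul m zr\<close> zero.
      Then \<open>tmul m T + U + tmul m T\<close> and \<open>tmul m T + 0 + tmul m T\<close> agree
      at \<open>e\<close>, which forces \<open>U = 0\<close>.\<close>
    define m where "m = - k"
    have "tmul m T + tmul 1 U = tmul 1 U + tmul m T + tmul (m * 1) (gcomm T U)" by (rule cs.gcomm_tmul_T[OF T(1) U(1)])
    then have TU: "tmul m T + U = U + tmul m T + tmul m zr" by (simp add: gcomm_neg[of T U] zr_def)
    have "zu + tmul m zr = tmul (1 + m * k) zu" by (simp add: tmul_add[OF zu3] zrk tmul_mult[OF zu3])
    also have "1 + m * k = 0" using \<open>k * k = 1\<close> by (simp add: m_def)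
    finally have z0: "zu + tmul m zr = 0" by simp
    have mT: "tmul m T \<in> S" using cs.T_tmul T(1) .
    have "e \<triangleleft> (tmul m T + U + tmul m T) = e \<triangleleft> (U + (tmul m T + (tmul m zr + tmul m T)))"
      by (simp only: TU add.assoc)
    also have "\<dots> = e \<triangleleft> (zu + (tmul m T + tmul m T + tmul m zr))"
      using centralD[OF central_tmul[OF zr(1)] mT, of m] by (simp add: act_plus U(2) flip: add.assoc)
    also have "\<dots> = e \<triangleleft> (tmul m T + tmul m T + (zu + tmul m zr))"
      using centralD[OF U(3) mT] by (metis add.assoc)
    finally have "e \<triangleleft> (tmul m T + U + tmul m T) = e \<triangleleft> (tmul m T + 0 + tmul m T)" by (simp add: z0)
    then have "tmul m T + U + tmul m T = tmul m T + 0 + tmul m T"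
      using S_eq[OF S_tw[OF mT U(1)] S_tw[OF mT S_0]] by blast
    then have "tmul m T + U = tmul m T + 0" by (rule add_right_imp_eq)
    then have "U = 0" by (rule add_left_imp_eq)
    then show ?thesis using U0 by simp
  qed
  interpret F: exp3_frame0 mul e U W T zr
    by unfold_locales (use U W T zr cUW indep in \<open>auto simp: zr_def\<close>)
  \<comment> \<open>Some \<open>F.PT i j k\<close> agrees with \<open>- F.h\<close> at
    \<open>e\<close>; it commutes with \<open>U\<close> by \<open>central_points_commute\<close>,
    hence \<open>k = 0\<close>.\<close>
  obtain i j k where ijk: "e \<triangleleft> - F.h = F.pt (i, j, k)"
    using F.pt_bij by (metis bij_pointE prod_cases3)
  have "F.PT i j k \<in> S" "e \<triangleleft> F.PT i j k = e \<triangleleft> - F.h" "central (- F.h)"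
    using F.PT_S ijk central_neg[OF F.h(1)] by (auto simp: F.pt_def)
  moreover have hz: "- F.h + zu = zu + - F.h"
    unfolding F.h_def using comm_neg central_gcomm[OF U(3) W(1) T(1)] by metis
  ultimately have "gcomm (F.PT i j k) U = 0"
    using central_points_commute[OF _ _ _ U] by blast
  then have "k = 0" using F.gcomm_PT_U[of i j k] tmul_inj[OF F.g(2,3), of "- k" 0] by simp
  then have "e \<triangleleft> - F.h = e \<triangleleft> (tmul i U + tmul j W)"
    using ijk by (simp add: F.pt_def F.PT_def F.N_def)
  also have "\<dots> = e \<triangleleft> (tmul i zu + tmul j zr)"
  proof -
    have "e \<triangleleft> (W + W) = e \<triangleleft> (zr + zr)"
      using centralD[OF zr(1) W(1)] by (metis act_plus W(2))
    then have eW: "e \<triangleleft> tmul j W = e \<triangleleft> tmul j zr" using f3_cases[of j] W(2) by auto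
    have eU: "e \<triangleleft> tmul i U = e \<triangleleft> tmul i zu" using f3_cases[of i] U(2) e2 by auto
    have "e \<triangleleft> (tmul i U + tmul j W) = e \<triangleleft> (tmul i zu + tmul j W)" by (simp add: act_plus eU)
    also have "\<dots> = e \<triangleleft> (tmul j W + tmul i zu)"
      using centralD[OF central_tmul[OF U(3)] cs.T_tmul[OF W(1)]] by simp
    also have "\<dots> = e \<triangleleft> (tmul j zr + tmul i zu)" by (simp add: act_plus eW)
    also have "tmul j zr + tmul i zu = tmul i zu + tmul j zr" using zuzr by (metis tmul_comm)
    finally show ?thesis .
  qed
  finally have "- F.h = tmul i zu + tmul j zr"
    by (intro central_eq[of _ _ e] central_plus central_neg central_tmul F.h U zr)
  then have "gcomm W T = - (tmul i zu + tmul j zr)" unfolding F.h_def by (metis minus_minus)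
  then have "exp3_frame mul e U W T zr zu i j"
    by unfold_locales (use U zu3 zuzr in auto)
  then show ?thesis by blast
qed

text \<open>Complementary to \<open>central_case\<close>: every element of \<open>S\<close> agreeing
  at \<open>e\<close> with a central permutation commutes with \<open>S\<close>. This applies to
  \<open>W\<close>, so \<open>p\<close> and \<open>q\<close> are zero.\<close>

lemma heisenberg_case:
  assumes cc: "\<And>U zu T. U \<in> S \<Longrightarrow> e \<triangleleft> U = e \<triangleleft> zu \<Longrightarrow> central zu \<Longrightarrow> T \<in> S \<Longrightarrow> gcomm U T = 0"
    and U: "U \<in> S" and T: "T \<in> S" "gcomm U T \<noteq> 0"
  shows "\<exists>W zr. exp3_frame mul e U W T zr 0 0 0"
proof -
  define zr where "zr = - gcomm U T"
  define W where "W = R (e \<triangleleft> zr)"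
  have W: "W \<in> S" "e \<triangleleft> W = e \<triangleleft> zr" by (simp_all add: W_def)
  have zr: "central zr" "zr \<noteq> 0" using gcomm_S_central[OF U T(1)] T(2) by (simp_all add: zr_def central_neg)
  have W0: "W \<noteq> 0" using W(2) central_fix[OF zr(1), of e] zr(2) by auto
  have WT: "gcomm W t = 0" if "t \<in> S" for t using cc[OF W zr(1) that] .
  have "gcomm U W = 0" using WT[OF U] gcomm_neg[of U W] by simp
  moreover have "i = 0 \<and> j = 0" if ij: "tmul i U + tmul j W = 0" for i j
  proof (cases "i = 0")
    case True
    then show ?thesis using ij tmul_inj[OF three[OF W(1)] W0, of j 0] by simp
  next
    case False
    have "tmul i U = - tmul j W" using ij by (simp add: eq_neg_iff_add_eq_0)
    then have "tmul i U = tmul (- j) W" by (simp add: tmul_neg three W)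
    from tmul_scale[OF U False this W(1)] obtain k where "U = tmul k W" by blast
    then have "U + T = T + U" using gcomm_zeroD[OF WT[OF T(1)]] by (metis tmul_comm)
    then show ?thesis using T(2) gcomm_zeroI by blast
  qed
  ultimately have "exp3_frame mul e U W T zr 0 0 0"
    by unfold_locales (use U W T zr WT in \<open>auto simp: zr_def central_0\<close>)
  then show ?thesis by blast
qed

lemma exp3_class:
  "(\<exists>h. bij h \<and> (\<forall>v w. h (additive_loop v w) = h v \<cdot> h w)) \<or>
   (\<exists>p q h. (p, q) \<in> {(0, 0), (1, 1), (1, 2), (2, 0)} \<and> bij h \<and> (\<forall>v w. h (companion_loop p q v w) = h v \<cdot> h w))"
proof (cases "\<forall>s\<in>S. \<forall>t\<in>S. s + t = t + s")
  case True
  then show ?thesis using abelian_case by blast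
next
  case False
  then have ex: "\<exists>s\<in>S. \<exists>t\<in>S. gcomm s t \<noteq> 0" using gcomm_zeroD by blast
  have "\<exists>U W T zr zu p q. exp3_frame mul e U W T zr zu p q"
    using central_case heisenberg_case ex by metis
  then obtain U W T zr zu p q where "exp3_frame mul e U W T zr zu p q" by blast
  then interpret F: exp3_frame mul e U W T zr zu p q .
  \<comment> \<open>The determinants at 1 and 2 exclude the five other pairs, whose matrices have a
    nonzero eigenvalue.\<close>
  have "(p, q) \<in> {(0, 0), (1, 1), (1, 2), (2, 0)}"
    using F.d_nonzero[of 1] F.d_nonzero[of 2] f3_cases[of p] f3_cases[of q]
    by (elim disjE) (simp_all add: companion_loop_d_def)
  then show ?thesis using F.pt_bij F.pt_mul by blast
qed

end

subsection \<open>Central extensions given by binary cubic forms\<close>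

definition cubic_form :: "3 \<Rightarrow> 3 \<Rightarrow> 3 \<Rightarrow> 3 \<Rightarrow> 3 \<Rightarrow> 3 \<Rightarrow> 3" where
  "cubic_form c0 c1 c2 c3 i j = c0 * (i * i * i) + c1 * (i * i * j) + c2 * (i * j * j) + c3 * (j * j * j)"

text \<open>Up to sign, the terms with \<open>c0\<close> and \<open>c3\<close> are carry cocycles
  \<open>((i + k)^3 - i^3 - k^3) / 3\<close>. The mixed terms are one-sided variants compatible with
  the right Bol law and the cube formula; \<open>l\<close> weighs the alternating form.\<close>

definition cubic_cocycle :: "3 \<Rightarrow> 3 \<Rightarrow> 3 \<Rightarrow> 3 \<Rightarrow> 3 \<Rightarrow> 3 \<Rightarrow> 3 \<Rightarrow> 3 \<Rightarrow> 3 \<Rightarrow> 3" where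
  "cubic_cocycle c0 c1 c2 c3 l i j k m = l * (i * m - j * k) - (c0 * (i * i * k + i * k * k)
     + c1 * (i * i * m + i * k * m) + c2 * (j * j * k + j * k * m) + c3 * (j * j * m + j * m * m))"

text \<open>The cube of \<open>(i, j, k)\<close> is \<open>(0, 0, q i j)\<close> for the cubic form \<open>q\<close> with coefficients \<open>c0, \<dots>, c3\<close>.\<close>

fun cubic_loop :: "3 \<Rightarrow> 3 \<Rightarrow> 3 \<Rightarrow> 3 \<Rightarrow> 3 \<Rightarrow> 3 \<times> 3 \<times> 3 \<Rightarrow> 3 \<times> 3 \<times> 3 \<Rightarrow> 3 \<times> 3 \<times> 3" where
  "cubic_loop c0 c1 c2 c3 l (i, j, a) (k, m, b) = (i + k, j + m, a + b + cubic_cocycle c0 c1 c2 c3 l i j k m)"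

lemma cubic_loop_rbol27: "rbol27 (cubic_loop c0 c1 c2 c3 l) (0, 0, 0)"
proof
  show "CARD(3 \<times> 3 \<times> 3) = 27" by (simp add: card_prod)
  fix x y z :: "3 \<times> 3 \<times> 3"
  obtain i j a k m b p q c where xyz: "x = (i, j, a)" "y = (k, m, b)" "z = (p, q, c)"
    by (metis prod_cases3)
  show "cubic_loop c0 c1 c2 c3 l (0, 0, 0) x = x" "cubic_loop c0 c1 c2 c3 l x (0, 0, 0) = x"
    by (simp_all add: xyz cubic_cocycle_def)
  show "cubic_loop c0 c1 c2 c3 l (cubic_loop c0 c1 c2 c3 l (cubic_loop c0 c1 c2 c3 l x y) z) y =
    cubic_loop c0 c1 c2 c3 l x (cubic_loop c0 c1 c2 c3 l (cubic_loop c0 c1 c2 c3 l y z) y)"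
    by (simp add: xyz cubic_cocycle_def algebra_simps)
  show "cubic_loop c0 c1 c2 c3 l x y = cubic_loop c0 c1 c2 c3 l x z \<Longrightarrow> y = z"
    by (auto simp: xyz)
  show "cubic_loop c0 c1 c2 c3 l y x = cubic_loop c0 c1 c2 c3 l z x \<Longrightarrow> y = z"
    by (auto simp: xyz)
qed

lemma zmul_invariant:
  assumes "\<And>v. D (v \<triangleleft> p) = D v"
  shows "D (v \<triangleleft> zmul n p) = D v"
proof (induction n arbitrary: v rule: int_induct[where k = 0])
  case base
  then show ?case by simp
next
  case (step1 i)
  then show ?case using assms by (simp add: zmul_succ act_plus)
next
  case (step2 i)
  have "zmul (i - 1) p = - p + zmul i p"
    using zmul_add[of "-1" i p] by (simp add: zmul_minus)
  then show ?case using step2 assms by (metis act_neg(2) act_plus)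
qed

text \<open>\<open>t\<close> and \<open>f\<close> are right multiplications by
  \<open>(a1, a2, 0)\<close> and \<open>(x1, x2, 0)\<close>. The form is nonzero at the first
  vector, so every central shift is a multiple of \<open>zmul 3 t\<close>.\<close>

lemma cubic_loop_frame:
  assumes a: "cubic_form c0 c1 c2 c3 a1 a2 \<noteq> 0" and d: "a1 * x2 - a2 * x1 \<noteq> 0"
    and e0: "cubic_form c0 c1 c2 c3 x1 x2 = of_int e0 * cubic_form c0 c1 c2 c3 a1 a2"
    and e1: "cubic_form c0 c1 c2 c3 (x1 + a1) (x2 + a2) = of_int e1 * cubic_form c0 c1 c2 c3 a1 a2"
    and e2: "cubic_form c0 c1 c2 c3 (x1 - a1) (x2 - a2) = of_int e2 * cubic_form c0 c1 c2 c3 a1 a2"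
    and l: "cubic_cocycle c0 c1 c2 c3 lam x1 x2 a1 a2 - cubic_cocycle c0 c1 c2 c3 lam a1 a2 x1 x2 = of_int l * cubic_form c0 c1 c2 c3 a1 a2"
  shows "\<exists>t f. frame (cubic_loop c0 c1 c2 c3 lam) (0, 0, 0) t f e0 e1 e2 l"
proof -
  let ?L = "cubic_loop c0 c1 c2 c3 lam"
  let ?q = "cubic_form c0 c1 c2 c3"
  interpret rbol27 ?L "(0, 0, 0)" by (rule cubic_loop_rbol27)
  define Sh where "Sh c = R (0, 0, c)" for c
  have Sh: "(i, j, k) \<triangleleft> Sh c = (i, j, k + c)" for i j k c
    by (simp add: Sh_def cubic_cocycle_def)
  have Sh_add: "Sh c + Sh c' = Sh (c + c')" for c c'
    by (rule act_ext) (auto simp: act_plus Sh add.assoc)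
  have Sh_0: "Sh 0 = 0" by (rule act_ext) (auto simp: Sh)
  have Sh_zmul: "zmul n (Sh c) = Sh (of_int n * c)" for n c
  proof (induction n rule: int_induct[where k = 0])
    case base
    then show ?case by (simp add: Sh_0)
  next
    case (step1 i)
    then show ?case by (simp only: zmul_succ) (simp add: Sh_add algebra_simps)
  next
    case (step2 i)
    have "Sh c + zmul (i - 1) (Sh c) = Sh c + Sh (of_int (i - 1) * c)"
      using step2 zmul_succ[of "i - 1" "Sh c"] by (simp add: Sh_add algebra_simps)
    then show ?case by simp
  qed
  have neg: "- R (i, j, k) = R (- i, - j, - k)" for i j k
  proof -
    have "R (i, j, k) + R (- i, - j, - k) = 0"
      by (rule act_ext) (auto simp: act_plus cubic_cocycle_def algebra_simps)
    then show ?thesis by (simp only: neg_eq_iff_add_eq_0)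
  qed
  have cube: "R (i, j, k) + R (i, j, k) + R (i, j, k) = Sh (?q i j)" for i j k
    by (rule act_ext) (auto simp: act_plus Sh cubic_cocycle_def cubic_form_def algebra_simps)
  have cube2: "R (i, j, k) + R (p, r, s) + R (i, j, k) + R (p, r, s) + R (i, j, k) + R (p, r, s) = Sh (?q (i + p) (j + r))"
    for i j k p r s
    by (rule act_ext) (auto simp: act_plus Sh cubic_cocycle_def cubic_form_def algebra_simps)
  define t f where "t = R (a1, a2, 0)" and "f = R (x1, x2, 0)"
  have zmul3: "zmul 3 s = s + s + s" for s :: "(3 \<times> 3 \<times> 3) sym"
    using zmul_add[of 2 1 s] zmul_add[of 1 1 s] by simp
  have t3: "zmul 3 t = Sh (?q a1 a2)" by (simp add: zmul3 t_def cube)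
  have t3n: "zmul (3 * n) t = Sh (of_int n * ?q a1 a2)" for n
    using zmul_zmul[of n 3 t] by (simp add: t3 Sh_zmul mult.commute)
  have pf: "pre_frame ?L (0, 0, 0) t f"
  proof
    show "t \<in> S" "f \<in> S" by (simp_all add: t_def f_def)
    show "zmul 9 s = 0" if s: "s \<in> S" for s
    proof -
      obtain i j k where "s = R (i, j, k)" using s by (auto simp: S_def)
      then have "zmul 3 (zmul 3 s) = Sh (3 * ?q i j)" by (simp add: zmul3 cube Sh_add)
      then show ?thesis by (simp add: zmul_zmul Sh_0)
    qed
    have "(0, 0, 0) \<triangleleft> zmul 3 t \<noteq> (0, 0, 0)" using a by (simp add: t3 Sh)
    then show "zmul 3 t \<noteq> 0" by auto
    show "f \<noteq> zmul n t" for n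
    proof
      assume "f = zmul n t"
      \<comment> \<open>The determinant against \<open>(a1, a2)\<close> is invariant under
        \<open>t\<close> but changed by \<open>f\<close>.\<close>
      define D where "D v = (case v of (i, j, k) \<Rightarrow> a1 * j - a2 * i)" for v :: "3 \<times> 3 \<times> 3"
      have "D (v \<triangleleft> t) = D v" for v
        by (cases v) (auto simp: D_def t_def algebra_simps)
      then have "D ((0, 0, 0) \<triangleleft> f) = D (0, 0, 0)"
        using zmul_invariant[of D t] \<open>f = zmul n t\<close> by simp
      then show False using d by (simp add: D_def f_def)
    qed
  qed
  interpret pre_frame ?L "(0, 0, 0)" t f by (rule pf)
  have "frame ?L (0, 0, 0) t f e0 e1 e2 l"
  proof
    show "f + f + f = zmul (3 * e0) t" by (simp add: t3n f_def cube e0)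
    show "f + t + f + t + f + t = zmul (3 * e1) t" unfolding t3n unfolding f_def t_def cube2 e1 ..
    show "f + - t + f + - t + f + - t = zmul (3 * e2) t"
      unfolding t3n unfolding f_def t_def neg cube2 using e2 by simp
    show "(0, 0, 0) \<triangleleft> (f + t) = (0, 0, 0) \<triangleleft> (t + f + zmul (3 * l) t)"
      unfolding t3n using l by (simp add: act_plus f_def t_def Sh cubic_cocycle_def[of _ _ _ _ _ 0 0] algebra_simps)
  qed
  then show ?thesis by blast
qed

text \<open>The nonzero binary cubic forms over the field with three elements up to linear substitutions, distinguished
by their factorisations: \<open>l\<^sup>3\<close>, \<open>l\<^sup>2 m\<close>, three distinct lines, a line times an irreducible quadratic, irreducible.\<close>

definition cubic_reps :: "(3 \<times> 3 \<times> 3 \<times> 3) set" where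
  "cubic_reps = {(1, 0, 0, 0), (0, 1, 0, 0), (1, 0, 2, 0), (1, 0, 1, 0), (1, 0, 2, 1)}"

definition "realised e0 e1 e2 \<longleftrightarrow> (\<exists>c0 c1 c2 c3 a1 a2 x1 x2. (c0, c1, c2, c3) \<in> cubic_reps \<and>
  cubic_form c0 c1 c2 c3 a1 a2 \<noteq> 0 \<and> a1 * x2 - a2 * x1 \<noteq> 0 \<and>
  cubic_form c0 c1 c2 c3 x1 x2 = e0 * cubic_form c0 c1 c2 c3 a1 a2 \<and>
  cubic_form c0 c1 c2 c3 (x1 + a1) (x2 + a2) = e1 * cubic_form c0 c1 c2 c3 a1 a2 \<and>
  cubic_form c0 c1 c2 c3 (x1 - a1) (x2 - a2) = e2 * cubic_form c0 c1 c2 c3 a1 a2)"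

lemma realisedI:
  "(c0, c1, c2, c3) \<in> cubic_reps \<Longrightarrow>
  cubic_form c0 c1 c2 c3 a1 a2 \<noteq> 0 \<Longrightarrow> a1 * x2 - a2 * x1 \<noteq> 0 \<Longrightarrow>
  cubic_form c0 c1 c2 c3 x1 x2 = e0 * cubic_form c0 c1 c2 c3 a1 a2 \<Longrightarrow>
  cubic_form c0 c1 c2 c3 (x1 + a1) (x2 + a2) = e1 * cubic_form c0 c1 c2 c3 a1 a2 \<Longrightarrow>
  cubic_form c0 c1 c2 c3 (x1 - a1) (x2 - a2) = e2 * cubic_form c0 c1 c2 c3 a1 a2 \<Longrightarrow> realised e0 e1 e2"
  unfolding realised_def by blast

text \<open>A binary cubic form over this field is determined by its values on the four lines, here
  those of \<open>a\<close>, \<open>x\<close>, \<open>x + a\<close> and \<open>x - a\<close>. So the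
  27 triples are the forms normalised to 1 at \<open>a\<close>, each equivalent to a
  representative.\<close>

lemma all_realised: "realised e0 e1 e2"
proof -
  \<comment> \<open>The witnesses are the four coefficients, then \<open>a1\<close> and
    \<open>a2\<close>, then \<open>x2\<close> before \<open>x1\<close>.\<close>
  have p000: "realised 0 0 0"
    by (rule realisedI[of 1 0 2 0 1 0 1 0]) (simp_all add: cubic_form_def cubic_reps_def)
  have p001: "realised 0 0 1"
    by (rule realisedI[of 0 1 0 0 1 1 2 0]) (simp_all add: cubic_form_def cubic_reps_def)
  have p002: "realised 0 0 2"
    by (rule realisedI[of 0 1 0 0 1 1 0 2]) (simp_all add: cubic_form_def cubic_reps_def)
  have p010: "realised 0 1 0"
    by (rule realisedI[of 0 1 0 0 1 1 0 1]) (simp_all add: cubic_form_def cubic_reps_def)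
  have p011: "realised 0 1 1"
    by (rule realisedI[of 1 0 1 0 1 1 1 0]) (simp_all add: cubic_form_def cubic_reps_def)
  have p012: "realised 0 1 2"
    by (rule realisedI[of 1 0 0 0 1 0 1 0]) (simp_all add: cubic_form_def cubic_reps_def)
  have p020: "realised 0 2 0"
    by (rule realisedI[of 0 1 0 0 1 1 1 0]) (simp_all add: cubic_form_def cubic_reps_def)
  have p021: "realised 0 2 1"
    by (rule realisedI[of 1 0 1 0 1 0 1 0]) (simp_all add: cubic_form_def cubic_reps_def)
  have p022: "realised 0 2 2"
    by (rule realisedI[of 1 0 1 0 1 1 2 0]) (simp_all add: cubic_form_def cubic_reps_def)
  have p100: "realised 1 0 0"
    by (rule realisedI[of 0 1 0 0 1 1 1 2]) (simp_all add: cubic_form_def cubic_reps_def)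
  have p101: "realised 1 0 1"
    by (rule realisedI[of 1 0 1 0 1 1 0 2]) (simp_all add: cubic_form_def cubic_reps_def)
  have p102: "realised 1 0 2"
    by (rule realisedI[of 1 0 1 0 1 0 1 2]) (simp_all add: cubic_form_def cubic_reps_def)
  have p110: "realised 1 1 0"
    by (rule realisedI[of 1 0 1 0 1 1 2 1]) (simp_all add: cubic_form_def cubic_reps_def)
  have p111: "realised 1 1 1"
    by (rule realisedI[of 1 0 2 1 1 0 1 0]) (simp_all add: cubic_form_def cubic_reps_def)
  have p112: "realised 1 1 2"
    by (rule realisedI[of 1 0 2 1 0 1 0 1]) (simp_all add: cubic_form_def cubic_reps_def)
  have p120: "realised 1 2 0"
    by (rule realisedI[of 1 0 0 0 1 0 1 1]) (simp_all add: cubic_form_def cubic_reps_def)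
  have p121: "realised 1 2 1"
    by (rule realisedI[of 1 0 2 1 0 1 1 1]) (simp_all add: cubic_form_def cubic_reps_def)
  have p122: "realised 1 2 2"
    by (rule realisedI[of 1 0 2 1 0 1 1 2]) (simp_all add: cubic_form_def cubic_reps_def)
  have p200: "realised 2 0 0"
    by (rule realisedI[of 0 1 0 0 1 1 2 1]) (simp_all add: cubic_form_def cubic_reps_def)
  have p201: "realised 2 0 1"
    by (rule realisedI[of 1 0 0 0 1 0 1 2]) (simp_all add: cubic_form_def cubic_reps_def)
  have p202: "realised 2 0 2"
    by (rule realisedI[of 1 0 1 0 1 1 1 2]) (simp_all add: cubic_form_def cubic_reps_def)
  have p210: "realised 2 1 0"
    by (rule realisedI[of 1 0 1 0 1 0 1 1]) (simp_all add: cubic_form_def cubic_reps_def)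
  have p211: "realised 2 1 1"
    by (rule realisedI[of 1 0 2 1 0 1 2 1]) (simp_all add: cubic_form_def cubic_reps_def)
  have p212: "realised 2 1 2"
    by (rule realisedI[of 1 0 2 1 0 1 0 2]) (simp_all add: cubic_form_def cubic_reps_def)
  have p220: "realised 2 2 0"
    by (rule realisedI[of 1 0 1 0 1 1 0 1]) (simp_all add: cubic_form_def cubic_reps_def)
  have p221: "realised 2 2 1"
    by (rule realisedI[of 1 0 2 1 0 1 2 2]) (simp_all add: cubic_form_def cubic_reps_def)
  have p222: "realised 2 2 2"
    by (rule realisedI[of 1 0 2 1 1 0 2 0]) (simp_all add: cubic_form_def cubic_reps_def)
  show ?thesis
    using f3_cases[of e0] f3_cases[of e1] f3_cases[of e2]
    by (elim disjE) (simp_all only: p000 p001 p002 p010 p011 p012 p020 p021 p022 p100 p101 p102 p110 p111 p112 p120 p121 p122 p200 p201 p202 p210 p211 p212 p220 p221 p222)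
qed

text \<open>Negating the frame changes the sign of the cubic part of the commutator but not of its determinant part, so
the values 0 and 1 of \<open>lam\<close> suffice.\<close>

lemma frame_in_model:
  "\<exists>c0 c1 c2 c3 lam t f. (c0, c1, c2, c3) \<in> cubic_reps \<and> lam \<in> {0, 1} \<and>
    frame (cubic_loop c0 c1 c2 c3 lam) (0, 0, 0) t f e0 e1 e2 l"
proof -
  obtain c0 c1 c2 c3 a1 a2 x1 x2 where c: "(c0, c1, c2, c3) \<in> cubic_reps"
    and a: "cubic_form c0 c1 c2 c3 a1 a2 \<noteq> 0" and d: "a1 * x2 - a2 * x1 \<noteq> 0"
    and e: "cubic_form c0 c1 c2 c3 x1 x2 = of_int e0 * cubic_form c0 c1 c2 c3 a1 a2"
      "cubic_form c0 c1 c2 c3 (x1 + a1) (x2 + a2) = of_int e1 * cubic_form c0 c1 c2 c3 a1 a2"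
      "cubic_form c0 c1 c2 c3 (x1 - a1) (x2 - a2) = of_int e2 * cubic_form c0 c1 c2 c3 a1 a2"
    using all_realised[of "of_int e0" "of_int e1" "of_int e2"] unfolding realised_def by blast
  define K where "K = cubic_cocycle c0 c1 c2 c3 0 x1 x2 a1 a2 - cubic_cocycle c0 c1 c2 c3 0 a1 a2 x1 x2"
  define r where "r = of_int l * cubic_form c0 c1 c2 c3 a1 a2 - K"
  define dd where "dd = a1 * x2 - a2 * x1"
  have qn: "cubic_form c0 c1 c2 c3 (- i) (- j) = - cubic_form c0 c1 c2 c3 i j" for i j
    by (simp add: cubic_form_def algebra_simps)
  have lam: "cubic_cocycle c0 c1 c2 c3 lam x1 x2 a1 a2 - cubic_cocycle c0 c1 c2 c3 lam a1 a2 x1 x2 = K + lam * dd" for lam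
    by (simp add: cubic_cocycle_def K_def dd_def algebra_simps)
  have lamn: "cubic_cocycle c0 c1 c2 c3 lam (- x1) (- x2) (- a1) (- a2) - cubic_cocycle c0 c1 c2 c3 lam (- a1) (- a2) (- x1) (- x2)
      = - K + lam * dd" for lam
    by (simp add: cubic_cocycle_def K_def dd_def algebra_simps)
  have "dd \<noteq> 0" using d by (simp add: dd_def)
  then consider "r = 0" | "r = dd" | "r = - dd"
    using f3_cases[of r] f3_cases[of dd] by fastforce
  then show ?thesis
  proof cases
    case 1
    then have "\<exists>t f. frame (cubic_loop c0 c1 c2 c3 0) (0, 0, 0) t f e0 e1 e2 l"
      using cubic_loop_frame[OF a d e, of 0 l] lam[of 0] by (simp add: r_def)
    then show ?thesis using c by blast
  next
    case 2
    then have "K + dd = of_int l * cubic_form c0 c1 c2 c3 a1 a2" by (simp add: r_def algebra_simps)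
    then have "\<exists>t f. frame (cubic_loop c0 c1 c2 c3 1) (0, 0, 0) t f e0 e1 e2 l"
      using cubic_loop_frame[OF a d e, of 1 l] lam[of 1] by simp
    then show ?thesis using c by blast
  next
    case 3
    then have "- K + dd = of_int l * cubic_form c0 c1 c2 c3 (- a1) (- a2)" by (simp add: r_def qn algebra_simps)
    moreover have "cubic_form c0 c1 c2 c3 (- x1 + - a1) (- x2 + - a2) = - cubic_form c0 c1 c2 c3 (x1 + a1) (x2 + a2)"
      "cubic_form c0 c1 c2 c3 (- x1 - - a1) (- x2 - - a2) = - cubic_form c0 c1 c2 c3 (x1 - a1) (x2 - a2)"
      using qn[of "x1 + a1" "x2 + a2"] qn[of "x1 - a1" "x2 - a2"] by simp_all
    moreover have "(- a1) * (- x2) - (- a2) * (- x1) \<noteq> 0" using d by simp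
    moreover have "cubic_form c0 c1 c2 c3 (- a1) (- a2) \<noteq> 0" using a by (simp add: qn)
    ultimately have "\<exists>t f. frame (cubic_loop c0 c1 c2 c3 1) (0, 0, 0) t f e0 e1 e2 l"
      using e by (intro cubic_loop_frame[of c0 c1 c2 c3 "- a1" "- a2" "- x2" "- x1"]) (simp_all only: lamn qn mult_1 mult_minus_right simp_thms)
    then show ?thesis using c by blast
  qed
qed

context rbol27
begin

lemma exp9_class:
  assumes nine: "\<And>s. s \<in> S \<Longrightarrow> zmul 9 s = 0" and a: "a \<in> S" "zmul 3 a \<noteq> 0"
  shows "\<exists>c0 c1 c2 c3 lam h. (c0, c1, c2, c3) \<in> cubic_reps \<and> lam \<in> {0, 1} \<and> bij h \<and>
    (\<forall>v w. h (v \<cdot> w) = cubic_loop c0 c1 c2 c3 lam (h v) (h w))"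
proof -
  have "card ((\<lambda>n::int. zmul n a) ` {0..<9}) \<le> card {0..<9::int}" by (rule card_image_le) simp
  then have "\<not> S \<subseteq> (\<lambda>n::int. zmul n a) ` {0..<9}"
    using card_mono[of "(\<lambda>n::int. zmul n a) ` {0..<9}" S] card_S by auto
  then obtain f where f: "f \<in> S" "f \<notin> (\<lambda>n::int. zmul n a) ` {0..<9}" by blast
  have "f \<noteq> zmul n a" for n
    using f(2) zmul_mod[OF nine[OF a(1)], of n] by (auto simp: image_iff dest: bspec[of _ _ "n mod 9"])
  then interpret pre_frame mul e a f
    using a f nine by unfold_locales auto
  obtain e0 e1 e2 l where F: "frame mul e a f e0 e1 e2 l" using frame_exists by blast
  obtain c0 c1 c2 c3 lam t' f' where c: "(c0, c1, c2, c3) \<in> cubic_reps" "lam \<in> {0, 1}"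
    and G: "frame (cubic_loop c0 c1 c2 c3 lam) (0, 0, 0) t' f' e0 e1 e2 l"
    using frame_in_model by blast
  interpret two_frames mul e a f "cubic_loop c0 c1 c2 c3 lam" "(0, 0, 0)" t' f' e0 e1 e2 l
    using F G by (simp add: two_frames_def)
  show ?thesis using c phi_bij phi_mul by blast
qed

end

subsection \<open>Representatives and invariants\<close>

text \<open>Left cancellation follows from right cancellation: the Bol law with the left inverse
  \<open>i x\<close> recovers \<open>m w x\<close> from \<open>m x w\<close>.\<close>

lemma rbolI:
  fixes m :: "'a::finite \<Rightarrow> 'a \<Rightarrow> 'a" and i :: "'a \<Rightarrow> 'a"
  assumes eL: "\<And>x. m e x = x" and eR: "\<And>x. m x e = x"
    and bol: "\<And>x y z. m (m (m x y) z) y = m x (m (m y z) y)"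
    and rip: "\<And>x y. m (m x y) (i y) = x" and inv: "\<And>x. m (i x) x = e"
  shows "rbol m e"
proof
  fix x y z :: 'a
  show inj: "y = z" if "m y x = m z x" for x y z using that rip by metis
  assume "m x y = m x z"
  moreover have "m w x = m (i x) (m (m x w) x)" for w
    using bol[of "i x" x w] by (simp add: inv eL)
  ultimately have "m y x = m z x" by metis
  then show "y = z" by (rule inj)
qed (rule eL eR bol)+

lemma card_v: "CARD(3 \<times> 3 \<times> 3) = 27"
  by (simp add: card_prod)

lemma additive_loop_rbol27: "rbol27 additive_loop (0, 0, 0)"
proof -
  have "rbol additive_loop (0, 0, 0)"
    by (rule rbolI[where i = "\<lambda>(i, j, k). (- i, - j, - k)"]) (auto simp: algebra_simps)
  then show ?thesis by (simp add: rbol27_def rbol27_axioms_def card_v)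
qed

text \<open>For fixed third coordinates the corrections are linear, so the Bol law becomes linear
  algebra after a case split.\<close>

lemma companion_loop_table:
  "companion_loop_b 0 0 0 m1 m2 = m1" "companion_loop_a 0 0 0 m1 m2 = 0"
  "companion_loop_b 0 0 1 m1 m2 = m1" "companion_loop_a 0 0 1 m1 m2 = 0"
  "companion_loop_b 0 0 2 m1 m2 = m1" "companion_loop_a 0 0 2 m1 m2 = 0"
  "companion_loop_b 1 1 0 m1 m2 = m1 + m2" "companion_loop_a 1 1 0 m1 m2 = m2"
  "companion_loop_b 1 1 1 m1 m2 = 2 * m1 + m2" "companion_loop_a 1 1 1 m1 m2 = 2 * m1 + 2 * m2"
  "companion_loop_b 1 1 2 m1 m2 = m1" "companion_loop_a 1 1 2 m1 m2 = 2 * m1 + m2"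
  "companion_loop_b 2 0 0 m1 m2 = m1" "companion_loop_a 2 0 0 m1 m2 = 2 * m2"
  "companion_loop_b 2 0 1 m1 m2 = 2 * m1 + m2" "companion_loop_a 2 0 1 m1 m2 = m1 + m2"
  "companion_loop_b 2 0 2 m1 m2 = 2 * m1 + 2 * m2" "companion_loop_a 2 0 2 m1 m2 = 2 * m1 + m2"
  by (simp_all add: companion_loop_a_def companion_loop_b_def companion_loop_d_def algebra_simps)

lemma companion_loop_rbol27:
  assumes "(p, q) \<in> {(0, 0), (1, 1), (2, 0)}"
  shows "rbol27 (companion_loop p q) (0, 0, 0)"
proof -
  have "rbol (companion_loop p q) (0, 0, 0)"
  proof (rule rbolI[where i = "\<lambda>(i, j, k). (- i, - j, - k)"])
    fix x y z :: "3 \<times> 3 \<times> 3"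
    obtain i j a k m b u v c where xyz: "x = (i, j, a)" "y = (k, m, b)" "z = (u, v, c)"
      by (metis prod_cases3)
    show "companion_loop p q (0, 0, 0) x = x" "companion_loop p q x (0, 0, 0) = x"
      by (simp_all add: xyz companion_loop_a_def companion_loop_b_def)
    show "companion_loop p q (case x of (i, j, k) \<Rightarrow> (- i, - j, - k)) x = (0, 0, 0)"
      by (simp add: xyz companion_loop_a_def companion_loop_b_def)
    consider "p = 0" "q = 0" | "p = 1" "q = 1" | "p = 2" "q = 0" using assms by auto
    note pq = this
    from pq show "companion_loop p q (companion_loop p q x y) (case y of (i, j, k) \<Rightarrow> (- i, - j, - k)) = x"
      using f3_cases[of a] f3_cases[of b]
      by cases (elim disjE; simp add: xyz companion_loop_table algebra_simps)+
    from pq show "companion_loop p q (companion_loop p q (companion_loop p q x y) z) y = companion_loop p q x (companion_loop p q (companion_loop p q y z) y)"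
      using f3_cases[of a] f3_cases[of b] f3_cases[of c]
      by cases (elim disjE; simp add: xyz companion_loop_table algebra_simps)+
  qed
  then show ?thesis by (simp add: rbol27_def rbol27_axioms_def card_v)
qed

text \<open>Replacing \<open>W\<close> and \<open>T\<close> by their negatives changes the sign of
  the matrix, hence that of \<open>q\<close>.\<close>

lemma companion_loop_12_11:
  "(\<lambda>(i, j, k). (i, - j, - k)) (companion_loop 1 2 v w) = companion_loop 1 1 ((\<lambda>(i, j, k). (i, - j, - k)) v) ((\<lambda>(i, j, k). (i, - j, - k)) w)"
proof -
  obtain i j a k m b where vw: "v = (i, j, a)" "w = (k, m, b)" by (metis prod_cases3)
  show ?thesis
    using f3_cases[of a] f3_cases[of b]
    by (elim disjE) (simp_all add: vw companion_loop_a_def companion_loop_b_def companion_loop_d_def algebra_simps)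
qed

section \<open>Isomorphisms and invariants\<close>

lemma magma_isoI:
  "bij_betw f G H \<Longrightarrow> (\<And>x y. x \<in> G \<Longrightarrow> y \<in> G \<Longrightarrow> f (m x y) = n (f x) (f y)) \<Longrightarrow> magma_iso G m H n"
  unfolding magma_iso_def by blast

definition closed_on :: "'a set \<Rightarrow> ('a \<Rightarrow> 'a \<Rightarrow> 'a) \<Rightarrow> bool" where
  "closed_on G m \<longleftrightarrow> (\<forall>x\<in>G. \<forall>y\<in>G. m x y \<in> G)"

lemma magma_iso_refl: "magma_iso G m G m"
  by (rule magma_isoI[of id]) auto

lemma magma_iso_sym: "closed_on G m \<Longrightarrow> magma_iso G m H n \<Longrightarrow> magma_iso H n G m"
proof -
  assume G: "closed_on G m" and "magma_iso G m H n"
  then obtain f where f: "bij_betw f G H" "\<And>x y. x \<in> G \<Longrightarrow> y \<in> G \<Longrightarrow> f (m x y) = n (f x) (f y)"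
    unfolding magma_iso_def by blast
  show ?thesis
  proof (rule magma_isoI)
    show "bij_betw (inv_into G f) H G" using bij_betw_inv_into[OF f(1)] .
    fix x y assume "x \<in> H" "y \<in> H"
    then obtain u w where "u \<in> G" "w \<in> G" "x = f u" "y = f w"
      using f(1) by (metis bij_betw_imp_surj_on imageE)
    moreover have "inj_on f G" using f(1) by (simp add: bij_betw_def)
    ultimately show "inv_into G f (n x y) = m (inv_into G f x) (inv_into G f y)"
      using G f(2)[of u w] by (metis closed_on_def inv_into_f_f)
  qed
qed

lemma magma_iso_trans:
  assumes "magma_iso G m H n" "magma_iso H n K p"
  shows "magma_iso G m K p"
proof -
  obtain f where f: "bij_betw f G H" "\<And>x y. x \<in> G \<Longrightarrow> y \<in> G \<Longrightarrow> f (m x y) = n (f x) (f y)"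
    using assms(1) unfolding magma_iso_def by blast
  obtain g where g: "bij_betw g H K" "\<And>x y. x \<in> H \<Longrightarrow> y \<in> H \<Longrightarrow> g (n x y) = p (g x) (g y)"
    using assms(2) unfolding magma_iso_def by blast
  show ?thesis
  proof (rule magma_isoI)
    show "bij_betw (g \<circ> f) G K" using bij_betw_trans[OF f(1) g(1)] .
    fix x y assume "x \<in> G" "y \<in> G"
    moreover from this have "f x \<in> H" "f y \<in> H" using bij_betwE[OF f(1)] by auto
    ultimately show "(g \<circ> f) (m x y) = p ((g \<circ> f) x) ((g \<circ> f) y)" by (simp add: f(2) g(2))
  qed
qed

text \<open>An identity-free form of the automorphic inverse property: for the extensions above it holds exactly when
\<open>lam = 0\<close>.\<close>

definition bruck_id :: "'a set \<Rightarrow> ('a \<Rightarrow> 'a \<Rightarrow> 'a) \<Rightarrow> bool" where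
  "bruck_id G m \<longleftrightarrow> (\<forall>x\<in>G. \<forall>y\<in>G. m (m x y) (m x y) = m (m y (m x x)) y)"

text \<open>Found by computer search; it tells the two loops of exponent 3 with trivial centre apart.\<close>

definition sep_id :: "'a set \<Rightarrow> ('a \<Rightarrow> 'a \<Rightarrow> 'a) \<Rightarrow> bool" where
  "sep_id G m \<longleftrightarrow> (\<forall>x\<in>G. \<forall>y\<in>G. m (m x x) (m (m (m y y) (m y x)) x) = m x (m (m x x) (m (m y y) (m y x))))"

text \<open>In a loop an idempotent cube is trivial.\<close>

definition idem_cubes :: "'a set \<Rightarrow> ('a \<Rightarrow> 'a \<Rightarrow> 'a) \<Rightarrow> 'a set" where
  "idem_cubes G m = {x \<in> G. m (m (m x x) x) (m (m x x) x) = m (m x x) x}"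

text \<open>The guard on the last entry confines the evaluation of \<open>sep_id\<close> to the
  nonassociative loops of exponent 3.\<close>

definition signature :: "'a set \<Rightarrow> ('a \<Rightarrow> 'a \<Rightarrow> 'a) \<Rightarrow> nat \<times> bool \<times> bool \<times> bool" where
  "signature G m = (card (idem_cubes G m), bruck_id G m, is_associative_on G m,
     card (idem_cubes G m) = 27 \<and> \<not> is_associative_on G m \<and> sep_id G m)"

lemma signature_iso:
  assumes G: "closed_on G m" and iso: "magma_iso G m H n"
  shows "signature H n = signature G m"
proof -
  obtain f where f: "bij_betw f G H" "\<And>x y. x \<in> G \<Longrightarrow> y \<in> G \<Longrightarrow> n (f x) (f y) = f (m x y)"
    using iso unfolding magma_iso_def by metis
  have H: "H = f ` G" using f(1) by (simp add: bij_betw_def)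
  have inj: "inj_on f G" using f(1) by (simp add: bij_betw_def)
  have eq: "f x = f y \<longleftrightarrow> x = y" if "x \<in> G" "y \<in> G" for x y
    using inj that by (simp add: inj_on_eq_iff)
  have c: "m x y \<in> G" if "x \<in> G" "y \<in> G" for x y using G that by (simp add: closed_on_def)
  have "is_associative_on H n = is_associative_on G m"
    by (simp add: is_associative_on_def H f c eq)
  moreover have "bruck_id H n = bruck_id G m"
    by (simp add: bruck_id_def H f c eq)
  moreover have "sep_id H n = sep_id G m"
    by (simp add: sep_id_def H f c eq)
  moreover have "idem_cubes H n = f ` idem_cubes G m"
    by (auto simp: idem_cubes_def H f c eq)
  moreover have "card (f ` idem_cubes G m) = card (idem_cubes G m)"
    using inj by (intro card_image) (auto simp: idem_cubes_def inj_on_def)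
  ultimately show ?thesis by (simp add: signature_def)
qed

lemma right_bol_iso:
  assumes m: "is_right_bol_loop G m" and iso: "magma_iso G m H n"
  shows "is_right_bol_loop H n"
proof -
  obtain f where f: "bij_betw f G H" "\<And>x y. x \<in> G \<Longrightarrow> y \<in> G \<Longrightarrow> n (f x) (f y) = f (m x y)"
    using iso unfolding magma_iso_def by metis
  have H: "H = f ` G" using f(1) by (simp add: bij_betw_def)
  have inj: "inj_on f G" using f(1) by (simp add: bij_betw_def)
  have c: "m x y \<in> G" if "x \<in> G" "y \<in> G" for x y
    using m that by (simp add: is_right_bol_loop_def is_loop_def)
  obtain e where e: "e \<in> G" "\<And>x. x \<in> G \<Longrightarrow> m e x = x \<and> m x e = x"
    using m by (auto simp: is_right_bol_loop_def is_loop_def)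
  have b: "bij_betw g' H H" if g: "bij_betw g G G" and gg: "\<And>x. x \<in> G \<Longrightarrow> g' (f x) = f (g x)" for g g'
  proof -
    have "bij_betw (f \<circ> (g \<circ> inv_into G f)) H H"
      using bij_betw_trans[OF bij_betw_trans[OF bij_betw_inv_into[OF f(1)] g] f(1)] by (simp add: comp_assoc)
    moreover have "(f \<circ> (g \<circ> inv_into G f)) y = g' y" if "y \<in> H" for y
      using that gg inj by (auto simp: H inv_into_f_f)
    ultimately show ?thesis using bij_betw_cong[of H "f \<circ> (g \<circ> inv_into G f)" g' H] by blast
  qed
  have "is_loop H n"
    unfolding is_loop_def
  proof (intro conjI)
    show "\<forall>x\<in>H. \<forall>y\<in>H. n x y \<in> H" by (auto simp: H f c)
    show "\<exists>e\<in>H. \<forall>x\<in>H. n e x = x \<and> n x e = x" using e by (auto simp: H f intro!: bexI[of _ e])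
    show "\<forall>a\<in>H. bij_betw (n a) H H \<and> bij_betw (\<lambda>x. n x a) H H"
    proof
      fix a assume "a \<in> H"
      then obtain u where u: "u \<in> G" "a = f u" by (auto simp: H)
      have "bij_betw (m u) G G" "bij_betw (\<lambda>x. m x u) G G"
        using m u(1) by (auto simp: is_right_bol_loop_def is_loop_def)
      then show "bij_betw (n a) H H \<and> bij_betw (\<lambda>x. n x a) H H"
        using b[of "m u" "n a"] b[of "\<lambda>x. m x u" "\<lambda>x. n x a"] u by (simp add: f)
    qed
  qed
  moreover have "\<forall>x\<in>G. \<forall>y\<in>G. \<forall>z\<in>G. m (m (m x y) z) y = m x (m (m y z) y)"
    using m by (simp add: is_right_bol_loop_def)
  ultimately show ?thesis by (simp add: is_right_bol_loop_def H f c)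
qed

lemma rbol27_right_bol:
  assumes "rbol27 m e"
  shows "is_right_bol_loop UNIV m"
proof -
  interpret rbol27 m e by fact
  have "bij (m a)" for a
    using injL by (simp add: bij_def inj_def finite_UNIV_inj_surj)
  moreover have "bij (\<lambda>x. m x a)" for a
    using injR by (simp add: bij_def inj_def finite_UNIV_inj_surj)
  ultimately show ?thesis
    using bol by (auto simp: is_right_bol_loop_def is_loop_def intro!: exI[of _ e])
qed

lemma right_bol_rbol27:
  fixes m :: "'a::finite \<Rightarrow> 'a \<Rightarrow> 'a"
  assumes m: "is_right_bol_loop UNIV m" and c: "CARD('a) = 27"
  shows "\<exists>e. rbol27 m e"
proof -
  obtain e where e: "\<And>x. m e x = x \<and> m x e = x"
    using m by (auto simp: is_right_bol_loop_def is_loop_def)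
  have inj: "inj (m a)" "inj (\<lambda>x. m x a)" for a
    using m by (auto simp: is_right_bol_loop_def is_loop_def bij_def)
  have bol: "m (m (m x y) z) y = m x (m (m y z) y)" for x y z
    using m by (simp add: is_right_bol_loop_def)
  have "rbol27 m e"
  proof
    show "m e x = x" "m x e = x" for x using e by auto
    show "m (m (m x y) z) y = m x (m (m y z) y)" for x y z by (rule bol)
    show "m x y = m x z \<Longrightarrow> y = z" for x y z using inj(1)[of x] by (auto dest: injD)
    show "m y x = m z x \<Longrightarrow> y = z" for x y z using inj(2)[of x] by (auto dest: injD)
  qed (rule c)
  then show ?thesis by blast
qed

lemma right_bol_closed: "is_right_bol_loop G m \<Longrightarrow> closed_on G m"
  by (simp add: is_right_bol_loop_def is_loop_def closed_on_def)

section \<open>The fifteen representatives\<close>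

definition enc :: "3 \<times> 3 \<times> 3 \<Rightarrow> nat" where
  "enc = (SOME f. bij_betw f UNIV {0..<27})"

lemma enc: "bij_betw enc UNIV {0..<27}"
proof -
  have "\<exists>f. bij_betw f (UNIV :: (3 \<times> 3 \<times> 3) set) {0..<27::nat}"
    by (intro finite_same_card_bij) (simp_all add: card_v)
  then show ?thesis unfolding enc_def by (rule someI_ex)
qed

definition on27 :: "(3 \<times> 3 \<times> 3 \<Rightarrow> 3 \<times> 3 \<times> 3 \<Rightarrow> 3 \<times> 3 \<times> 3) \<Rightarrow> nat \<Rightarrow> nat \<Rightarrow> nat" where
  "on27 M x y = enc (M (inv enc x) (inv enc y))"

lemma on27_iso: "magma_iso UNIV M {0..<27} (on27 M)"
  by (rule magma_isoI[OF enc]) (use enc in \<open>simp add: on27_def bij_betw_def\<close>)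

lemma type_copy:
  fixes m :: "nat \<Rightarrow> nat \<Rightarrow> nat"
  shows "\<exists>M. magma_iso {0..<27} m (UNIV :: (3 \<times> 3 \<times> 3) set) M"
proof -
  have "magma_iso {0..<27} m UNIV (\<lambda>u w. inv enc (m (enc u) (enc w)))"
  proof (rule magma_isoI)
    show "bij_betw (inv enc) {0..<27} UNIV" using bij_betw_inv_into[OF enc] .
    fix x y :: nat assume "x \<in> {0..<27}" "y \<in> {0..<27}"
    then have "enc (inv enc x) = x" "enc (inv enc y) = y"
      using enc by (auto simp: bij_betw_def intro!: f_inv_into_f)
    then show "inv enc (m x y) = inv enc (m (enc (inv enc x)) (enc (inv enc y)))" by simp
  qed
  then show ?thesis by blast
qed

text \<open>The groups are the first three entries (cyclic, elementary abelian, Heisenberg) and the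
  two with form \<open>1 0 0 0\<close>.\<close>

definition reps :: "(nat \<Rightarrow> nat \<Rightarrow> nat) list" where
  "reps = [\<lambda>x y. (x + y) mod 27, on27 additive_loop, on27 (companion_loop 0 0), on27 (companion_loop 1 1), on27 (companion_loop 2 0),
    on27 (cubic_loop 1 0 0 0 0), on27 (cubic_loop 1 0 0 0 1), on27 (cubic_loop 0 1 0 0 0), on27 (cubic_loop 0 1 0 0 1),
    on27 (cubic_loop 1 0 2 0 0), on27 (cubic_loop 1 0 2 0 1), on27 (cubic_loop 1 0 1 0 0), on27 (cubic_loop 1 0 1 0 1),
    on27 (cubic_loop 1 0 2 1 0), on27 (cubic_loop 1 0 2 1 1)]"

lemma (in rbol27) classification:
  "\<exists>r\<in>set reps. magma_iso UNIV mul {0..<27} r"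
proof -
  have fromh: "magma_iso UNIV mul {0..<27} (on27 M)" if "bij h" "\<And>v w. h (M v w) = h v \<cdot> h w" "rbol27 M e'" for h M e'
  proof -
    have "magma_iso UNIV M UNIV mul" using that by (intro magma_isoI[of h]) auto
    then have "magma_iso UNIV mul UNIV M" by (rule magma_iso_sym[rotated]) (simp add: closed_on_def)
    then show ?thesis using magma_iso_trans on27_iso by blast
  qed
  consider (cyc) a where "a \<in> S" "zmul 9 a \<noteq> 0"
    | (nine) a where "a \<in> S" "zmul 3 a \<noteq> 0" "\<And>s. s \<in> S \<Longrightarrow> zmul 9 s = 0"
    | (three) "\<And>s. s \<in> S \<Longrightarrow> zmul 3 s = 0" by blast
  then show ?thesis
  proof cases
    case cyc
    then obtain h where h: "bij_betw h {0..<27::nat} UNIV" "\<And>x y. h ((x + y) mod 27) = h x \<cdot> h y"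
      using cyclic by blast
    have "magma_iso {0..<27::nat} (\<lambda>x y. (x + y) mod 27) UNIV mul"
      using h by (intro magma_isoI[of h]) auto
    then have "magma_iso UNIV mul {0..<27::nat} (\<lambda>x y. (x + y) mod 27)"
      by (rule magma_iso_sym[rotated]) (simp add: closed_on_def)
    then show ?thesis by (auto simp: reps_def)
  next
    case nine
    then obtain c0 c1 c2 c3 lam h where c: "(c0, c1, c2, c3) \<in> cubic_reps" "lam \<in> {0, 1}"
      and h: "bij h" "\<And>v w. h (v \<cdot> w) = cubic_loop c0 c1 c2 c3 lam (h v) (h w)"
      using exp9_class[of a] by blast
    have "magma_iso UNIV mul UNIV (cubic_loop c0 c1 c2 c3 lam)" using h by (intro magma_isoI[of h]) auto
    then have "magma_iso UNIV mul {0..<27} (on27 (cubic_loop c0 c1 c2 c3 lam))" using magma_iso_trans on27_iso by blast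
    moreover have "on27 (cubic_loop c0 c1 c2 c3 lam) \<in> set reps"
      using c by (auto simp: cubic_reps_def reps_def)
    ultimately show ?thesis by blast
  next
    case three
    have zmul3: "zmul 3 s = s + s + s" for s :: "'a sym"
      using zmul_add[of 2 1 s] zmul_add[of 1 1 s] by simp
    interpret exp3 mul e by unfold_locales (use three zmul3 in auto)
    from exp3_class show ?thesis
    proof (elim disjE exE conjE)
      fix h :: "3 \<times> 3 \<times> 3 \<Rightarrow> 'a" assume "bij h" "\<forall>v w. h (additive_loop v w) = h v \<cdot> h w"
      then have "magma_iso UNIV mul {0..<27} (on27 additive_loop)" using fromh additive_loop_rbol27 by blast
      then show ?thesis by (auto simp: reps_def)
    next
      fix p q and h :: "3 \<times> 3 \<times> 3 \<Rightarrow> 'a"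
      assume pq: "(p, q) \<in> {(0, 0), (1, 1), (1, 2), (2, 0)}" and h: "bij h" "\<forall>v w. h (companion_loop p q v w) = h v \<cdot> h w"
      show ?thesis
      proof (cases "(p, q) = (1, 2)")
        case False
        then have "(p, q) \<in> {(0, 0), (1, 1), (2, 0)}" using pq by auto
        then have "magma_iso UNIV mul {0..<27} (on27 (companion_loop p q))" using fromh[OF h(1)] h(2) companion_loop_rbol27 by blast
        then show ?thesis using pq False by (auto simp: reps_def)
      next
        case True
        define g where "g = (\<lambda>(i, j, k). (i, - j, - k) :: 3 \<times> 3 \<times> 3)"
        have gg: "g (g v) = v" for v by (cases v) (simp add: g_def)
        have "bij g" using gg by (metis bijI')
        have "h (g (companion_loop 1 1 v w)) = h (g v) \<cdot> h (g w)" for v w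
        proof -
          have "g (companion_loop 1 1 v w) = g (companion_loop 1 1 (g (g v)) (g (g w)))" by (simp add: gg)
          also have "\<dots> = companion_loop 1 2 (g v) (g w)"
            unfolding g_def companion_loop_12_11[symmetric] unfolding g_def[symmetric] by (rule gg)
          finally show ?thesis using h(2)[rule_format, of "g v" "g w"] True by simp
        qed
        moreover have "bij (h \<circ> g)" using h(1) \<open>bij g\<close> by (simp add: bij_comp)
        ultimately have "magma_iso UNIV mul {0..<27} (on27 (companion_loop 1 1))"
          using fromh[of "h \<circ> g" "companion_loop 1 1"] companion_loop_rbol27[of 1 1] by simp
        then show ?thesis by (auto simp: reps_def)
      qed
    qed
  qed
qed

lemma UNIV_3: "(UNIV :: 3 set) = {0, 1, 2}"
  using f3_cases by auto

lemma card_triples: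
  "card {v :: 3 \<times> 3 \<times> 3. P v} = (\<Sum>i\<in>{0, 1, 2}. \<Sum>j\<in>{0, 1, 2}. \<Sum>k\<in>{0, 1, 2}. if P (i, j, k) then 1 else 0)"
proof -
  have "card {v :: 3 \<times> 3 \<times> 3. P v} = (\<Sum>v\<in>UNIV. if P v then 1 else 0)"
    by (simp add: sum.If_cases)
  also have "(UNIV :: (3 \<times> 3 \<times> 3) set) = {0, 1, 2} \<times> {0, 1, 2} \<times> {0, 1, 2}"
    using UNIV_3 by (metis UNIV_Times_UNIV)
  finally show ?thesis by (simp only: sum.cartesian_product')
qed

text \<open>Cubes are trivial exactly over the zeros of the form, so the count is three times the
  number of zeros: 9, 15, 21, 9 and 3 for the five forms.\<close>

lemma cubic_loop_cubes: "card (idem_cubes UNIV (cubic_loop c0 c1 c2 c3 l)) = card {v :: 3 \<times> 3 \<times> 3. case v of (i, j, k) \<Rightarrow> cubic_form c0 c1 c2 c3 i j = 0}"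
proof -
  have "cubic_loop c0 c1 c2 c3 l (cubic_loop c0 c1 c2 c3 l (i, j, k) (i, j, k)) (i, j, k) = (0, 0, cubic_form c0 c1 c2 c3 i j)" for i j k
    by (simp add: cubic_cocycle_def cubic_form_def algebra_simps)
  then show ?thesis by (intro arg_cong[where f = card]) (auto simp: idem_cubes_def cubic_cocycle_def)
qed

lemma cubic_loop_bruck: "bruck_id UNIV (cubic_loop c0 c1 c2 c3 0)" "\<not> bruck_id UNIV (cubic_loop c0 c1 c2 c3 1)"
proof -
  show "bruck_id UNIV (cubic_loop c0 c1 c2 c3 0)"
    unfolding bruck_id_def by (auto simp: cubic_cocycle_def algebra_simps)
  show "\<not> bruck_id UNIV (cubic_loop c0 c1 c2 c3 1)"
  proof
    let ?L = "cubic_loop c0 c1 c2 c3 1"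
    let ?x = "(1, 0, 0)" and ?y = "(0, 1, 0)"
    assume "bruck_id UNIV ?L"
    then have "?L (?L ?x ?y) (?L ?x ?y) = ?L (?L ?y (?L ?x ?x)) ?y" unfolding bruck_id_def by blast
    then show False by (simp add: cubic_cocycle_def algebra_simps)
  qed
qed

text \<open>Associativity separates the two forms with count 9, and the cyclic group from the
  irreducible form; \<open>bruck_id\<close> separates the two loops of each form.\<close>

lemma reps_signature:
  "map (signature {0..<27}) reps =
   [(3, True, True, False), (27, True, True, False), (27, False, True, False), (27, False, False, False),
    (27, False, False, True), (9, True, True, False), (9, False, True, False), (15, True, False, False),
    (15, False, False, False), (21, True, False, False), (21, False, False, False), (9, True, False, False),
    (9, False, False, False), (3, True, False, False), (3, False, False, False)]"
proof -
  have on27: "signature {0..<27} (on27 M) = signature UNIV M" for M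
    by (rule signature_iso[OF _ on27_iso]) (simp add: closed_on_def)
  have Z27: "signature {0..<27::nat} (\<lambda>x y. (x + y) mod 27) = (3, True, True, False)"
  proof -
    have "((x + x) mod 27 + x) mod 27 = (3 * x) mod 27" for x :: nat
    proof -
      have "x + x + x = 3 * x" by simp
      then show ?thesis by (simp only: mod_add_left_eq)
    qed
    moreover have "((3 * x) mod 27 + (3 * x) mod 27) mod 27 = (3 * x) mod 27 \<longleftrightarrow> x = 0 \<or> x = 9 \<or> x = 18"
      if "x < 27" for x :: nat
    proof -
      have "(y + y) mod 27 = y \<longleftrightarrow> y = 0" if "y < 27" for y :: nat
        using that by (cases "y + y < 27") (auto simp: le_mod_geq)
      from this[of "(3 * x) mod 27"]
      have "((3 * x) mod 27 + (3 * x) mod 27) mod 27 = (3 * x) mod 27 \<longleftrightarrow> 27 dvd 3 * x"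
        by (simp only: mod_eq_0_iff_dvd)
      also have "\<dots> \<longleftrightarrow> 9 dvd x" using nat_mult_dvd_cancel_disj[of 3 9 x] by simp
      also have "\<dots> \<longleftrightarrow> x = 0 \<or> x = 9 \<or> x = 18" using that by presburger
      finally show ?thesis .
    qed
    ultimately have "idem_cubes {0..<27::nat} (\<lambda>x y. (x + y) mod 27) = {0, 9, 18}"
      by (auto simp: idem_cubes_def)
    moreover have "bruck_id {0..<27::nat} (\<lambda>x y. (x + y) mod 27)"
      unfolding bruck_id_def by (simp only: mod_simps) (simp add: algebra_simps)
    moreover have "is_associative_on {0..<27::nat} (\<lambda>x y. (x + y) mod 27)"
      by (simp add: is_associative_on_def mod_simps algebra_simps)
    ultimately show ?thesis by (simp add: signature_def)
  qed
  have cubesV0: "card (idem_cubes UNIV additive_loop) = 27"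
  proof -
    have "idem_cubes UNIV additive_loop = UNIV" by (auto simp: idem_cubes_def)
    then show ?thesis using card_v by simp
  qed
  have cubesME: "card (idem_cubes UNIV (companion_loop p q)) = 27" for p q
  proof -
    have "companion_loop p q (companion_loop p q v v) v = (0, 0, 0)" for v
      by (cases v) (simp add: companion_loop_a_def companion_loop_b_def)
    then have "idem_cubes UNIV (companion_loop p q) = UNIV" by (auto simp: idem_cubes_def companion_loop_a_def companion_loop_b_def)
    then show ?thesis using card_v by simp
  qed
  have additive_loop: "signature UNIV additive_loop = (27, True, True, False)"
    by (auto simp: signature_def cubesV0 bruck_id_def is_associative_on_def algebra_simps)
  have companion_loop_bruck: "\<not> bruck_id UNIV (companion_loop p q)" if "(p, q) \<in> {(0, 0), (1, 1), (2, 0)}" for p q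
  proof
    let ?x = "(1, 0, 0)" and ?y = "(0, 0, 1)"
    assume "bruck_id UNIV (companion_loop p q)"
    then have "companion_loop p q (companion_loop p q ?x ?y) (companion_loop p q ?x ?y) = companion_loop p q (companion_loop p q ?y (companion_loop p q ?x ?x)) ?y"
      unfolding bruck_id_def by blast
    then show False using that by (auto simp: companion_loop_a_def companion_loop_b_def companion_loop_d_def)
  qed
  have companion_loop_assoc: "\<not> is_associative_on UNIV (companion_loop p q)" if "(p, q) \<in> {(1, 1), (2, 0)}" for p q
  proof
    let ?x = "(1, 0, 0)" and ?y = "(0, 0, 1)"
    assume A: "is_associative_on UNIV (companion_loop p q)"
    then have "companion_loop p q (companion_loop p q ?x ?y) ?y = companion_loop p q ?x (companion_loop p q ?y ?y)"
      "companion_loop p q (companion_loop p q ?y ?x) ?y = companion_loop p q ?y (companion_loop p q ?x ?y)" "companion_loop p q (companion_loop p q ?y ?y) ?x = companion_loop p q ?y (companion_loop p q ?y ?x)"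
      unfolding is_associative_on_def by blast+
    then show False using that by (auto simp: companion_loop_a_def companion_loop_b_def companion_loop_d_def)
  qed
  have companion_loop00: "signature UNIV (companion_loop 0 0) = (27, False, True, False)"
    using companion_loop_bruck by (auto simp: signature_def cubesME is_associative_on_def companion_loop_a_def companion_loop_b_def companion_loop_d_def algebra_simps)
  have companion_loop11: "signature UNIV (companion_loop 1 1) = (27, False, False, False)"
  proof -
    have "\<not> sep_id UNIV (companion_loop 1 1)"
    proof
      let ?x = "(0, 0, 1)" and ?y = "(0, 1, 1)" and ?m = "companion_loop 1 1"
      assume "sep_id UNIV (companion_loop 1 1)"
      then have "?m (?m ?x ?x) (?m (?m (?m ?y ?y) (?m ?y ?x)) ?x) = ?m ?x (?m (?m ?x ?x) (?m (?m ?y ?y) (?m ?y ?x)))"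
        unfolding sep_id_def by blast
      then show False by (simp add: companion_loop_a_def companion_loop_b_def companion_loop_d_def)
    qed
    then show ?thesis using companion_loop_bruck[of 1 1] companion_loop_assoc[of 1 1] by (simp add: signature_def cubesME)
  qed
  have companion_loop20: "signature UNIV (companion_loop 2 0) = (27, False, False, True)"
  proof -
    have "sep_id UNIV (companion_loop 2 0)"
      unfolding sep_id_def
    proof (intro ballI)
      fix x y :: "3 \<times> 3 \<times> 3"
      obtain i j k u v w where "x = (i, j, k)" "y = (u, v, w)" by (metis prod_cases3)
      then show "companion_loop 2 0 (companion_loop 2 0 x x) (companion_loop 2 0 (companion_loop 2 0 (companion_loop 2 0 y y) (companion_loop 2 0 y x)) x) =
        companion_loop 2 0 x (companion_loop 2 0 (companion_loop 2 0 x x) (companion_loop 2 0 (companion_loop 2 0 y y) (companion_loop 2 0 y x)))"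
        using f3_cases[of k] f3_cases[of w]
        by (elim disjE) (simp_all add: companion_loop_a_def companion_loop_b_def companion_loop_d_def algebra_simps)
    qed
    then show ?thesis using companion_loop_bruck[of 2 0] companion_loop_assoc[of 2 0] by (simp add: signature_def cubesME)
  qed
  have c: "card (idem_cubes UNIV (cubic_loop 1 0 0 0 l)) = 9" "card (idem_cubes UNIV (cubic_loop 0 1 0 0 l)) = 15"
    "card (idem_cubes UNIV (cubic_loop 1 0 2 0 l)) = 21" "card (idem_cubes UNIV (cubic_loop 1 0 1 0 l)) = 9"
    "card (idem_cubes UNIV (cubic_loop 1 0 2 1 l)) = 3" for l
    by (simp_all add: cubic_loop_cubes card_triples cubic_form_def)
  have cubic_loop_assoc: "is_associative_on UNIV (cubic_loop 1 0 0 0 l)" for l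
    by (auto simp: is_associative_on_def cubic_cocycle_def algebra_simps)
  have cubic_loop_nonassoc: "\<not> is_associative_on UNIV (cubic_loop c0 c1 c2 c3 l)" if "c1 \<noteq> 0 \<or> c2 \<noteq> 0" for c0 c1 c2 c3 l
  proof
    let ?x = "(1, 0, 0)" and ?y = "(0, 1, 0)" and ?m = "cubic_loop c0 c1 c2 c3 l"
    assume "is_associative_on UNIV (cubic_loop c0 c1 c2 c3 l)"
    then have "?m (?m ?x ?x) ?y = ?m ?x (?m ?x ?y)" "?m (?m ?x ?y) ?x = ?m ?x (?m ?y ?x)"
      "?m (?m ?y ?x) ?x = ?m ?y (?m ?x ?x)" "?m (?m ?x ?y) ?y = ?m ?x (?m ?y ?y)"
      "?m (?m ?y ?x) ?y = ?m ?y (?m ?x ?y)" "?m (?m ?y ?y) ?x = ?m ?y (?m ?y ?x)"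
      unfolding is_associative_on_def by blast+
    then show False using that f3_cases[of c1] f3_cases[of c2] by (auto simp: cubic_cocycle_def)
  qed
  show ?thesis
    by (simp add: reps_def on27 Z27 additive_loop companion_loop00 companion_loop11 companion_loop20)
      (simp add: signature_def c cubic_loop_bruck cubic_loop_assoc cubic_loop_nonassoc)
qed

lemma reps_bol: "r \<in> set reps \<Longrightarrow> r \<in> bol27"
proof -
  have on27: "on27 M \<in> bol27" if "rbol27 M e" for M e
    using right_bol_iso[OF rbol27_right_bol[OF that] on27_iso] by (simp add: bol27_def)
  have Z27: "(\<lambda>x y :: nat. (x + y) mod 27) \<in> bol27"
  proof -
    have le: "x = y" if "x \<le> y" "y < 27" "(a + y) mod 27 = (a + x) mod 27" for a x y :: nat
    proof -
      have "27 dvd (a + y) - (a + x)" using that by (subst mod_eq_dvd_iff_nat[symmetric]) auto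
      then have "27 dvd y - x" by simp
      then have "\<not> 0 < y - x" using that(2) by (auto dest: dvd_imp_le)
      then show ?thesis using that(1) by simp
    qed
    have inj: "inj_on (\<lambda>x. (a + x) mod 27) {0..<27}" for a :: nat
      by (rule inj_onI) (metis le atLeastLessThan_iff nat_le_linear)
    have bij: "bij_betw (\<lambda>x. (a + x) mod 27) {0..<27} {0..<27}" for a :: nat
    proof -
      have "(\<lambda>x. (a + x) mod 27) ` {0..<27} = {0..<27}"
        by (rule endo_inj_surj[OF _ _ inj]) auto
      then show ?thesis using inj by (simp add: bij_betw_def)
    qed
    have "is_loop {0..<27} (\<lambda>x y :: nat. (x + y) mod 27)"
      unfolding is_loop_def using bij by (auto simp: add.commute intro!: bexI[of _ 0])
    then show ?thesis
      unfolding bol27_def is_right_bol_loop_def mem_Collect_eq by (simp only: mod_simps) (simp add: algebra_simps)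
  qed
  assume "r \<in> set reps"
  then show ?thesis
    using Z27 on27[OF additive_loop_rbol27] on27[OF cubic_loop_rbol27] on27[OF companion_loop_rbol27[of 0 0]] on27[OF companion_loop_rbol27[of 1 1]]
      on27[OF companion_loop_rbol27[of 2 0]]
    by (auto simp: reps_def)
qed

section \<open>Counting isomorphism classes\<close>

lemma bol27_closed: "m \<in> bol27 \<Longrightarrow> closed_on {0..<27} m"
  by (simp add: bol27_def right_bol_closed)

lemma iso27_equiv: "equiv bol27 iso27"
proof (rule equivI)
  show "refl_on bol27 iso27"
    by (auto simp: refl_on_def iso27_def magma_iso_refl)
  show "sym iso27"
    by (auto simp: sym_def iso27_def intro: magma_iso_sym bol27_closed)
  show "trans iso27"
    by (auto simp: trans_def iso27_def intro: magma_iso_trans)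
qed (auto simp: iso27_def)

lemma reps_cover:
  assumes "m \<in> bol27"
  shows "\<exists>r\<in>set reps. (m, r) \<in> iso27"
proof -
  obtain M :: "3 \<times> 3 \<times> 3 \<Rightarrow> 3 \<times> 3 \<times> 3 \<Rightarrow> 3 \<times> 3 \<times> 3" where M: "magma_iso {0..<27} m UNIV M"
    using type_copy by blast
  then have "is_right_bol_loop UNIV M"
    using assms right_bol_iso by (auto simp: bol27_def)
  then obtain e where "rbol27 M e" using right_bol_rbol27[OF _ card_v] by blast
  then obtain r where "r \<in> set reps" "magma_iso UNIV M {0..<27} r"
    using rbol27.classification by blast
  then show ?thesis
    using M assms reps_bol magma_iso_trans[OF M] by (auto simp: iso27_def)
qed

lemma iso27_signature: "(m, n) \<in> iso27 \<Longrightarrow> signature {0..<27} m = signature {0..<27} n"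
  using signature_iso[OF bol27_closed] by (fastforce simp: iso27_def)

lemma signature_inj: "distinct reps" "inj_on (signature {0..<27}) (set reps)"
proof -
  have "distinct (map (signature {0..<27}) reps)" by (simp add: reps_signature)
  then show "distinct reps" "inj_on (signature {0..<27}) (set reps)"
    by (simp_all add: distinct_map)
qed

text \<open>A predicate that factors through the signature is constant on isomorphism classes, and
  each class has one representative; so filtering the list of signatures counts classes.\<close>

lemma card_quotient:
  assumes P: "\<And>m. P m = Q (signature {0..<27} m)"
  shows "card ({m \<in> bol27. P m} // iso27) = length (filter Q (map (signature {0..<27}) reps))"
proof -
  let ?A = "{r \<in> set reps. P r}"
  have "{m \<in> bol27. P m} // iso27 = (\<lambda>r. iso27 `` {r}) ` ?A"
  proof (intro subset_antisym subsetI)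
    fix c assume "c \<in> {m \<in> bol27. P m} // iso27"
    then obtain m where m: "m \<in> bol27" "P m" "c = iso27 `` {m}" by (auto simp: quotient_def)
    obtain r where r: "r \<in> set reps" "(m, r) \<in> iso27" using reps_cover[OF m(1)] by blast
    then have "c = iso27 `` {r}" using m(3) equiv_class_eq[OF iso27_equiv] by blast
    moreover have "P r" using m(2) iso27_signature[OF r(2)] by (simp add: P)
    ultimately show "c \<in> (\<lambda>r. iso27 `` {r}) ` ?A" using r(1) by blast
  next
    fix c assume "c \<in> (\<lambda>r. iso27 `` {r}) ` ?A"
    then show "c \<in> {m \<in> bol27. P m} // iso27" using reps_bol by (auto simp: quotient_def)
  qed
  moreover have "inj_on (\<lambda>r. iso27 `` {r}) ?A"
  proof (rule inj_onI)
    fix r s assume rs: "r \<in> ?A" "s \<in> ?A" "iso27 `` {r} = iso27 `` {s}"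
    then have "(r, s) \<in> iso27"
      using eq_equiv_class[OF _ iso27_equiv] reps_bol by blast
    then show "r = s" using iso27_signature signature_inj(2) rs by (auto dest: inj_onD)
  qed
  ultimately have "card ({m \<in> bol27. P m} // iso27) = card ?A" by (simp add: card_image)
  also have "?A = set (filter P reps)" by simp
  also have "card \<dots> = length (filter P reps)"
    using signature_inj(1) by (intro distinct_card) simp
  finally have "card ({m \<in> bol27. P m} // iso27) = length (filter P reps)" .
  moreover have "Q \<circ> signature {0..<27} = P" by (rule ext) (simp add: P)
  ultimately show ?thesis by (simp only: filter_map length_map)
qed

theorem theorem5p2:
  shows "card (bol27 // iso27) = 15
       \<and> card ({m \<in> bol27. is_associative_on {0..<27} m} // iso27) = 5
       \<and> card ({m \<in> bol27. \<not> is_associative_on {0..<27} m} // iso27) = 10"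
proof (intro conjI)
  have "card ({m \<in> bol27. True} // iso27) = 15"
    by (subst card_quotient[where Q = "\<lambda>_. True"]) (simp_all add: reps_signature)
  then show "card (bol27 // iso27) = 15" by simp
  show "card ({m \<in> bol27. is_associative_on {0..<27} m} // iso27) = 5"
    by (subst card_quotient[where Q = "\<lambda>(_, _, a, _). a"]) (simp_all add: reps_signature signature_def)
  show "card ({m \<in> bol27. \<not> is_associative_on {0..<27} m} // iso27) = 10"
    by (subst card_quotient[where Q = "\<lambda>(_, _, a, _). \<not> a"]) (simp_all add: reps_signature signature_def)
qed

end
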